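(* Let $G\in L^1_{loc}(\mathbb{R}^d)$ be real-valued such that $\|G\ast\varphi_n\|_{L^2(\mathbb{R}^d)}\to0$ for every sequence $(\varphi_n)\subset\mathcal{D}(\mathbb{R}^d)$ converging to $0$ in $\mathcal{D}(\mathbb{R}^d)$. Let $\dot L$ be a Lévy white noise with characteristic triplet $(a,\gamma,\nu)$ such that $\mathbb{E}|\langle\dot L,\varphi\rangle|<\infty$ and $\mathbb{E}\langle\dot L,\varphi\rangle=0$ for every $\varphi\in\mathcal{D}(\mathbb{R}^d)$. For $R>0$ let $G_R(x):=\int_{B_R(x)}|G(y)|\lambda^d(dy)$. If for all $R>0$ $$\int_{\mathbb{R}}\mathbf{1}_{|r|>1}|r|\int_{1/|r|}^{\infty} d_{G_R}(\alpha)\lambda^1(d\alpha)\,\nu(dr)<\infty\quad\text{and}\quad \int_{\mathbb{R}}\mathbf{1}_{|r|>1}|r|^2\int_0^{1/|r|}\alpha\, d_{G_R}(\alpha)\lambda^1(d\alpha)\,\nu(dr)<\infty,$$ then $s(\varphi):=\langle\dot L,G\ast\varphi\rangle$, $\varphi\in\mathcal{D}(\mathbb{R}^d)$, defines a stationary generalized random process.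
   Context: $(\Omega,\mathcal{F},\mathcal{P})$ is a probability space and $L^0(\Omega)$ denotes the real random variables, with convergence meaning convergence in probability. $\mathcal{D}(\mathbb{R}^d)$ is the space of infinitely differentiable compactly supported functions $\mathbb{R}^d\to\mathbb{R}$, with $\varphi_n\to\varphi$ meaning that all supports lie in a common compact set and $\sup_x|D^\alpha(\varphi_n-\varphi)(x)|\to0$ for every multi-index $\alpha$. A generalized random process is a map $s:\mathcal{D}(\mathbb{R}^d)\to L^0(\Omega)$ that is linear (almost surely) and continuous ($\varphi_n\to\varphi$ in $\mathcal{D}$ implies $s(\varphi_n)\to s(\varphi)$ in probability). A Lévy white noise with characteristic triplet $(a,\gamma,\nu)$ ($a\ge0$, $\gamma\in\mathbb{R}$, $\nu$ a Lévy measure on $\mathbb{R}$) is a generalized random process $\dot L$ with $\mathbb{E}\exp(i\langle\dot L,\varphi\rangle)=\exp\big(\int_{\mathbb{R}^d}\psi(\varphi(x))\lambda^d(dx)\big)$, $\psi(z)=i\gamma z-\tfrac12 az^2+\int_{\mathbb{R}}(e^{ixz}-1-ixz\mathbf{1}_{|x|\le1})\nu(dx)$. $\dot L$ extends to a Lévy basis $L$ and $\langle\dot L,f\rangle:=\int f\,dL$ for every measurable $f$ integrable with respect to $L$ in the sense of Rajput and Rosiński. A generalized process $s$ is stationary if for every $t\in\mathbb{R}^d$ the process $\varphi\mapsto\langle s,\varphi(\cdot-t)\rangle$ has the same law as $s$. $d_f(\alpha):=\lambda^d(\{x:|f(x)|>\alpha\})$; $B_R(x)$ is the open Euclidean ball.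 *)

theory Defs
  imports "HOL-Probability.Probability"
begin

text \<open>Iterated directional (Frechet) derivatives along a list of directions.
  For lists of standard basis vectors these are the partial derivatives D^alpha.\<close>
fun dirderiv :: "'a::euclidean_space list \<Rightarrow> ('a \<Rightarrow> real) \<Rightarrow> ('a \<Rightarrow> real)" where
  "dirderiv [] f = f"
| "dirderiv (v # vs) f = (\<lambda>x. frechet_derivative (dirderiv vs f) (at x) v)"

definition smooth_fun :: "('a::euclidean_space \<Rightarrow> real) \<Rightarrow> bool" where
  "smooth_fun f \<longleftrightarrow> (\<forall>vs. set vs \<subseteq> Basis \<longrightarrow> (\<forall>x. dirderiv vs f differentiable (at x)))"

definition test_fun :: "('a::euclidean_space \<Rightarrow> real) \<Rightarrow> bool" where
  "test_fun f \<longleftrightarrow> smooth_fun f \<and> bounded {x. f x \<noteq> 0}"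

definition D_conv :: "(nat \<Rightarrow> 'a::euclidean_space \<Rightarrow> real) \<Rightarrow> ('a \<Rightarrow> real) \<Rightarrow> bool" where
  "D_conv phis phi \<longleftrightarrow>
     (\<forall>n. test_fun (phis n)) \<and> test_fun phi \<and>
     (\<exists>K. compact K \<and> {x. phi x \<noteq> 0} \<subseteq> K \<and> (\<forall>n. {x. phis n x \<noteq> 0} \<subseteq> K)) \<and>
     (\<forall>vs. set vs \<subseteq> Basis \<longrightarrow>
        uniform_limit UNIV (\<lambda>n. dirderiv vs (\<lambda>x. phis n x - phi x)) (\<lambda>_. 0) sequentially)"

definition conv_prob :: "'w measure \<Rightarrow> (nat \<Rightarrow> 'w \<Rightarrow> real) \<Rightarrow> ('w \<Rightarrow> real) \<Rightarrow> bool" where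
  "conv_prob M X Y \<longleftrightarrow> (\<forall>n. X n \<in> borel_measurable M) \<and> Y \<in> borel_measurable M \<and>
     (\<forall>e>0. (\<lambda>n. measure M {\<omega>\<in>space M. e < \<bar>X n \<omega> - Y \<omega>\<bar>}) \<longlonglongrightarrow> 0)"

definition gen_random_process :: "'w measure \<Rightarrow> (('a::euclidean_space \<Rightarrow> real) \<Rightarrow> 'w \<Rightarrow> real) \<Rightarrow> bool" where
  "gen_random_process M s \<longleftrightarrow>
     (\<forall>phi. test_fun phi \<longrightarrow> s phi \<in> borel_measurable M) \<and>
     (\<forall>phi psi a b. test_fun phi \<longrightarrow> test_fun psi \<longrightarrow>
        (AE \<omega> in M. s (\<lambda>x. a * phi x + b * psi x) \<omega> = a * s phi \<omega> + b * s psi \<omega>)) \<and>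
     (\<forall>phis phi. D_conv phis phi \<longrightarrow> conv_prob M (\<lambda>n. s (phis n)) (s phi))"

definition stationary_process :: "'w measure \<Rightarrow> (('a::euclidean_space \<Rightarrow> real) \<Rightarrow> 'w \<Rightarrow> real) \<Rightarrow> bool" where
  "stationary_process M s \<longleftrightarrow>
     (\<forall>t::'a. distr M (Pi\<^sub>M {phi. test_fun phi} (\<lambda>_. borel)) (\<lambda>\<omega>. \<lambda>phi\<in>{phi. test_fun phi}. s (\<lambda>x. phi (x - t)) \<omega>)
            = distr M (Pi\<^sub>M {phi. test_fun phi} (\<lambda>_. borel)) (\<lambda>\<omega>. \<lambda>phi\<in>{phi. test_fun phi}. s phi \<omega>))"

definition levy_measure :: "real measure \<Rightarrow> bool" where
  "levy_measure nu \<longleftrightarrow> sets nu = sets borel \<and> emeasure nu {0} = 0 \<and>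
     (\<integral>\<^sup>+ x. ennreal (min 1 (x\<^sup>2)) \<partial>nu) < \<infinity>"

definition levy_triplet :: "real \<Rightarrow> real \<Rightarrow> real measure \<Rightarrow> bool" where
  "levy_triplet a \<gamma> nu \<longleftrightarrow> a \<ge> 0 \<and> levy_measure nu"

definition levy_exponent :: "real \<Rightarrow> real \<Rightarrow> real measure \<Rightarrow> real \<Rightarrow> complex" where
  "levy_exponent a \<gamma> nu z =
     \<i> * of_real (\<gamma> * z) - of_real (a * z\<^sup>2 / 2)
     + (\<integral> x. cis (x * z) - 1 - \<i> * of_real (x * z) * (if \<bar>x\<bar> \<le> 1 then 1 else 0) \<partial>nu)"

definition levy_white_noise ::
  "'w measure \<Rightarrow> real \<Rightarrow> real \<Rightarrow> real measure \<Rightarrow> (('a::euclidean_space \<Rightarrow> real) \<Rightarrow> 'w \<Rightarrow> real) \<Rightarrow> bool" where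
  "levy_white_noise M a \<gamma> nu Ld \<longleftrightarrow> levy_triplet a \<gamma> nu \<and> gen_random_process M Ld \<and>
     (\<forall>phi. test_fun phi \<longrightarrow>
        (\<integral>\<omega>. cis (Ld phi \<omega>) \<partial>M) = exp (\<integral>x. levy_exponent a \<gamma> nu (phi x) \<partial>(lborel :: 'a measure)))"

definition bsets :: "'a::euclidean_space set set" where
  "bsets = {A. A \<in> sets lborel \<and> bounded A}"

definition levy_basis ::
  "'w measure \<Rightarrow> real \<Rightarrow> real \<Rightarrow> real measure \<Rightarrow> ('a::euclidean_space set \<Rightarrow> 'w \<Rightarrow> real) \<Rightarrow> bool" where
  "levy_basis M a \<gamma> nu L \<longleftrightarrow> levy_triplet a \<gamma> nu \<and>
     (\<forall>A\<in>bsets. L A \<in> borel_measurable M) \<and>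
     (\<forall>A\<in>bsets. \<forall>z. (\<integral>\<omega>. cis (z * L A \<omega>) \<partial>M) = exp (of_real (measure lborel A) * levy_exponent a \<gamma> nu z)) \<and>
     (\<forall>(I::nat set) A. finite I \<longrightarrow> (\<forall>i\<in>I. A i \<in> bsets) \<longrightarrow> disjoint_family_on A I \<longrightarrow>
        prob_space.indep_vars M (\<lambda>_. borel) (\<lambda>i. L (A i)) I) \<and>
     (\<forall>A. range A \<subseteq> bsets \<longrightarrow> disjoint_family A \<longrightarrow> \<Union>(range A) \<in> bsets \<longrightarrow>
        (AE \<omega> in M. (\<lambda>n. L (A n) \<omega>) sums L (\<Union>(range A)) \<omega>))"

text \<open>Rajput-Rosinski integral: X is (a version of) the integral of f over R^d w.r.t. L.
  Simple functions are sum_{j<ns n} cs n j * indicator (As n j) with As n j bounded Borel.\<close>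
definition RR_integral ::
  "'w measure \<Rightarrow> ('a::euclidean_space set \<Rightarrow> 'w \<Rightarrow> real) \<Rightarrow> ('a \<Rightarrow> real) \<Rightarrow> ('w \<Rightarrow> real) \<Rightarrow> bool" where
  "RR_integral M L f X \<longleftrightarrow> f \<in> borel_measurable lborel \<and>
     (\<exists>(ns :: nat \<Rightarrow> nat) (cs :: nat \<Rightarrow> nat \<Rightarrow> real) (As :: nat \<Rightarrow> nat \<Rightarrow> 'a set).
        (\<forall>n j. As n j \<in> bsets) \<and>
        (AE x in lborel. (\<lambda>n. \<Sum>j<ns n. cs n j * indicator (As n j) x) \<longlonglongrightarrow> f x) \<and>
        (\<forall>B\<in>sets lborel. \<exists>Y. conv_prob M (\<lambda>n \<omega>. \<Sum>j<ns n. cs n j * L (B \<inter> As n j) \<omega>) Y) \<and>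
        conv_prob M (\<lambda>n \<omega>. \<Sum>j<ns n. cs n j * L (As n j) \<omega>) X)"

definition locally_integrable :: "('a::euclidean_space \<Rightarrow> real) \<Rightarrow> bool" where
  "locally_integrable G \<longleftrightarrow> G \<in> borel_measurable lborel \<and>
     (\<forall>K. compact K \<longrightarrow> set_integrable lborel K G)"

definition convolution :: "('a::euclidean_space \<Rightarrow> real) \<Rightarrow> ('a \<Rightarrow> real) \<Rightarrow> 'a \<Rightarrow> real" where
  "convolution G phi = (\<lambda>x. \<integral>y. G y * phi (x - y) \<partial>lborel)"

definition distfun :: "('a::euclidean_space \<Rightarrow> real) \<Rightarrow> real \<Rightarrow> ennreal" where
  "distfun f \<alpha> = emeasure (lborel :: 'a measure) {x. \<bar>f x\<bar> > \<alpha>}"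

definition G_R :: "('a::euclidean_space \<Rightarrow> real) \<Rightarrow> real \<Rightarrow> 'a \<Rightarrow> real" where
  "G_R G R x = (\<integral>y\<in>ball x R. \<bar>G y\<bar> \<partial>lborel)"

end

theory Submission
  imports Defs
begin

text \<open>Let \<open>H\<close> be the Huber function. Integrability and vanishing mean of the noise
  force \<open>\<integral>\<^bsub>\<bar>r\<bar>>1\<^esub> \<bar>r\<bar> \<nu>(dr) < \<infinity>\<close> and \<open>\<psi>(z) = - a z\<^sup>2 / 2 + \<integral> (e\<^bsup>irz\<^esup> - 1 - irz) \<nu>(dr)\<close>, so that
  \<open>\<bar>\<psi>(z)\<bar> \<le> 4 \<Phi>(z)\<close> with \<open>\<Phi>(z) = a z\<^sup>2 / 2 + \<integral> H(rz) \<nu>(dr)\<close>. The modular \<open>\<integral> \<Phi>(f(x)) dx\<close> controls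
  \<open>1 - E exp(iz \<integral> f dL)\<close>, hence the tails of \<open>\<integral> f dL\<close>, and every \<open>f\<close> with finite modular is
  integrable by approximation with simple functions. Since \<open>\<bar>G * \<phi>\<bar> \<le> sup \<bar>\<phi>\<bar> \<cdot> G\<^sub>R\<close>, the layer cake formula for
  \<open>H\<close> turns the two conditions on the distribution function of \<open>G\<^sub>R\<close> into finiteness of the large jump part of the
  modular of \<open>G * \<phi>\<close>; the rest is bounded by the \<open>L\<^sup>2\<close> norm. Linearity rests on uniqueness of the
  integral, continuity on the tail bound, and stationarity on the translation invariance of
  the characteristic functions of all linear combinations.\<close>

section \<open>A Huber-type function\<close>

text \<open>On the positive half line H is the primitive of the minimum of u and 1: quadratic near
  0, linear at infinity, with a derivative that changes its formula exactly at 1. Rescaled to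
  \<open>1 / \<bar>r\<bar>\<close>, this break point is the one that separates the two hypotheses on
  the distribution function, so together they are the large jump part of the modular of
  \<open>G_R\<close>, not merely a bound for it. Three obstacles shape the proof. The definition of
  the integral admits any step functions whose integrals converge over every Borel set and gives no
  control of the modular along them; uniqueness therefore needs a gliding hump instead of a norm
  estimate. The noise is known only through its characteristic functional, so the moment of the Levy
  measure has to be extracted from values of 1 - cos at dyadic scales. Finally \<open>s\<close> is
  an arbitrary choice of versions: linearity holds up to null sets that depend on the arguments, and
  a law on an uncountable product is recovered from finitely many coordinates at a time.\<close>

definition huber :: "real \<Rightarrow> real" where
  "huber u = (if \<bar>u\<bar> \<le> 1 then u\<^sup>2 / 2 else \<bar>u\<bar> - 1 / 2)"

lemma borel_measurable_huber [measurable]: "huber \<in> borel_measurable borel"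
  unfolding huber_def by measurable

lemma huber_nonneg [simp]: "0 \<le> huber u"
  by (auto simp: huber_def)

lemma huber_0 [simp]: "huber 0 = 0"
  by (simp add: huber_def)

lemma huber_abs [simp]: "huber \<bar>u\<bar> = huber u"
  by (simp add: huber_def)

lemma huber_le_sq: "huber u \<le> u\<^sup>2 / 2"
  using zero_le_power2[of "\<bar>u\<bar> - 1"] by (simp add: huber_def power2_diff)

lemma huber_le_abs: "huber u \<le> \<bar>u\<bar>"
proof (cases "\<bar>u\<bar> \<le> 1")
  case True
  have "\<bar>u\<bar> * \<bar>u\<bar> \<le> \<bar>u\<bar> * 1" using True by (intro mult_left_mono) auto
  then show ?thesis using True by (simp add: huber_def power2_eq_square)
qed (simp add: huber_def)

lemma huber_mono:
  assumes "\<bar>u\<bar> \<le> \<bar>v\<bar>" shows "huber u \<le> huber v"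
proof (cases "\<bar>v\<bar> \<le> 1")
  case True
  then show ?thesis using assms abs_le_square_iff[of u v] by (simp add: huber_def)
next
  case False
  show ?thesis
  proof (cases "\<bar>u\<bar> \<le> 1")
    case True
    have "\<bar>u\<bar>\<^sup>2 \<le> 1\<^sup>2" using True by (intro power_mono) auto
    with True False show ?thesis by (simp add: huber_def)
  qed (use False assms in \<open>simp add: huber_def\<close>)
qed

text \<open>H grows at least linearly and at most quadratically, so a dilation by c costs at most
  the larger of the two powers. This is the Delta-2 property of the modular, and for 0 <= c <= 1 it
  yields the factor c that later cancels a division by c.\<close>

lemma huber_scale: "huber (c * u) \<le> max \<bar>c\<bar> (c\<^sup>2) * huber u"
proof -
  have main: "huber (c * v) \<le> max c (c\<^sup>2) * huber v" if c: "0 \<le> c" and v: "0 \<le> v" for c v :: real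
  proof (cases "c \<le> 1")
    case True
    have "c * c \<le> c * 1" using True c by (intro mult_left_mono) auto
    then have m: "max c (c\<^sup>2) = c" by (simp add: power2_eq_square max_def)
    show ?thesis
    proof (cases "v \<le> 1")
      case v1: True
      have cv: "c * v \<le> 1" using mult_le_one[OF True v v1] .
      have "c * c * v\<^sup>2 \<le> c * v\<^sup>2" using \<open>c * c \<le> c * 1\<close> by (intro mult_right_mono) auto
      with v1 cv show ?thesis using c v unfolding m by (simp add: huber_def power2_eq_square ac_simps)
    next
      case v1: False
      show ?thesis
      proof (cases "c * v \<le> 1")
        case True
        have "(c * v) * (c * v) \<le> (c * v) * 1" using True c v by (intro mult_left_mono) auto
        moreover have "c * 1 \<le> c * v" using v1 c by (intro mult_left_mono) auto
        ultimately show ?thesis using True v1 c v unfolding m by (simp add: huber_def power2_eq_square algebra_simps)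
      next
        case cv: False
        then show ?thesis using True v1 c v by (simp add: m huber_def algebra_simps)
      qed
    qed
  next
    case False
    then have c1: "1 \<le> c" by simp
    have "c * 1 \<le> c * c" using c1 by (intro mult_left_mono) auto
    then have m: "max c (c\<^sup>2) = c\<^sup>2" by (simp add: power2_eq_square max_def)
    show ?thesis
    proof (cases "v \<le> 1")
      case v1: True
      have "huber (c * v) \<le> (c * v)\<^sup>2 / 2" by (rule huber_le_sq)
      then show ?thesis using v1 v by (simp add: m huber_def power_mult_distrib)
    next
      case v1: False
      have "1 * 1 \<le> c * v" using c1 v1 by (intro mult_mono) auto
      have "c * 1 \<le> c * v" using v1 c by (intro mult_left_mono) auto
      then have "(c + 1) / 2 \<le> c * v" using \<open>1 * 1 \<le> c * v\<close> by simp
      \<comment> \<open>The product is the factorisation of c^2 (v - 1/2) - (c v - 1/2), the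
        difference of the two sides when c v and v both exceed 1.\<close>
      then have "0 \<le> (c - 1) * (c * v - (c + 1) / 2)" using c1 by (intro mult_nonneg_nonneg) auto
      then have "c * v - 1/2 \<le> c\<^sup>2 * (v - 1/2)" by (simp add: field_simps power2_eq_square)
      then show ?thesis using v1 v c by (cases "c * v \<le> 1") (use \<open>1 * 1 \<le> c * v\<close> in \<open>auto simp: m huber_def\<close>)
    qed
  qed
  show ?thesis using main[of "\<bar>c\<bar>" "\<bar>u\<bar>"] by (simp add: abs_mult[symmetric])
qed

text \<open>Below 1 the Taylor bound u^2/2 is H itself. Above 1 the bound 2|u| is compared with H;
  the comparison is tight at |u| = 1, where H is 1/2, and this fixes the constant 4.\<close>

lemma cis_approx_huber: "norm (cis u - 1 - \<i> * u) \<le> 4 * huber u"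
proof (cases "\<bar>u\<bar> \<le> 1")
  case True
  have "norm (cis u - 1 - \<i> * u) \<le> \<bar>u\<bar>\<^sup>2 / 2"
    using iexp_approx1[of u 1] by (simp add: cis_conv_exp algebra_simps numeral_2_eq_2)
  also have "\<dots> = huber u" using True by (simp add: huber_def)
  also have "\<dots> \<le> 4 * huber u" using huber_nonneg[of u] by linarith
  finally show ?thesis .
next
  case False
  have "norm (cis u - 1 - \<i> * u) \<le> 2 * \<bar>u\<bar>"
    using iexp_approx2[of u 1] by (simp add: cis_conv_exp algebra_simps)
  then show ?thesis using False by (simp add: huber_def)
qed

text \<open>The right side is chosen to telescope under halving of u with weights 2^k. In H(u) - 2
  H(u/2) the linear parts cancel, which leaves 1/2 for large u. The factor 8 makes the right side
  equal to 2 at |u| = 1, and from there on it stays above 2, the trivial bound for 1 - cos.\<close>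

lemma one_minus_cos_le_huber: "1 - cos u \<le> 8 * (huber u - 2 * huber (u / 2))"
proof -
  have "(sin (u / 2))\<^sup>2 \<le> (u / 2)\<^sup>2"
    using abs_sin_x_le_abs_x[of "u / 2"] by (simp only: abs_le_square_iff)
  then have "1 - cos u \<le> u\<^sup>2 / 2"
    using cos_double_sin[of "u / 2"] by (simp add: power_divide)
  have "1 - cos u \<le> 2" using cos_ge_minus_one[of u] by simp
  consider "\<bar>u\<bar> \<le> 1" | "1 < \<bar>u\<bar>" "\<bar>u\<bar> \<le> 2" | "2 < \<bar>u\<bar>" by linarith
  then show ?thesis
  proof cases
    case 1
    then have "huber u = u\<^sup>2 / 2" "huber (u / 2) = huber u / 4"
      by (auto simp: huber_def power_divide)
    then have "8 * (huber u - 2 * huber (u / 2)) = 4 * huber u" "1 - cos u \<le> huber u"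
      using \<open>1 - cos u \<le> u\<^sup>2 / 2\<close> by simp_all
    then show ?thesis using huber_nonneg[of u] by linarith
  next
    case 2
    have "0 \<le> (\<bar>u\<bar> - 1) * (3 - \<bar>u\<bar>)" using 2 by (intro mult_nonneg_nonneg) auto
    then have "u\<^sup>2 + 3 \<le> 4 * \<bar>u\<bar>" by (simp add: algebra_simps power2_eq_square)
    moreover have "8 * (huber u - 2 * huber (u / 2)) = 8 * \<bar>u\<bar> - 4 - 2 * u\<^sup>2"
      using 2 by (simp add: huber_def power_divide)
    ultimately show ?thesis using \<open>1 - cos u \<le> 2\<close> by linarith
  next
    case 3
    then show ?thesis using \<open>1 - cos u \<le> 2\<close> by (simp add: huber_def field_simps)
  qed
qed

lemma nn_integral_Ioo_id:
  fixes b :: real assumes "0 \<le> b"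
  shows "(\<integral>\<^sup>+\<alpha>. indicator {0<..<b} \<alpha> * ennreal \<alpha> \<partial>lborel) = ennreal (b\<^sup>2 / 2)"
proof -
  have "(\<integral>\<^sup>+\<alpha>. indicator {0<..<b} \<alpha> * ennreal \<alpha> \<partial>lborel) = (\<integral>\<^sup>+\<alpha>. ennreal \<alpha> * indicator {0..b} \<alpha> \<partial>lborel)"
  proof (intro nn_integral_cong_AE)
    have "AE \<alpha> in lborel. \<alpha> \<noteq> 0" "AE \<alpha> in lborel. \<alpha> \<noteq> b" by (rule AE_lborel_singleton)+
    then show "AE \<alpha> in lborel. indicator {0<..<b} \<alpha> * ennreal \<alpha> = ennreal \<alpha> * indicator {0..b} \<alpha>"
      by eventually_elim (auto split: split_indicator)
  qed
  also have "\<dots> = ennreal (b\<^sup>2 / 2 - 0\<^sup>2 / 2)"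
    using assms by (intro nn_integral_FTC_Icc[where F="\<lambda>x. x\<^sup>2 / 2"]) (auto intro!: derivative_eq_intros)
  finally show ?thesis by simp
qed

text \<open>Since H has derivative min(v, 1) for v >= 0, H(rho g) is the integral over 0 < alpha < g
  of rho min(rho alpha, 1). The weight is rho^2 alpha below 1/rho and rho above. It vanishes for
  negative alpha, so the unbounded interval below g does no harm.\<close>

lemma huber_layer_cake:
  assumes "0 < \<rho>" "0 \<le> g"
  shows "ennreal (huber (\<rho> * g)) = (\<integral>\<^sup>+\<alpha>. indicator {..<g} \<alpha> *
     (ennreal \<rho> * indicator {1/\<rho><..} \<alpha> + ennreal (\<rho>\<^sup>2) * (indicator {0<..<1/\<rho>} \<alpha> * ennreal \<alpha>)) \<partial>lborel)"
proof -
  have "(\<integral>\<^sup>+\<alpha>. indicator {..<g} \<alpha> *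
     (ennreal \<rho> * indicator {1/\<rho><..} \<alpha> + ennreal (\<rho>\<^sup>2) * (indicator {0<..<1/\<rho>} \<alpha> * ennreal \<alpha>)) \<partial>lborel)
    = (\<integral>\<^sup>+\<alpha>. ennreal \<rho> * indicator {1/\<rho><..<g} \<alpha> + ennreal (\<rho>\<^sup>2) * (indicator {0<..<min g (1/\<rho>)} \<alpha> * ennreal \<alpha>) \<partial>lborel)"
    by (intro nn_integral_cong) (auto split: split_indicator)
  also have "\<dots> = ennreal \<rho> * emeasure lborel {1/\<rho><..<g} + ennreal (\<rho>\<^sup>2) * ennreal ((min g (1/\<rho>))\<^sup>2 / 2)"
    using assms by (simp add: nn_integral_add nn_integral_cmult nn_integral_Ioo_id)
  also have "\<dots> = ennreal (huber (\<rho> * g))"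
  proof (cases "\<rho> * g \<le> 1")
    case True
    then have "g \<le> 1 / \<rho>" using assms by (simp add: field_simps)
    moreover from this have "{1/\<rho><..<g} = {}" by auto
    ultimately show ?thesis using True assms
      by (simp add: huber_def ennreal_mult'[symmetric] power_mult_distrib del: emeasure_lborel_Ioo)
  next
    case False
    then have "1 / \<rho> < g" using assms by (simp add: field_simps)
    moreover have "\<rho> * (g - 1 / \<rho>) + \<rho>\<^sup>2 * ((1 / \<rho>)\<^sup>2 / 2) = \<rho> * g - 1 / 2"
      using assms by (simp add: field_simps)
    ultimately show ?thesis using False assms
      by (simp add: huber_def ennreal_mult'[symmetric] ennreal_plus[symmetric] del: ennreal_plus)
  qed
  finally show ?thesis by simp
qed

section \<open>Convergence in probability\<close>

lemma borel_measurable_cis [measurable]: "cis \<in> borel_measurable borel"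
  unfolding cis_conv_exp by measurable

context prob_space
begin

lemma conv_probI:
  assumes "\<And>n. X n \<in> borel_measurable M" "Y \<in> borel_measurable M"
    and "\<And>e. e > 0 \<Longrightarrow> (\<lambda>n. prob {\<omega>\<in>space M. e < \<bar>X n \<omega> - Y \<omega>\<bar>}) \<longlonglongrightarrow> 0"
  shows "conv_prob M X Y"
  using assms by (auto simp: conv_prob_def)

lemma conv_prob_subseq:
  assumes "conv_prob M X Y" "strict_mono r"
  shows "conv_prob M (\<lambda>n. X (r n)) Y"
  unfolding conv_prob_def
proof (intro conjI allI impI)
  fix e :: real assume "0 < e"
  then have "(\<lambda>n. prob {\<omega>\<in>space M. e < \<bar>X n \<omega> - Y \<omega>\<bar>}) \<longlonglongrightarrow> 0"
    using assms by (simp add: conv_prob_def)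
  from LIMSEQ_subseq_LIMSEQ[OF this assms(2)]
  show "(\<lambda>n. prob {\<omega>\<in>space M. e < \<bar>X (r n) \<omega> - Y \<omega>\<bar>}) \<longlonglongrightarrow> 0"
    by (simp add: comp_def)
qed (use assms in \<open>auto simp: conv_prob_def\<close>)

lemma prob_abs_add_gt_le:
  fixes X Y :: "'a \<Rightarrow> real" and e :: real
  assumes [measurable]: "X \<in> borel_measurable M" "Y \<in> borel_measurable M"
  shows "prob {\<omega>\<in>space M. e < \<bar>X \<omega> + Y \<omega>\<bar>}
    \<le> prob {\<omega>\<in>space M. e / 2 < \<bar>X \<omega>\<bar>} + prob {\<omega>\<in>space M. e / 2 < \<bar>Y \<omega>\<bar>}"
proof -
  have "prob {\<omega>\<in>space M. e < \<bar>X \<omega> + Y \<omega>\<bar>}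
    \<le> prob ({\<omega>\<in>space M. e / 2 < \<bar>X \<omega>\<bar>} \<union> {\<omega>\<in>space M. e / 2 < \<bar>Y \<omega>\<bar>})"
    by (intro finite_measure_mono) auto
  also have "\<dots> \<le> prob {\<omega>\<in>space M. e / 2 < \<bar>X \<omega>\<bar>} + prob {\<omega>\<in>space M. e / 2 < \<bar>Y \<omega>\<bar>}"
    by (intro measure_Un_le) auto
  finally show ?thesis .
qed

lemma conv_prob_diff:
  assumes X: "conv_prob M X X'" and Y: "conv_prob M Y Y'"
  shows "conv_prob M (\<lambda>n \<omega>. X n \<omega> - Y n \<omega>) (\<lambda>\<omega>. X' \<omega> - Y' \<omega>)"
proof (rule conv_probI)
  have [measurable]: "X n \<in> borel_measurable M" "Y n \<in> borel_measurable M"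
     "X' \<in> borel_measurable M" "Y' \<in> borel_measurable M" for n
    using X Y by (auto simp: conv_prob_def)
  show "(\<lambda>\<omega>. X n \<omega> - Y n \<omega>) \<in> borel_measurable M" "(\<lambda>\<omega>. X' \<omega> - Y' \<omega>) \<in> borel_measurable M" for n
    by measurable
  fix e :: real assume e: "e > 0"
  have lim: "(\<lambda>n. prob {\<omega>\<in>space M. e/2 < \<bar>X n \<omega> - X' \<omega>\<bar>} + prob {\<omega>\<in>space M. e/2 < \<bar>Y n \<omega> - Y' \<omega>\<bar>}) \<longlonglongrightarrow> 0 + 0"
    using X Y half_gt_zero[OF e] by (intro tendsto_add) (simp_all only: conv_prob_def)
  have le: "prob {\<omega>\<in>space M. e < \<bar>X n \<omega> - Y n \<omega> - (X' \<omega> - Y' \<omega>)\<bar>}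
    \<le> prob {\<omega>\<in>space M. e/2 < \<bar>X n \<omega> - X' \<omega>\<bar>} + prob {\<omega>\<in>space M. e/2 < \<bar>Y n \<omega> - Y' \<omega>\<bar>}" for n
  proof -
    have "X n \<omega> - X' \<omega> + (Y' \<omega> - Y n \<omega>) = X n \<omega> - Y n \<omega> - (X' \<omega> - Y' \<omega>)" for \<omega> by simp
    then show ?thesis
      using prob_abs_add_gt_le[of "\<lambda>\<omega>. X n \<omega> - X' \<omega>" "\<lambda>\<omega>. Y' \<omega> - Y n \<omega>" e]
      by (simp only: abs_minus_commute[of "Y' _"]) simp
  qed
  show "(\<lambda>n. prob {\<omega>\<in>space M. e < \<bar>X n \<omega> - Y n \<omega> - (X' \<omega> - Y' \<omega>)\<bar>}) \<longlonglongrightarrow> 0"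
    by (intro tendsto_sandwich[OF _ _ tendsto_const lim[unfolded add_0_right]] always_eventually allI le) simp
qed

lemma conv_prob_const_cmult:
  assumes X: "conv_prob M X X'"
  shows "conv_prob M (\<lambda>n \<omega>. c * X n \<omega>) (\<lambda>\<omega>. c * X' \<omega>)"
proof (rule conv_probI)
  have [measurable]: "X n \<in> borel_measurable M" "X' \<in> borel_measurable M" for n
    using X by (auto simp: conv_prob_def)
  show "(\<lambda>\<omega>. c * X n \<omega>) \<in> borel_measurable M" "(\<lambda>\<omega>. c * X' \<omega>) \<in> borel_measurable M" for n
    by measurable
  fix e :: real assume e: "e > 0"
  have eq: "(e < \<bar>c * X n \<omega> - c * X' \<omega>\<bar>) = (e / \<bar>c\<bar> < \<bar>X n \<omega> - X' \<omega>\<bar>)" if "c \<noteq> 0" for n \<omega>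
  proof -
    have "\<bar>c * X n \<omega> - c * X' \<omega>\<bar> = \<bar>c\<bar> * \<bar>X n \<omega> - X' \<omega>\<bar>" by (simp add: right_diff_distrib flip: abs_mult)
    then show ?thesis using that by (simp add: pos_divide_less_eq mult.commute)
  qed
  show "(\<lambda>n. prob {\<omega>\<in>space M. e < \<bar>c * X n \<omega> - c * X' \<omega>\<bar>}) \<longlonglongrightarrow> 0"
  proof (cases "c = 0")
    case False
    then have "e / \<bar>c\<bar> > 0" using e by simp
    then show ?thesis using X False by (simp add: eq conv_prob_def)
  qed (use e in simp)
qed

lemma AE_eq_0_if_prob:
  fixes X :: "'a \<Rightarrow> real"
  assumes [measurable]: "X \<in> borel_measurable M"
    and X: "\<And>e. e > 0 \<Longrightarrow> prob {\<omega>\<in>space M. e < \<bar>X \<omega>\<bar>} = 0"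
  shows "AE \<omega> in M. X \<omega> = 0"
proof -
  have "AE \<omega> in M. \<bar>X \<omega>\<bar> \<le> 1 / real (Suc k)" for k
  proof -
    have "{\<omega>\<in>space M. 1 / real (Suc k) < \<bar>X \<omega>\<bar>} \<in> null_sets M"
      using X[of "1 / real (Suc k)"] by (auto simp: null_sets_def emeasure_eq_measure)
    then have "AE \<omega> in M. \<omega> \<notin> {\<omega>\<in>space M. 1 / real (Suc k) < \<bar>X \<omega>\<bar>}" by (rule AE_not_in)
    then show ?thesis by (rule AE_mp) (auto intro!: AE_I2)
  qed
  then have "AE \<omega> in M. \<forall>k. \<bar>X \<omega>\<bar> \<le> 1 / real (Suc k)" by (simp add: AE_all_countable)
  then show ?thesis
  proof (rule AE_mp, intro AE_I2 impI)
    fix \<omega> assume "\<forall>k. \<bar>X \<omega>\<bar> \<le> 1 / real (Suc k)"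
    then have "\<bar>X \<omega>\<bar> \<le> 0"
      by (intro LIMSEQ_le_const[OF LIMSEQ_inverse_real_of_nat]) (auto simp: inverse_eq_divide)
    then show "X \<omega> = 0" by simp
  qed
qed

lemma conv_prob_AE_unique:
  assumes Y: "conv_prob M X Y" and Z: "conv_prob M X Z"
  shows "AE \<omega> in M. Y \<omega> = Z \<omega>"
proof -
  have [measurable]: "X n \<in> borel_measurable M" "Y \<in> borel_measurable M" "Z \<in> borel_measurable M" for n
    using Y Z by (auto simp: conv_prob_def)
  \<comment> \<open>The zero sequence converges to Y - Z, so the probability of a deviation of Y - Z
    is a constant sequence with limit 0.\<close>
  have "conv_prob M (\<lambda>n \<omega>. X n \<omega> - X n \<omega>) (\<lambda>\<omega>. Y \<omega> - Z \<omega>)"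
    using Y Z by (rule conv_prob_diff)
  then have "(\<lambda>n::nat. prob {\<omega>\<in>space M. e < \<bar>Y \<omega> - Z \<omega>\<bar>}) \<longlonglongrightarrow> 0" if "e > 0" for e
    using that by (simp add: conv_prob_def abs_minus_commute)
  then have "prob {\<omega>\<in>space M. e < \<bar>Y \<omega> - Z \<omega>\<bar>} = 0" if "e > 0" for e
    using that by (simp add: LIMSEQ_const_iff)
  then have "AE \<omega> in M. Y \<omega> - Z \<omega> = 0" by (intro AE_eq_0_if_prob) auto
  then show ?thesis by simp
qed

text \<open>Extract an almost surely convergent subsequence by Borel-Cantelli.\<close>
lemma Cauchy_prob_imp_conv_prob:
  fixes X :: "nat \<Rightarrow> 'a \<Rightarrow> real"
  assumes [measurable]: "\<And>n. X n \<in> borel_measurable M"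
    and C: "\<And>e d. e > 0 \<Longrightarrow> d > 0 \<Longrightarrow>
       \<exists>N. \<forall>m\<ge>N. \<forall>n\<ge>N. prob {\<omega>\<in>space M. e < \<bar>X m \<omega> - X n \<omega>\<bar>} < d"
  shows "\<exists>Y. conv_prob M X Y"
proof -
  define P where "P k N \<longleftrightarrow> (\<forall>m\<ge>N. \<forall>n\<ge>N. prob {\<omega>\<in>space M. (1/2)^k < \<bar>X m \<omega> - X n \<omega>\<bar>} < (1/2)^k)" for k :: nat and N
  have ex: "\<exists>N. P k N" for k unfolding P_def by (rule C) auto
  obtain r :: "nat \<Rightarrow> nat" where r: "\<And>k. P k (r k) \<and> r k < r (Suc k)"
  proof (atomize_elim, rule dependent_nat_choice)
    show "\<exists>x. P 0 x" by (rule ex)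
    fix x k assume "P k x"
    obtain N where "P (Suc k) N" using ex by blast
    then have "P (Suc k) (max N (Suc x))" by (auto simp: P_def)
    then show "\<exists>y. P (Suc k) y \<and> x < y" by (intro exI[of _ "max N (Suc x)"]) auto
  qed
  have mono: "strict_mono r" using r by (simp add: strict_mono_Suc_iff)
  define A where "A k = {\<omega>\<in>space M. (1/2)^k < \<bar>X (r (Suc k)) \<omega> - X (r k) \<omega>\<bar>}" for k
  have [measurable]: "A k \<in> sets M" for k unfolding A_def by measurable
  have A: "prob (A k) < (1/2)^k" for k
    using r[of k] unfolding P_def A_def by auto
  have "summable (\<lambda>k. prob (A k))"
    by (rule summable_comparison_test'[OF summable_geometric[of "1/2::real"], of 0])
       (use A in \<open>auto intro: less_imp_le\<close>)
  then have "AE \<omega> in M. eventually (\<lambda>k. \<omega> \<in> space M - A k) sequentially"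
    by (intro borel_cantelli_AE1) (auto simp: emeasure_eq_measure)
  then have lim: "AE \<omega> in M. convergent (\<lambda>k. X (r k) \<omega>)"
  proof (rule AE_mp, intro AE_I2 impI)
    fix \<omega> assume \<omega>: "\<omega> \<in> space M" and ev: "eventually (\<lambda>k. \<omega> \<in> space M - A k) sequentially"
    have "eventually (\<lambda>k. norm (X (r (Suc k)) \<omega> - X (r k) \<omega>) \<le> (1/2)^k) sequentially"
      using ev by eventually_elim (use \<omega> in \<open>auto simp: A_def\<close>)
    then have "summable (\<lambda>k. X (r (Suc k)) \<omega> - X (r k) \<omega>)"
      by (rule summable_comparison_test_ev) (rule summable_geometric, simp)
    then have "convergent (\<lambda>n. \<Sum>k<n. X (r (Suc k)) \<omega> - X (r k) \<omega>)"
      by (simp add: summable_iff_convergent)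
    then have "convergent (\<lambda>n. X (r n) \<omega> - X (r 0) \<omega>)"
      by (simp only: sum_lessThan_telescope[where f="\<lambda>k. X (r k) \<omega>"])
    then have "convergent (\<lambda>n. X (r n) \<omega> - X (r 0) \<omega> + X (r 0) \<omega>)"
      by (intro convergent_add convergent_const)
    then show "convergent (\<lambda>k. X (r k) \<omega>)" by simp
  qed
  define Y where "Y \<omega> = lim (\<lambda>k. X (r k) \<omega>)" for \<omega>
  have [measurable]: "Y \<in> borel_measurable M" unfolding Y_def by (rule borel_measurable_lim_metric) simp
  have AEY: "AE \<omega> in M. (\<lambda>k. X (r k) \<omega>) \<longlonglongrightarrow> Y \<omega>"
    using lim by eventually_elim (simp add: Y_def convergent_LIMSEQ_iff)
  have sub: "(\<lambda>k. prob {\<omega>\<in>space M. e < \<bar>X (r k) \<omega> - Y \<omega>\<bar>}) \<longlonglongrightarrow> 0" if e: "e > 0" for e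
  proof -
    have "(\<lambda>k. \<integral>\<omega>. indicator {\<omega>\<in>space M. e < \<bar>X (r k) \<omega> - Y \<omega>\<bar>} \<omega> \<partial>M) \<longlonglongrightarrow> (\<integral>\<omega>. (0::real) \<partial>M)"
    proof (rule integral_dominated_convergence[where w="\<lambda>_. 1"])
      show "AE \<omega> in M. (\<lambda>k. indicator {\<omega>\<in>space M. e < \<bar>X (r k) \<omega> - Y \<omega>\<bar>} \<omega>) \<longlonglongrightarrow> (0::real)"
        using AEY
      proof eventually_elim
        case (elim \<omega>)
        then have "eventually (\<lambda>k. \<bar>X (r k) \<omega> - Y \<omega>\<bar> < e) sequentially"
          using e by (auto simp: tendsto_iff dist_real_def)
        then have "eventually (\<lambda>k. indicator {\<omega>\<in>space M. e < \<bar>X (r k) \<omega> - Y \<omega>\<bar>} \<omega> = (0::real)) sequentially"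
          by eventually_elim auto
        then show ?case by (rule tendsto_eventually)
      qed
    qed auto
    then show ?thesis by simp
  qed
  \<comment> \<open>Almost sure convergence is available along r only; the Cauchy property carries
    it over to the full sequence by comparing X n with X (r k) for a late k.\<close>
  have "conv_prob M X Y"
  proof (rule conv_probI)
    fix e :: real assume e: "e > 0"
    show "(\<lambda>n. prob {\<omega>\<in>space M. e < \<bar>X n \<omega> - Y \<omega>\<bar>}) \<longlonglongrightarrow> 0"
    proof (rule LIMSEQ_I)
      fix d :: real assume d: "d > 0"
      obtain N where N: "\<And>m n. m \<ge> N \<Longrightarrow> n \<ge> N \<Longrightarrow> prob {\<omega>\<in>space M. e/2 < \<bar>X m \<omega> - X n \<omega>\<bar>} < d/2"
        using C[of "e/2" "d/2"] e d by auto
      obtain K where K: "\<And>k. k \<ge> K \<Longrightarrow> prob {\<omega>\<in>space M. e/2 < \<bar>X (r k) \<omega> - Y \<omega>\<bar>} < d/2"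
        using LIMSEQ_D[OF sub[of "e/2"], of "d/2"] e d by auto
      define k where "k = max K N"
      have "r k \<ge> N" using seq_suble[OF mono, of k] by (auto simp: k_def)
      have "prob {\<omega>\<in>space M. e < \<bar>X n \<omega> - Y \<omega>\<bar>} < d" if "n \<ge> N" for n
      proof -
        have "prob {\<omega>\<in>space M. e < \<bar>X n \<omega> - Y \<omega>\<bar>} \<le> prob {\<omega>\<in>space M. e/2 < \<bar>X n \<omega> - X (r k) \<omega>\<bar>}
            + prob {\<omega>\<in>space M. e/2 < \<bar>X (r k) \<omega> - Y \<omega>\<bar>}"
          using prob_abs_add_gt_le[of "\<lambda>\<omega>. X n \<omega> - X (r k) \<omega>" "\<lambda>\<omega>. X (r k) \<omega> - Y \<omega>" e] by simp
        also have "\<dots> < d / 2 + d / 2"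
          using N[OF that \<open>r k \<ge> N\<close>] K[of k] by (intro add_strict_mono) (auto simp: k_def)
        finally show ?thesis by simp
      qed
      then show "\<exists>no. \<forall>n\<ge>no. norm (prob {\<omega>\<in>space M. e < \<bar>X n \<omega> - Y \<omega>\<bar>} - 0) < d" by auto
    qed
  qed auto
  then show ?thesis by blast
qed

section \<open>Characteristic functions: continuity and tail bounds\<close>

lemma integrable_cis [simp]:
  "X \<in> borel_measurable M \<Longrightarrow> integrable M (\<lambda>\<omega>. cis (X \<omega>))"
  by (rule integrable_const_bound[where B=1]) (auto simp: cis_conv_exp)

lemma conv_prob_cis:
  assumes X: "conv_prob M X Y"
  shows "(\<lambda>n. \<integral>\<omega>. cis (z * X n \<omega>) \<partial>M) \<longlonglongrightarrow> (\<integral>\<omega>. cis (z * Y \<omega>) \<partial>M)"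
proof -
  have zX: "conv_prob M (\<lambda>n \<omega>. z * X n \<omega>) (\<lambda>\<omega>. z * Y \<omega>)" using X by (rule conv_prob_const_cmult)
  have [measurable]: "X n \<in> borel_measurable M" "Y \<in> borel_measurable M" for n
    using X by (auto simp: conv_prob_def)
  have cis_le: "norm (cis u - cis v) \<le> \<bar>u - v\<bar>" for u v :: real
  proof -
    have "cis u - cis v = cis v * (cis (u - v) - 1)" by (simp add: right_diff_distrib cis_mult)
    then have "norm (cis u - cis v) = norm (cis (u - v) - 1)" by (simp add: norm_mult)
    also have "\<dots> \<le> \<bar>u - v\<bar>" using iexp_approx1[of "u - v" 0] by (simp add: cis_conv_exp)
    finally show ?thesis .
  qed
  have norm2: "norm (cis u - cis v) \<le> 2" for u v :: real
    using norm_triangle_ineq4[of "cis u" "cis v"] by simp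
  show ?thesis
  proof (rule LIMSEQ_I)
    fix d :: real assume d: "d > 0"
    \<comment> \<open>Where the difference is at most d/2, \<open>cis_le\<close> bounds the
      integrand by d/2. Elsewhere the integrand is at most 2, and a probability below d/4 makes this
      cost less than d/2.\<close>
    obtain N where N: "\<And>n. n \<ge> N \<Longrightarrow> prob {\<omega>\<in>space M. d/2 < \<bar>z * X n \<omega> - z * Y \<omega>\<bar>} < d/4"
    proof -
      have "(\<lambda>n. prob {\<omega>\<in>space M. d/2 < \<bar>z * X n \<omega> - z * Y \<omega>\<bar>}) \<longlonglongrightarrow> 0"
        using zX half_gt_zero[OF d] by (simp only: conv_prob_def)
      from LIMSEQ_D[OF this, of "d/4"] d obtain N where
        "\<And>n. n \<ge> N \<Longrightarrow> norm (prob {\<omega>\<in>space M. d/2 < \<bar>z * X n \<omega> - z * Y \<omega>\<bar>} - 0) < d/4" by auto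
      then show thesis by (intro that[of N]) simp
    qed
    have "norm ((\<integral>\<omega>. cis (z * X n \<omega>) \<partial>M) - (\<integral>\<omega>. cis (z * Y \<omega>) \<partial>M)) < d" if "n \<ge> N" for n
    proof -
      let ?A = "{\<omega>\<in>space M. d/2 < \<bar>z * X n \<omega> - z * Y \<omega>\<bar>}"
      have "norm ((\<integral>\<omega>. cis (z * X n \<omega>) \<partial>M) - (\<integral>\<omega>. cis (z * Y \<omega>) \<partial>M))
          = norm (\<integral>\<omega>. cis (z * X n \<omega>) - cis (z * Y \<omega>) \<partial>M)"
        by (subst Bochner_Integration.integral_diff) auto
      also have "\<dots> \<le> (\<integral>\<omega>. d/2 + 2 * indicator ?A \<omega> \<partial>M)"
      proof (rule order_trans[OF integral_norm_bound integral_mono])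
        show "integrable M (\<lambda>\<omega>. norm (cis (z * X n \<omega>) - cis (z * Y \<omega>)))"
          by (intro integrable_norm Bochner_Integration.integrable_diff integrable_cis) measurable
        show "integrable M (\<lambda>\<omega>. d/2 + 2 * indicator ?A \<omega>)"
          by (intro integrable_const_bound[where B="d/2 + 2"]) (use d in \<open>auto split: split_indicator\<close>)
        fix \<omega> assume "\<omega> \<in> space M"
        then show "norm (cis (z * X n \<omega>) - cis (z * Y \<omega>)) \<le> d/2 + 2 * indicator ?A \<omega>"
          using cis_le[of "z * X n \<omega>" "z * Y \<omega>"] norm2[of "z * X n \<omega>" "z * Y \<omega>"] d
          by (auto simp del: mult_eq_0_iff split: split_indicator)
      qed
      also have "\<dots> = d/2 + 2 * prob ?A"
        by (subst Bochner_Integration.integral_add)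
           (auto simp: prob_space intro!: integrable_const_bound[where B=2] split: split_indicator)
      also have "\<dots> < d" using N[OF that] by simp
      finally show ?thesis .
    qed
    then show "\<exists>no. \<forall>n\<ge>no. norm ((\<integral>\<omega>. cis (z * X n \<omega>) \<partial>M) - (\<integral>\<omega>. cis (z * Y \<omega>) \<partial>M)) < d" by auto
  qed
qed

text \<open>Averaging \<open>1 - cos (z X)\<close> over \<open>0 \<le> z \<le> T\<close> gives \<open>1 - sin (T X) / (T X)\<close>, which is at least
  \<open>1/2\<close> when \<open>\<bar>T X\<bar> \<ge> 2\<close>.\<close>
lemma prob_abs_gt_le_char:
  assumes [measurable]: "X \<in> borel_measurable M" and T: "T > 0"
    and q: "\<And>z. 0 \<le> z \<Longrightarrow> z \<le> T \<Longrightarrow> 1 - Re (\<integral>\<omega>. cis (z * X \<omega>) \<partial>M) \<le> q"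
  shows "prob {\<omega>\<in>space M. 2 / T < \<bar>X \<omega>\<bar>} \<le> 2 * q"
proof -
  interpret P: pair_sigma_finite M lborel ..
  have q0: "0 \<le> q" using q[of 0] T by (simp add: prob_space)
  have cosint: "(\<integral>\<^sup>+z. ennreal (1 - cos (z * x)) * indicator {0..T} z \<partial>lborel) \<ge> ennreal (T / 2) * indicator {x. 2 / T < \<bar>x\<bar>} x" for x
  proof (cases "2 / T < \<bar>x\<bar>")
    case True
    then have x: "x \<noteq> 0" "2 < T * \<bar>x\<bar>" using T by (auto simp: field_simps)
    have "(\<integral>\<^sup>+z. ennreal (1 - cos (z * x)) * indicator {0..T} z \<partial>lborel) = ennreal ((T - sin (T * x) / x) - (0 - sin (0 * x) / x))"
      using T x by (intro nn_integral_FTC_Icc[where F="\<lambda>z. z - sin (z * x) / x"])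
        (auto intro!: derivative_eq_intros)
    moreover have "\<bar>sin (T * x) / x\<bar> \<le> 1 / \<bar>x\<bar>"
      using abs_sin_le_one[of "T * x"] by (simp add: abs_divide divide_right_mono)
    moreover have "1 / \<bar>x\<bar> \<le> T / 2" using x by (simp add: field_simps)
    moreover have "T / 2 \<le> T - sin (T * x) / x" using calculation(2,3) by linarith
    ultimately show ?thesis using True by (auto intro!: ennreal_leI)
  qed simp
  have "ennreal (T / 2) * emeasure M {\<omega>\<in>space M. 2 / T < \<bar>X \<omega>\<bar>}
      = (\<integral>\<^sup>+\<omega>. ennreal (T / 2) * indicator {\<omega>\<in>space M. 2 / T < \<bar>X \<omega>\<bar>} \<omega> \<partial>M)"
    by (simp add: nn_integral_cmult_indicator)
  also have "\<dots> \<le> (\<integral>\<^sup>+\<omega>. (\<integral>\<^sup>+z. ennreal (1 - cos (z * X \<omega>)) * indicator {0..T} z \<partial>lborel) \<partial>M)"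
    using cosint by (intro nn_integral_mono) (auto simp: indicator_def split: if_splits)
  also have "\<dots> = (\<integral>\<^sup>+z. (\<integral>\<^sup>+\<omega>. ennreal (1 - cos (z * X \<omega>)) * indicator {0..T} z \<partial>M) \<partial>lborel)"
    by (rule P.Fubini'[symmetric]) measurable
  also have "\<dots> \<le> (\<integral>\<^sup>+z. ennreal q * indicator {0..T} z \<partial>lborel)"
  proof (intro nn_integral_mono)
    fix z :: real
    have "(\<integral>\<^sup>+\<omega>. ennreal (1 - cos (z * X \<omega>)) \<partial>M) = ennreal (\<integral>\<omega>. 1 - cos (z * X \<omega>) \<partial>M)"
      by (intro nn_integral_eq_integral Bochner_Integration.integrable_diff integrable_const_bound[where B=1]) auto
    also have "(\<integral>\<omega>. 1 - cos (z * X \<omega>) \<partial>M) = 1 - Re (\<integral>\<omega>. cis (z * X \<omega>) \<partial>M)"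
      by (subst integral_Re[symmetric])
         (auto simp: prob_space intro!: Bochner_Integration.integral_diff[THEN trans] integrable_const_bound[where B=1])
    finally show "(\<integral>\<^sup>+\<omega>. ennreal (1 - cos (z * X \<omega>)) * indicator {0..T} z \<partial>M) \<le> ennreal q * indicator {0..T} z"
      using q[of z] by (auto split: split_indicator intro: ennreal_leI)
  qed
  also have "\<dots> = ennreal (q * T)"
    using T q0 by (simp add: nn_integral_cmult_indicator ennreal_mult')
  finally have "ennreal (T / 2 * prob {\<omega>\<in>space M. 2 / T < \<bar>X \<omega>\<bar>}) \<le> ennreal (q * T)"
    using T by (subst ennreal_mult) (auto simp: emeasure_eq_measure)
  then have "T / 2 * prob {\<omega>\<in>space M. 2 / T < \<bar>X \<omega>\<bar>} \<le> q * T"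
    using T q0 by (subst (asm) ennreal_le_iff) auto
  then show ?thesis using T by (simp add: field_simps)
qed

end

section \<open>Uniqueness of multivariate characteristic functions\<close>

context prob_space
begin

text \<open>After division by its mass c the weight U becomes a density, and Levy's uniqueness
  theorem applies to the laws of Z and Z' under the reweighted measures. The masses agree by the
  hypothesis at t = 0; mass zero is treated apart because it cannot be normalised. The bound 2 fits
  the weights 1 + Re W with |W| <= 1 that are used below.\<close>

lemma weighted_law_unique:
  fixes U U' Z Z' :: "'a \<Rightarrow> real"
  assumes [measurable]: "U \<in> borel_measurable M" "U' \<in> borel_measurable M"
      "Z \<in> borel_measurable M" "Z' \<in> borel_measurable M" "A \<in> sets borel"
    and U: "\<And>\<omega>. 0 \<le> U \<omega>" "\<And>\<omega>. U \<omega> \<le> 2" and U': "\<And>\<omega>. 0 \<le> U' \<omega>" "\<And>\<omega>. U' \<omega> \<le> 2"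
    and eq: "\<And>t. (\<integral>\<omega>. U \<omega> *\<^sub>R cis (t * Z \<omega>) \<partial>M) = (\<integral>\<omega>. U' \<omega> *\<^sub>R cis (t * Z' \<omega>) \<partial>M)"
  shows "(\<integral>\<omega>. U \<omega> * indicator A (Z \<omega>) \<partial>M) = (\<integral>\<omega>. U' \<omega> * indicator A (Z' \<omega>) \<partial>M)"
proof -
  have int: "integrable M V" if [measurable]: "V \<in> borel_measurable M" and "\<And>\<omega>. 0 \<le> V \<omega>" "\<And>\<omega>. V \<omega> \<le> (2::real)" for V
    using that by (intro integrable_const_bound[where B=2]) auto
  define c where "c = (\<integral>\<omega>. U \<omega> \<partial>M)"
  have c': "c = (\<integral>\<omega>. U' \<omega> \<partial>M)"
  proof -
    have "complex_of_real (\<integral>\<omega>. U \<omega> \<partial>M) = complex_of_real (\<integral>\<omega>. U' \<omega> \<partial>M)"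
      using eq[of 0] by (simp add: scaleR_conv_of_real)
    then show ?thesis by (simp only: of_real_eq_iff c_def)
  qed
  have c0: "0 \<le> c" unfolding c_def using U by (intro Bochner_Integration.integral_nonneg) auto
  show ?thesis
  proof (cases "c = 0")
    case True
    have "AE \<omega> in M. U \<omega> = 0" using True U int[of U]
      by (subst integral_nonneg_eq_0_iff_AE[symmetric]) (auto simp: c_def)
    moreover have "AE \<omega> in M. U' \<omega> = 0" using True U' int[of U']
      by (subst integral_nonneg_eq_0_iff_AE[symmetric]) (auto simp: c')
    ultimately show ?thesis
      by (intro integral_cong_AE) (auto elim!: eventually_elim2)
  next
    case False
    then have c: "c > 0" using c0 by simp
    define N where "N V W = distr (density M (\<lambda>\<omega>. ennreal (V \<omega> / c))) borel W" for V W :: "'a \<Rightarrow> real"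
    have dist: "real_distribution (N V W)"
      and char: "char (N V W) t = (\<integral>\<omega>. V \<omega> *\<^sub>R cis (t * W \<omega>) \<partial>M) / c"
      and meas: "c * measure (N V W) A = (\<integral>\<omega>. V \<omega> * indicator A (W \<omega>) \<partial>M)"
      if [measurable]: "V \<in> borel_measurable M" "W \<in> borel_measurable M"
        and V: "\<And>\<omega>. 0 \<le> V \<omega>" "\<And>\<omega>. V \<omega> \<le> 2" and cV: "c = (\<integral>\<omega>. V \<omega> \<partial>M)" for V W t
    proof -
      have em: "emeasure (N V W) B = ennreal ((\<integral>\<omega>. V \<omega> * indicator B (W \<omega>) \<partial>M) / c)" if [measurable]: "B \<in> sets borel" for B
      proof -
        have "emeasure (N V W) B = (\<integral>\<^sup>+\<omega>. ennreal (V \<omega> / c) * indicator (W -` B \<inter> space M) \<omega> \<partial>M)"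
          by (simp add: N_def emeasure_distr emeasure_density)
        also have "\<dots> = (\<integral>\<^sup>+\<omega>. ennreal (V \<omega> * indicator B (W \<omega>) / c) \<partial>M)"
          by (intro nn_integral_cong) (auto split: split_indicator)
        also have "\<dots> = ennreal (\<integral>\<omega>. V \<omega> * indicator B (W \<omega>) / c \<partial>M)"
          using V c by (intro nn_integral_eq_integral Bochner_Integration.integrable_divide int AE_I2) (auto split: split_indicator)
        finally show ?thesis by simp
      qed
      have "emeasure (N V W) (space (N V W)) = 1"
        using em[of UNIV] c by (simp add: N_def cV[symmetric])
      then have "prob_space (N V W)" by (rule prob_spaceI)
      then show "real_distribution (N V W)"
        by (simp add: real_distribution_def real_distribution_axioms_def N_def)
      have "char (N V W) t = (\<integral>\<omega>. cis (t * W \<omega>) \<partial>density M (\<lambda>\<omega>. ennreal (V \<omega> / c)))"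
        unfolding char_def N_def by (subst integral_distr) (auto simp: cis_conv_exp)
      also have "\<dots> = (\<integral>\<omega>. (V \<omega> / c) *\<^sub>R cis (t * W \<omega>) \<partial>M)"
        using V c by (intro integral_density) auto
      also have "\<dots> = (\<integral>\<omega>. V \<omega> *\<^sub>R cis (t * W \<omega>) \<partial>M) / c"
        by (simp add: scaleR_conv_of_real)
      finally show "char (N V W) t = (\<integral>\<omega>. V \<omega> *\<^sub>R cis (t * W \<omega>) \<partial>M) / c" .
      have "0 \<le> (\<integral>\<omega>. V \<omega> * indicator A (W \<omega>) \<partial>M)"
        using V by (intro Bochner_Integration.integral_nonneg) auto
      then show "c * measure (N V W) A = (\<integral>\<omega>. V \<omega> * indicator A (W \<omega>) \<partial>M)"
        using em[of A] c by (simp add: measure_def)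
    qed
    have "N U Z = N U' Z'"
      by (rule Levy_uniqueness) (auto intro!: dist U U' c_def c' simp: char[OF _ _ U c_def] char[OF _ _ U' c'] eq)
    then show ?thesis
      using meas[of U Z] meas[of U' Z'] U U' c_def c' by simp
  qed
qed

text \<open>A complex weight of modulus at most 1 is reduced to the nonnegative weight 1 + Re W, and
  the contribution of the constant 1 is removed by the equality of the plain laws. The imaginary
  part is the real part of -i W.\<close>

lemma complex_weighted_law_unique:
  fixes W W' :: "'a \<Rightarrow> complex" and Z Z' :: "'a \<Rightarrow> real"
  assumes [measurable]: "W \<in> borel_measurable M" "W' \<in> borel_measurable M"
      "Z \<in> borel_measurable M" "Z' \<in> borel_measurable M" "A \<in> sets borel"
    and W: "\<And>\<omega>. norm (W \<omega>) \<le> 1" and W': "\<And>\<omega>. norm (W' \<omega>) \<le> 1"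
    and eq: "\<And>t. (\<integral>\<omega>. W \<omega> * cis (t * Z \<omega>) \<partial>M) = (\<integral>\<omega>. W' \<omega> * cis (t * Z' \<omega>) \<partial>M)"
    and eq1: "\<And>t. (\<integral>\<omega>. cis (t * Z \<omega>) \<partial>M) = (\<integral>\<omega>. cis (t * Z' \<omega>) \<partial>M)"
  shows "(\<integral>\<omega>. W \<omega> * indicator A (Z \<omega>) \<partial>M) = (\<integral>\<omega>. W' \<omega> * indicator A (Z' \<omega>) \<partial>M)"
proof -
  have intC: "integrable M F" if "F \<in> borel_measurable M" "\<And>\<omega>. norm (F \<omega>) \<le> 1" for F :: "'a \<Rightarrow> complex"
    using that by (intro integrable_const_bound[where B=1]) auto
  have intR: "integrable M F" if "F \<in> borel_measurable M" "\<And>\<omega>. \<bar>F \<omega>\<bar> \<le> 1" for F :: "'a \<Rightarrow> real"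
    using that by (intro integrable_const_bound[where B=1]) auto
  have ind: "(\<integral>\<omega>. indicator A (Z \<omega>) \<partial>M) = (\<integral>\<omega>. indicator A (Z' \<omega>) \<partial>M :: real)"
    using weighted_law_unique[of "\<lambda>_. 1" "\<lambda>_. 1" Z Z' A] eq1 by simp
  have Re_part: "(\<integral>\<omega>. Re (F \<omega>) * indicator A (Z \<omega>) \<partial>M) = (\<integral>\<omega>. Re (F' \<omega>) * indicator A (Z' \<omega>) \<partial>M)"
    if [measurable]: "F \<in> borel_measurable M" "F' \<in> borel_measurable M"
      and F: "\<And>\<omega>. norm (F \<omega>) \<le> 1" and F': "\<And>\<omega>. norm (F' \<omega>) \<le> 1"
      and eqF: "\<And>t. (\<integral>\<omega>. F \<omega> * cis (t * Z \<omega>) \<partial>M) = (\<integral>\<omega>. F' \<omega> * cis (t * Z' \<omega>) \<partial>M)" for F F'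
  proof -
    \<comment> \<open>Re H is the mean of H and its conjugate, and conjugation reverses the
      frequency: cnj H * cis (t V) is the conjugate of H * cis (-t V). Hence the transform of the
      real weight is determined by the transforms of H at t and at -t.\<close>
    have split: "(\<integral>\<omega>. (1 + Re (H \<omega>)) *\<^sub>R cis (t * V \<omega>) \<partial>M)
        = (\<integral>\<omega>. cis (t * V \<omega>) \<partial>M) + ((\<integral>\<omega>. H \<omega> * cis (t * V \<omega>) \<partial>M) + cnj (\<integral>\<omega>. H \<omega> * cis (- t * V \<omega>) \<partial>M)) / 2"
      if [measurable]: "H \<in> borel_measurable M" "V \<in> borel_measurable M" and H: "\<And>\<omega>. norm (H \<omega>) \<le> 1" for H V t
    proof -
      have i: "integrable M (\<lambda>\<omega>. H \<omega> * cis (s * V \<omega>))" for s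
        using H by (intro intC) (auto simp: norm_mult)
      have i': "integrable M (\<lambda>\<omega>. cnj (H \<omega> * cis (s * V \<omega>)))" for s
        using i by (simp only: integrable_cnj)
      have "(1 + Re (H \<omega>)) *\<^sub>R cis (t * V \<omega>)
          = cis (t * V \<omega>) + (H \<omega> * cis (t * V \<omega>) + cnj (H \<omega> * cis (- t * V \<omega>))) / 2" for \<omega>
      proof -
        have "complex_of_real (Re (H \<omega>)) = (H \<omega> + cnj (H \<omega>)) / 2" by (simp add: complex_add_cnj)
        then show ?thesis by (simp add: scaleR_conv_of_real cis_cnj algebra_simps add_divide_distrib)
      qed
      then have "(\<integral>\<omega>. (1 + Re (H \<omega>)) *\<^sub>R cis (t * V \<omega>) \<partial>M)
         = (\<integral>\<omega>. cis (t * V \<omega>) + (H \<omega> * cis (t * V \<omega>) + cnj (H \<omega> * cis (- t * V \<omega>))) / 2 \<partial>M)" by simp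
      also have "\<dots> = (\<integral>\<omega>. cis (t * V \<omega>) \<partial>M) + ((\<integral>\<omega>. H \<omega> * cis (t * V \<omega>) \<partial>M) + (\<integral>\<omega>. cnj (H \<omega> * cis (- t * V \<omega>)) \<partial>M)) / 2"
        using i[of t] i'[of "- t"] by simp
      also have "(\<integral>\<omega>. cnj (H \<omega> * cis (- t * V \<omega>)) \<partial>M) = cnj (\<integral>\<omega>. H \<omega> * cis (- t * V \<omega>) \<partial>M)"
        by (rule Bochner_Integration.integral_cnj)
      finally show ?thesis .
    qed
    have R: "\<bar>Re (F \<omega>)\<bar> \<le> 1" "\<bar>Re (F' \<omega>)\<bar> \<le> 1" for \<omega>
      using abs_Re_le_cmod[of "F \<omega>"] abs_Re_le_cmod[of "F' \<omega>"] F[of \<omega>] F'[of \<omega>] by linarith+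
    then have R': "0 \<le> 1 + Re (F \<omega>)" "1 + Re (F \<omega>) \<le> 2" "0 \<le> 1 + Re (F' \<omega>)" "1 + Re (F' \<omega>) \<le> 2" for \<omega>
      using R[of \<omega>] by linarith+
    have eqF': "(\<integral>\<omega>. F \<omega> * cis (- (t * Z \<omega>)) \<partial>M) = (\<integral>\<omega>. F' \<omega> * cis (- (t * Z' \<omega>)) \<partial>M)" for t
      using eqF[of "- t"] by simp
    have "(\<integral>\<omega>. (1 + Re (F \<omega>)) * indicator A (Z \<omega>) \<partial>M) = (\<integral>\<omega>. (1 + Re (F' \<omega>)) * indicator A (Z' \<omega>) \<partial>M)"
      by (rule weighted_law_unique) (use R' in \<open>simp_all add: split F F' eqF eqF' eq1\<close>)
    moreover have "(\<integral>\<omega>. (1 + Re (H \<omega>)) * indicator A (V \<omega>) \<partial>M)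
       = (\<integral>\<omega>. indicator A (V \<omega>) \<partial>M) + (\<integral>\<omega>. Re (H \<omega>) * indicator A (V \<omega>) \<partial>M)"
      if [measurable]: "H \<in> borel_measurable M" "V \<in> borel_measurable M" and H: "\<And>\<omega>. \<bar>Re (H \<omega>)\<bar> \<le> 1" for H V
      unfolding distrib_right mult_1
      by (intro Bochner_Integration.integral_add intR) (use H in \<open>auto split: split_indicator\<close>)
    ultimately show ?thesis using R ind by simp
  qed
  have eq_i: "(\<integral>\<omega>. - \<i> * W \<omega> * cis (t * Z \<omega>) \<partial>M) = (\<integral>\<omega>. - \<i> * W' \<omega> * cis (t * Z' \<omega>) \<partial>M)" for t
    using eq[of t] by (simp add: mult.assoc)
  have Re: "(\<integral>\<omega>. Re (W \<omega>) * indicator A (Z \<omega>) \<partial>M) = (\<integral>\<omega>. Re (W' \<omega>) * indicator A (Z' \<omega>) \<partial>M)"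
    using W W' eq by (intro Re_part) auto
  have Im: "(\<integral>\<omega>. Im (W \<omega>) * indicator A (Z \<omega>) \<partial>M) = (\<integral>\<omega>. Im (W' \<omega>) * indicator A (Z' \<omega>) \<partial>M)"
    using Re_part[of "\<lambda>\<omega>. - \<i> * W \<omega>" "\<lambda>\<omega>. - \<i> * W' \<omega>"] W W' eq_i by (simp add: norm_mult)
  have "(\<integral>\<omega>. F \<omega> * indicator A (V \<omega>) \<partial>M)
      = Complex (\<integral>\<omega>. Re (F \<omega>) * indicator A (V \<omega>) \<partial>M) (\<integral>\<omega>. Im (F \<omega>) * indicator A (V \<omega>) \<partial>M)"
    if [measurable]: "F \<in> borel_measurable M" "V \<in> borel_measurable M" and F: "\<And>\<omega>. norm (F \<omega>) \<le> 1" for F V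
  proof -
    have i: "integrable M (\<lambda>\<omega>. F \<omega> * indicator A (V \<omega>))"
      using F by (intro intC) (auto split: split_indicator)
    show ?thesis
      by (auto simp: complex_eq_iff integral_Re[OF i, symmetric] integral_Im[OF i, symmetric]
          intro!: Bochner_Integration.integral_cong split: split_indicator)
  qed
  then show ?thesis using W W' Re Im by simp
qed

text \<open>Replace the factors \<open>cis (z i * X i)\<close> by indicators of \<open>X i \<in> A i\<close> one coordinate at a time.\<close>
lemma joint_law_unique:
  fixes X Y :: "'i \<Rightarrow> 'a \<Rightarrow> real"
  assumes J: "finite J"
    and meas: "\<And>i. i \<in> J \<Longrightarrow> X i \<in> borel_measurable M" "\<And>i. i \<in> J \<Longrightarrow> Y i \<in> borel_measurable M"
    and A: "\<And>i. i \<in> J \<Longrightarrow> A i \<in> sets borel"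
    and eq: "\<And>z. (\<integral>\<omega>. cis (\<Sum>i\<in>J. z i * X i \<omega>) \<partial>M) = (\<integral>\<omega>. cis (\<Sum>i\<in>J. z i * Y i \<omega>) \<partial>M)"
  shows "prob {\<omega>\<in>space M. \<forall>i\<in>J. X i \<omega> \<in> A i} = prob {\<omega>\<in>space M. \<forall>i\<in>J. Y i \<omega> \<in> A i}"
proof -
  have *: "(\<integral>\<omega>. (\<Prod>i\<in>K. indicator (A i) (X i \<omega>)) * cis (\<Sum>i\<in>R. z i * X i \<omega>) \<partial>M)
      = (\<integral>\<omega>. (\<Prod>i\<in>K. indicator (A i) (Y i \<omega>)) * cis (\<Sum>i\<in>R. z i * Y i \<omega>) \<partial>M)"
    if "finite K" "K \<subseteq> J" "R \<subseteq> J" "K \<inter> R = {}" for K R z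
    using that
  proof (induction K arbitrary: R z rule: finite_induct)
    case empty
    \<comment> \<open>Zero coefficients outside R bring the smaller sum into the form of the
      hypothesis on J.\<close>
    have "(\<Sum>i\<in>J. (if i \<in> R then z i else 0) * V i \<omega>) = (\<Sum>i\<in>R. z i * V i \<omega>)" for V :: "'i \<Rightarrow> 'a \<Rightarrow> real" and \<omega>
      using J empty by (intro sum.mono_neutral_cong_right) auto
    then show ?case using eq[of "\<lambda>i. if i \<in> R then z i else 0"] by simp
  next
    case (insert k K)
    have fin: "finite K" "finite R" using insert J finite_subset by auto
    have kR: "k \<notin> R" "k \<notin> K" "k \<in> J" using insert by auto
    define W where "W V \<omega> = (\<Prod>i\<in>K. indicator (A i) (V i \<omega>)) * cis (\<Sum>i\<in>R. z i * V i \<omega>)" for V :: "'i \<Rightarrow> 'a \<Rightarrow> real" and \<omega>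
    have Wm: "W V \<in> borel_measurable M" if "\<And>i. i \<in> J \<Longrightarrow> V i \<in> borel_measurable M" for V
    proof -
      have [measurable]: "(\<lambda>\<omega>. \<Prod>i\<in>K. indicator (A i) (V i \<omega>) :: complex) \<in> borel_measurable M"
        using that insert A by (intro borel_measurable_prod borel_measurable_indicator') auto
      have [measurable]: "(\<lambda>\<omega>. \<Sum>i\<in>R. z i * V i \<omega>) \<in> borel_measurable M"
        using that insert by (intro borel_measurable_sum borel_measurable_times) auto
      show ?thesis unfolding W_def by measurable
    qed
    have Wn: "norm (W V \<omega>) \<le> 1" for V \<omega>
      by (auto simp: W_def norm_mult prod_norm[symmetric] intro!: prod_le_1 split: split_indicator)
    have Wcis: "W V \<omega> * cis (t * V k \<omega>)
       = (\<Prod>i\<in>K. indicator (A i) (V i \<omega>)) * cis (\<Sum>i\<in>insert k R. (if i = k then t else z i) * V i \<omega>)" for V \<omega> t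
    proof -
      have "(\<Sum>i\<in>R. (if i = k then t else z i) * V i \<omega>) = (\<Sum>i\<in>R. z i * V i \<omega>)"
        using kR by (intro sum.cong) auto
      then show ?thesis using fin kR by (simp add: W_def mult.assoc cis_mult add.commute)
    qed
    have eq1: "(\<integral>\<omega>. cis (t * X k \<omega>) \<partial>M) = (\<integral>\<omega>. cis (t * Y k \<omega>) \<partial>M)" for t
    proof -
      have "(\<Sum>i\<in>J. (if i = k then t else 0) * V i \<omega>) = t * V k \<omega>" for V :: "'i \<Rightarrow> 'a \<Rightarrow> real" and \<omega>
        using J kR by (subst sum.remove[of J k]) auto
      then show ?thesis using eq[of "\<lambda>i. if i = k then t else 0"] by simp
    qed
    have "(\<integral>\<omega>. W X \<omega> * indicator (A k) (X k \<omega>) \<partial>M) = (\<integral>\<omega>. W Y \<omega> * indicator (A k) (Y k \<omega>) \<partial>M)"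
    proof (rule complex_weighted_law_unique)
      fix t
      show "(\<integral>\<omega>. W X \<omega> * cis (t * X k \<omega>) \<partial>M) = (\<integral>\<omega>. W Y \<omega> * cis (t * Y k \<omega>) \<partial>M)"
        unfolding Wcis using insert kR by (intro insert.IH) auto
    qed (use Wm Wn meas kR A eq1 in auto)
    then show ?case using fin kR by (simp add: W_def ac_simps)
  qed
  have P: "complex_of_real (prob {\<omega>\<in>space M. \<forall>i\<in>J. V i \<omega> \<in> A i}) = (\<integral>\<omega>. (\<Prod>i\<in>J. indicator (A i) (V i \<omega>)) \<partial>M)"
    if "\<And>i. i \<in> J \<Longrightarrow> V i \<in> borel_measurable M" for V
  proof -
    have [measurable]: "{\<omega>\<in>space M. \<forall>i\<in>J. V i \<omega> \<in> A i} \<in> sets M"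
      using that J A by (intro sets.sets_Collect_finite_All) (auto intro: measurable_sets_Collect)
    have "(\<integral>\<omega>. (\<Prod>i\<in>J. indicator (A i) (V i \<omega>) :: complex) \<partial>M)
        = (\<integral>\<omega>. complex_of_real (indicator {\<omega>\<in>space M. \<forall>i\<in>J. V i \<omega> \<in> A i} \<omega>) \<partial>M)"
    proof (intro Bochner_Integration.integral_cong refl)
      fix \<omega> assume "\<omega> \<in> space M"
      then show "(\<Prod>i\<in>J. indicator (A i) (V i \<omega>)) = complex_of_real (indicator {\<omega>\<in>space M. \<forall>i\<in>J. V i \<omega> \<in> A i} \<omega>)"
        using J by (cases "\<forall>i\<in>J. V i \<omega> \<in> A i") (auto intro!: prod.neutral bexI simp: indicator_def)
    qed
    also have "\<dots> = complex_of_real (prob {\<omega>\<in>space M. \<forall>i\<in>J. V i \<omega> \<in> A i})"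
      by (subst integral_complex_of_real) simp
    finally show ?thesis by simp
  qed
  have "complex_of_real (prob {\<omega>\<in>space M. \<forall>i\<in>J. X i \<omega> \<in> A i}) = complex_of_real (prob {\<omega>\<in>space M. \<forall>i\<in>J. Y i \<omega> \<in> A i})"
    using *[of J "{}"] J meas by (simp add: P)
  then show ?thesis by simp
qed

text \<open>Cylinder sets over finite subsets of I form an intersection-stable generator of the
  product sigma-algebra, so \<open>joint_law_unique\<close> suffices even for an uncountable index
  set such as the space of test functions.\<close>

lemma process_law_unique:
  fixes X Y :: "'i \<Rightarrow> 'a \<Rightarrow> real"
  assumes meas: "\<And>i. i \<in> I \<Longrightarrow> X i \<in> borel_measurable M" "\<And>i. i \<in> I \<Longrightarrow> Y i \<in> borel_measurable M"
    and eq: "\<And>J z. finite J \<Longrightarrow> J \<subseteq> I \<Longrightarrow>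
       (\<integral>\<omega>. cis (\<Sum>i\<in>J. z i * X i \<omega>) \<partial>M) = (\<integral>\<omega>. cis (\<Sum>i\<in>J. z i * Y i \<omega>) \<partial>M)"
  shows "distr M (Pi\<^sub>M I (\<lambda>_. borel)) (\<lambda>\<omega>. \<lambda>i\<in>I. X i \<omega>) = distr M (Pi\<^sub>M I (\<lambda>_. borel)) (\<lambda>\<omega>. \<lambda>i\<in>I. Y i \<omega>)"
proof (rule measure_eqI_PiM_infinite)
  have m: "(\<lambda>\<omega>. \<lambda>i\<in>I. V i \<omega>) \<in> measurable M (Pi\<^sub>M I (\<lambda>_. borel))"
    if "\<And>i. i \<in> I \<Longrightarrow> V i \<in> borel_measurable M" for V :: "'i \<Rightarrow> 'a \<Rightarrow> real"
    using that by (intro measurable_restrict) auto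
  show "finite_measure (distr M (Pi\<^sub>M I (\<lambda>_. borel)) (\<lambda>\<omega>. \<lambda>i\<in>I. X i \<omega>))"
    using m[OF meas(1)] by (intro finite_measure_distr) auto
  fix A J assume J: "finite J" "J \<subseteq> I" and A: "\<And>i. i \<in> J \<Longrightarrow> A i \<in> sets (borel :: real measure)"
  have "emeasure (distr M (Pi\<^sub>M I (\<lambda>_. borel)) (\<lambda>\<omega>. \<lambda>i\<in>I. V i \<omega>)) (prod_emb I (\<lambda>_. borel) J (Pi\<^sub>E J A))
      = prob {\<omega>\<in>space M. \<forall>i\<in>J. V i \<omega> \<in> A i}"
    if V: "\<And>i. i \<in> I \<Longrightarrow> V i \<in> borel_measurable M" for V :: "'i \<Rightarrow> 'a \<Rightarrow> real"
  proof -
    have "(\<lambda>\<omega>. \<lambda>i\<in>I. V i \<omega>) -` prod_emb I (\<lambda>_. borel) J (Pi\<^sub>E J A) \<inter> space M = {\<omega>\<in>space M. \<forall>i\<in>J. V i \<omega> \<in> A i}"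
      using J by (auto simp: prod_emb_def PiE_iff extensional_def subset_iff)
    then show ?thesis
      using J A m[OF V] by (subst emeasure_distr) (auto simp: emeasure_eq_measure)
  qed
  then show "emeasure (distr M (Pi\<^sub>M I (\<lambda>_. borel)) (\<lambda>\<omega>. \<lambda>i\<in>I. X i \<omega>)) (prod_emb I (\<lambda>_. borel) J (Pi\<^sub>E J A))
    = emeasure (distr M (Pi\<^sub>M I (\<lambda>_. borel)) (\<lambda>\<omega>. \<lambda>i\<in>I. Y i \<omega>)) (prod_emb I (\<lambda>_. borel) J (Pi\<^sub>E J A))"
    using J A meas eq[OF J] by (auto intro!: joint_law_unique)
qed simp_all

end

section \<open>Test functions\<close>

text \<open>Any class of differentiable functions that is closed under partial derivatives serves as
  an invariant for the induction on the list of directions. Smoothness is thereby shown without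
  computing higher derivatives.\<close>

lemma smooth_coinduct:
  assumes "f \<in> P"
    and diff: "\<And>g x. g \<in> P \<Longrightarrow> g differentiable (at x)"
    and closed: "\<And>g v. g \<in> P \<Longrightarrow> v \<in> Basis \<Longrightarrow> (\<lambda>x. frechet_derivative g (at x) v) \<in> P"
  shows "smooth_fun f"
proof -
  have "dirderiv vs f \<in> P" if "set vs \<subseteq> Basis" for vs
    using that by (induction vs) (auto intro: assms(1) closed)
  then show ?thesis using diff by (auto simp: smooth_fun_def)
qed

lemma smooth_fun_dirderiv_differentiable:
  "smooth_fun f \<Longrightarrow> set vs \<subseteq> Basis \<Longrightarrow> dirderiv vs f differentiable (at x)"
  by (auto simp: smooth_fun_def)

lemma dirderiv_lincomb:
  assumes "smooth_fun f" "smooth_fun g" "set vs \<subseteq> Basis"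
  shows "dirderiv vs (\<lambda>x. a * f x + b * g x) = (\<lambda>x. a * dirderiv vs f x + b * dirderiv vs g x)"
  using assms(3)
proof (induction vs)
  case (Cons v vs)
  have "frechet_derivative (\<lambda>x. a * dirderiv vs f x + b * dirderiv vs g x) (at x)
      = (\<lambda>h. a * frechet_derivative (dirderiv vs f) (at x) h + b * frechet_derivative (dirderiv vs g) (at x) h)" for x
  proof -
    have f: "(dirderiv vs f has_derivative frechet_derivative (dirderiv vs f) (at x)) (at x)"
      and g: "(dirderiv vs g has_derivative frechet_derivative (dirderiv vs g) (at x)) (at x)"
      using assms Cons.prems by (auto intro!: frechet_derivative_works[THEN iffD1] smooth_fun_dirderiv_differentiable)
    have "((\<lambda>x. a * dirderiv vs f x + b * dirderiv vs g x) has_derivative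
       (\<lambda>h. a * frechet_derivative (dirderiv vs f) (at x) h + b * frechet_derivative (dirderiv vs g) (at x) h)) (at x)"
      by (intro has_derivative_add has_derivative_mult_right f g)
    then show ?thesis by (rule frechet_derivative_at[symmetric])
  qed
  then show ?case using Cons by simp
qed simp

lemma smooth_fun_lincomb:
  assumes "smooth_fun f" "smooth_fun g"
  shows "smooth_fun (\<lambda>x. a * f x + b * g x)"
  unfolding smooth_fun_def
  by (auto simp: dirderiv_lincomb[OF assms] intro!: derivative_intros smooth_fun_dirderiv_differentiable[OF assms(1)]
      smooth_fun_dirderiv_differentiable[OF assms(2)])

lemma dirderiv_shift:
  assumes "smooth_fun f" "set vs \<subseteq> Basis"
  shows "dirderiv vs (\<lambda>x. f (x - t)) = (\<lambda>x. dirderiv vs f (x - t))"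
  using assms(2)
proof (induction vs)
  case (Cons v vs)
  have "frechet_derivative (\<lambda>x. dirderiv vs f (x - t)) (at x) = frechet_derivative (dirderiv vs f) (at (x - t))" for x
  proof -
    have f: "(dirderiv vs f has_derivative frechet_derivative (dirderiv vs f) (at (x - t))) (at (x - t))"
      using assms(1) Cons.prems by (auto intro!: frechet_derivative_works[THEN iffD1] smooth_fun_dirderiv_differentiable)
    have "((\<lambda>x. dirderiv vs f (x - t)) has_derivative (\<lambda>h. frechet_derivative (dirderiv vs f) (at (x - t)) h)) (at x)"
      by (rule has_derivative_compose[of "\<lambda>x. x - t" "\<lambda>h. h" x UNIV "dirderiv vs f", OF _ f]) (auto intro!: derivative_eq_intros)
    then show ?thesis by (rule frechet_derivative_at[symmetric])
  qed
  then show ?case using Cons by simp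
qed simp

lemma smooth_fun_shift:
  assumes "smooth_fun f"
  shows "smooth_fun (\<lambda>x. f (x - t))"
  unfolding smooth_fun_def
proof (intro allI impI)
  fix vs :: "'a list" and x assume vs: "set vs \<subseteq> Basis"
  have "dirderiv vs f differentiable (at (x - t))"
    using assms vs by (rule smooth_fun_dirderiv_differentiable)
  then have "(\<lambda>x. dirderiv vs f (x - t)) differentiable (at x)"
    using differentiable_chain_at[of "\<lambda>x. x - t" x "dirderiv vs f"] by (simp add: comp_def)
  then show "dirderiv vs (\<lambda>x. f (x - t)) differentiable (at x)"
    by (simp add: dirderiv_shift[OF assms vs])
qed

lemma test_fun_lincomb:
  assumes "test_fun f" "test_fun g"
  shows "test_fun (\<lambda>x. a * f x + b * g x)"
proof -
  have "bounded ({x. f x \<noteq> 0} \<union> {x. g x \<noteq> 0})" using assms by (simp add: test_fun_def)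
  then have "bounded {x. a * f x + b * g x \<noteq> 0}" by (rule bounded_subset) auto
  then show ?thesis using assms smooth_fun_lincomb by (auto simp: test_fun_def)
qed

lemma test_fun_diff: "test_fun f \<Longrightarrow> test_fun g \<Longrightarrow> test_fun (\<lambda>x. f x - g x)"
  using test_fun_lincomb[of f g 1 "-1"] by simp

lemma test_fun_cmult: "test_fun f \<Longrightarrow> test_fun (\<lambda>x. c * f x)"
  using test_fun_lincomb[of f f c 0] by simp

lemma test_fun_shift:
  assumes "test_fun f"
  shows "test_fun (\<lambda>x. f (x - t))"
proof -
  have "bounded ((\<lambda>x. x + t) ` {x. f x \<noteq> 0})" using assms by (intro bounded_translation_minus[of _ "- t", simplified]) (simp add: test_fun_def)
  then have "bounded {x. f (x - t) \<noteq> 0}"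
    by (rule bounded_subset) (force intro: image_eqI[of _ _ "_ - t"])
  then show ?thesis using assms smooth_fun_shift by (auto simp: test_fun_def)
qed

lemma smooth_fun_zero: "smooth_fun (\<lambda>x. 0)"
proof (rule smooth_coinduct[of _ "{\<lambda>x. 0}"])
qed auto

lemma test_fun_zero: "test_fun (\<lambda>x. 0)"
  by (simp add: test_fun_def smooth_fun_zero)

lemma test_fun_sum:
  assumes "finite J" "\<And>i. i \<in> J \<Longrightarrow> test_fun (f i)"
  shows "test_fun (\<lambda>x. \<Sum>i\<in>J. c i * f i x)"
  using assms
proof (induction J rule: finite_induct)
  case (insert i J)
  then show ?case using test_fun_lincomb[of "f i" "\<lambda>x. \<Sum>i\<in>J. c i * f i x" "c i" 1] by simp
qed (simp add: test_fun_zero)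

lemma test_fun_continuous: "test_fun f \<Longrightarrow> continuous_on UNIV f"
  using smooth_fun_dirderiv_differentiable[of f "[]"]
  by (auto simp: test_fun_def continuous_on_eq_continuous_at intro!: differentiable_imp_continuous_within)

lemma borel_measurable_test_fun: "test_fun f \<Longrightarrow> f \<in> borel_measurable borel"
  by (intro borel_measurable_continuous_onI test_fun_continuous)

lemma dirderiv_eq_0_outside:
  assumes "{x. f x \<noteq> 0} \<subseteq> K" "closed K" "x \<notin> K"
  shows "dirderiv vs f x = 0"
  using assms(3)
proof (induction vs arbitrary: x)
  case (Cons v vs)
  have "(dirderiv vs f has_derivative (\<lambda>_. 0)) (at x)"
    by (rule has_derivative_transform_within_open[where f="\<lambda>_. 0" and s="- K"])
       (use Cons assms(2) in auto)
  then have "(\<lambda>_. 0) = frechet_derivative (dirderiv vs f) (at x)" by (rule frechet_derivative_at)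
  from fun_cong[OF this, of v] show ?case by simp
qed (use assms(1) in auto)

lemma test_fun_support:
  assumes "test_fun f"
  obtains r where "0 < r" "{x. f x \<noteq> 0} \<subseteq> ball 0 r"
  using bounded_subset_ballD[of "{x. f x \<noteq> 0}" 0] assms by (auto simp: test_fun_def)

lemma test_fun_dirderiv_bounded:
  assumes "test_fun f" "set vs \<subseteq> Basis"
  obtains B where "\<And>x. \<bar>dirderiv vs f x\<bar> \<le> B"
proof -
  obtain r where "{x. f x \<noteq> 0} \<subseteq> ball 0 r" using assms(1) by (rule test_fun_support)
  then have r: "{x. f x \<noteq> 0} \<subseteq> cball 0 r" using ball_subset_cball by (rule order_trans)
  have "continuous_on (cball 0 r) (dirderiv vs f)"
    unfolding continuous_on_eq_continuous_within
  proof
    fix x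
    have "dirderiv vs f differentiable (at x)"
      using assms by (intro smooth_fun_dirderiv_differentiable) (auto simp: test_fun_def)
    then show "continuous (at x within cball 0 r) (dirderiv vs f)"
      by (rule differentiable_imp_continuous_within[OF differentiable_at_withinI])
  qed
  then have "bounded (dirderiv vs f ` cball 0 r)" by (intro compact_imp_bounded compact_continuous_image) auto
  then obtain B where B: "\<And>x. x \<in> cball 0 r \<Longrightarrow> \<bar>dirderiv vs f x\<bar> \<le> B"
    unfolding bounded_iff by (auto simp only: ball_simps real_norm_def)
  have "\<bar>dirderiv vs f x\<bar> \<le> \<bar>B\<bar>" for x
    using B[of x] dirderiv_eq_0_outside[OF r closed_cball, of x vs] by (cases "x \<in> cball 0 r") auto
  then show thesis by (rule that)
qed

lemma test_fun_bounded:
  assumes "test_fun f"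
  obtains B where "\<And>x. \<bar>f x\<bar> \<le> B"
  using test_fun_dirderiv_bounded[where vs="[]", OF assms] by auto

section \<open>Convergence in the space of test functions\<close>

lemma D_conv_diff_zero:
  assumes "D_conv phis phi"
  shows "D_conv (\<lambda>n x. phis n x - phi x) (\<lambda>_. 0)"
proof -
  obtain K where K: "compact K" "{x. phi x \<noteq> 0} \<subseteq> K" "\<And>n. {x. phis n x \<noteq> 0} \<subseteq> K"
    using assms unfolding D_conv_def by blast
  have K': "{x. phis n x - phi x \<noteq> 0} \<subseteq> K" for n
  proof
    fix x assume "x \<in> {x. phis n x - phi x \<noteq> 0}"
    then have "phis n x \<noteq> 0 \<or> phi x \<noteq> 0" by auto
    then show "x \<in> K" using K(2) K(3)[of n] by auto
  qed
  show ?thesis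
    unfolding D_conv_def
  proof (intro conjI allI impI exI[of _ K])
    fix vs :: "'a list" assume "set vs \<subseteq> Basis"
    then show "uniform_limit UNIV (\<lambda>n. dirderiv vs (\<lambda>x. phis n x - phi x - 0)) (\<lambda>_. 0) sequentially"
      using assms by (simp add: D_conv_def)
  qed (use assms K' K(1) in \<open>auto simp: D_conv_def intro!: test_fun_diff test_fun_zero\<close>)
qed

text \<open>The hypothesis on G speaks of limits along null sequences only. Fed with the multiples
  \<open>phi / (n + 1)\<close> of one fixed function, it yields finiteness of the L2 norm of the
  convolution of G with phi by homogeneity.\<close>

lemma D_conv_divide_Suc:
  assumes "test_fun phi"
  shows "D_conv (\<lambda>n x. phi x / real (Suc n)) (\<lambda>_. 0)"
proof -
  have scale: "(\<lambda>x. phi x / real (Suc n)) = (\<lambda>x. inverse (real (Suc n)) * phi x + 0 * phi x)" for n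
    by (simp add: field_simps)
  have tf: "test_fun (\<lambda>x. phi x / real (Suc n))" for n
    unfolding scale using assms by (intro test_fun_lincomb)
  obtain r where "{x. phi x \<noteq> 0} \<subseteq> ball 0 r" using assms by (rule test_fun_support)
  then have r: "{x. phi x \<noteq> 0} \<subseteq> cball 0 r" using ball_subset_cball by (rule order_trans)
  have "uniform_limit UNIV (\<lambda>n. dirderiv vs (\<lambda>x. phi x / real (Suc n) - 0)) (\<lambda>_. 0) sequentially"
    if vs: "set vs \<subseteq> Basis" for vs
  proof -
    have sm: "smooth_fun phi" using assms by (simp add: test_fun_def)
    have eq: "dirderiv vs (\<lambda>x. phi x / real (Suc n) - 0) = (\<lambda>x. inverse (real (Suc n)) * dirderiv vs phi x)" for n
      using dirderiv_lincomb[OF sm sm vs, of "inverse (real (Suc n))" 0] by (simp only: scale diff_0_right mult_zero_left add_0_right)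
    obtain B where B: "\<And>x. \<bar>dirderiv vs phi x\<bar> \<le> B" using test_fun_dirderiv_bounded[OF assms vs] by blast
    have lim: "(\<lambda>n. inverse (real (Suc n)) * B) \<longlonglongrightarrow> 0"
      using tendsto_mult_left_zero[OF LIMSEQ_inverse_real_of_nat] .
    show ?thesis
      unfolding eq
    proof (rule uniform_limitI)
      fix e :: real assume e: "e > 0"
      have "eventually (\<lambda>n. inverse (real (Suc n)) * B < e) sequentially"
        using order_tendstoD(2)[OF lim e] .
      then show "\<forall>\<^sub>F n in sequentially. \<forall>x\<in>UNIV. dist (inverse (real (Suc n)) * dirderiv vs phi x) 0 < e"
      proof eventually_elim
        case (elim n)
        have "inverse (real (Suc n)) * \<bar>dirderiv vs phi x\<bar> \<le> inverse (real (Suc n)) * B" for x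
          using B by (intro mult_left_mono) auto
        then have "inverse (real (Suc n)) * \<bar>dirderiv vs phi x\<bar> < e" for x
          using elim by (rule le_less_trans)
        then show ?case by (simp add: dist_real_def abs_mult del: of_nat_Suc)
      qed
    qed
  qed
  then show ?thesis using r tf
    unfolding D_conv_def by (auto intro!: test_fun_zero exI[of _ "cball 0 r"])
qed

section \<open>A smooth bump built from exp(-1/t)\<close>

definition flat_exp :: "nat \<Rightarrow> real \<Rightarrow> real" where
  "flat_exp k t = (if t > 0 then exp (- 1 / t) / t ^ k else 0)"

text \<open>The powers of t in the denominator make the family \<open>flat_exp\<close> closed under
  differentiation up to linear combinations. The only delicate point is t = 0: a bound of order t^2
  makes the difference quotient there tend to 0. The constant is the reciprocal of the coefficient
  of the term of order k + 2 in the series of exp(1/t), the single term that is kept.\<close>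

lemma flat_exp_le:
  "\<bar>flat_exp k t\<bar> \<le> fact (k + 2) * t\<^sup>2"
proof (cases "t > 0")
  case True
  define c :: real where "c = fact (k + 2)"
  have c: "c > 0" by (simp add: c_def)
  have "(\<Sum>n\<in>{k+2}. inverse (fact n) * (1 / t) ^ n) \<le> (\<Sum>n. inverse (fact n) * (1 / t) ^ n)"
    using True by (intro sum_le_suminf summable_exp) auto
  then have "(1 / t) ^ (k + 2) / c \<le> exp (1 / t)"
    unfolding c_def by (simp add: exp_def divide_inverse mult.commute)
  then have "exp (- 1 / t) * ((1 / t) ^ (k + 2) / c) \<le> exp (- 1 / t) * exp (1 / t)"
    by (intro mult_left_mono) auto
  also have "\<dots> = 1" by (simp flip: exp_add)
  finally have "exp (- 1 / t) / (t ^ (k + 2) * c) \<le> 1"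
    by (simp add: power_divide)
  then have "exp (- 1 / t) \<le> t ^ (k + 2) * c"
    using True c by (subst (asm) pos_divide_le_eq) auto
  then have "exp (- 1 / t) \<le> (c * t\<^sup>2) * t ^ k"
    by (simp only: power_add mult_ac)
  then have "exp (- 1 / t) / t ^ k \<le> c * t\<^sup>2"
    using True by (subst pos_divide_le_eq) auto
  then show ?thesis using True unfolding c_def by (simp add: flat_exp_def)
qed (simp add: flat_exp_def)

lemma DERIV_flat_exp:
  "(flat_exp k has_real_derivative flat_exp (k + 2) t - real k * flat_exp (k + 1) t) (at t)"
proof -
  consider "t > 0" | "t < 0" | "t = 0" by linarith
  then show ?thesis
  proof cases
    case 1
    have "((\<lambda>t. exp (- 1 / t) / t ^ k) has_real_derivative
       exp (- 1 / t) / t ^ (k + 2) - real k * (exp (- 1 / t) / t ^ (k + 1))) (at t)"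
    proof -
      have e: "((\<lambda>t. exp (- 1 / t)) has_real_derivative exp (- 1 / t) / t\<^sup>2) (at t)"
        using 1 by (auto intro!: derivative_eq_intros simp: power2_eq_square)
      have "((\<lambda>t. exp (- 1 / t) / t ^ k) has_real_derivative
          (exp (- 1 / t) / t\<^sup>2 * t ^ k - exp (- 1 / t) * (real k * t ^ (k - 1))) / (t ^ k * t ^ k)) (at t)"
        using 1 by (intro DERIV_divide e) (auto intro!: derivative_eq_intros)
      moreover have "(E / t\<^sup>2 * t ^ k - E * (real k * t ^ (k - 1))) / (t ^ k * t ^ k)
          = E / t ^ (k + 2) - real k * (E / t ^ (k + 1))" for E :: real
        using 1 by (cases k) (simp_all add: field_simps power2_eq_square)
      ultimately show ?thesis by simp
    qed
    then have "((\<lambda>t. exp (- 1 / t) / t ^ k) has_real_derivative flat_exp (k + 2) t - real k * flat_exp (k + 1) t) (at t)"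
      using 1 by (simp add: flat_exp_def)
    then show ?thesis
      by (rule has_field_derivative_transform_within_open[of _ _ _ "{0<..}"]) (use 1 in \<open>auto simp: flat_exp_def\<close>)
  next
    case 2
    have "((\<lambda>_. 0) has_real_derivative flat_exp (k + 2) t - real k * flat_exp (k + 1) t) (at t)"
      using 2 by (simp add: flat_exp_def)
    then show ?thesis
      by (rule has_field_derivative_transform_within_open[of _ _ _ "{..<0}"]) (use 2 in \<open>auto simp: flat_exp_def\<close>)
  next
    case 3
    have "((\<lambda>h. flat_exp k h / h) \<longlongrightarrow> 0) (at 0)"
    proof (rule Lim_null_comparison)
      show "\<forall>\<^sub>F h in at 0. norm (flat_exp k h / h) \<le> fact (k + 2) * \<bar>h\<bar>"
      proof (rule eventually_at_filter[THEN iffD2], rule always_eventually, intro allI impI)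
        fix h :: real assume "h \<noteq> 0"
        then show "norm (flat_exp k h / h) \<le> fact (k + 2) * \<bar>h\<bar>"
          using flat_exp_le[of k h] by (simp add: pos_divide_le_eq power2_eq_square mult.assoc abs_mult[symmetric])
      qed
      show "((\<lambda>h. fact (k + 2) * \<bar>h\<bar>) \<longlongrightarrow> (0::real)) (at 0)"
        by (intro tendsto_mult_right_zero tendsto_rabs_zero tendsto_ident_at)
    qed
    then show ?thesis using 3 by (simp add: has_field_derivative_iff flat_exp_def)
  qed
qed

lemma real_polynomial_function_has_derivative:
  assumes "real_polynomial_function p"
  shows "\<exists>p'. (\<forall>x. (p has_derivative p' x) (at x)) \<and> (\<forall>v. real_polynomial_function (\<lambda>x. p' x v))"
  using assms
proof (induction p rule: real_polynomial_function.induct)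
  case (linear f)
  then show ?case by (intro exI[of _ "\<lambda>_. f"]) (auto intro: bounded_linear_imp_has_derivative real_polynomial_function.intros)
next
  case (const c)
  then show ?case by (intro exI[of _ "\<lambda>_ _. 0"]) (auto intro: real_polynomial_function.intros)
next
  case (add f g)
  then obtain f' g' where "\<And>x. (f has_derivative f' x) (at x)" "\<And>v. real_polynomial_function (\<lambda>x. f' x v)"
    "\<And>x. (g has_derivative g' x) (at x)" "\<And>v. real_polynomial_function (\<lambda>x. g' x v)" by blast
  then show ?case
    by (intro exI[of _ "\<lambda>x h. f' x h + g' x h"] conjI allI has_derivative_add real_polynomial_function.intros(3))
next
  case (mult f g)
  then obtain f' g' where "\<And>x. (f has_derivative f' x) (at x)" "\<And>v. real_polynomial_function (\<lambda>x. f' x v)"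
    "\<And>x. (g has_derivative g' x) (at x)" "\<And>v. real_polynomial_function (\<lambda>x. g' x v)" by blast
  with mult.hyps show ?case
    by (intro exI[of _ "\<lambda>x h. f x * g' x h + f' x h * g x"] conjI allI has_derivative_mult real_polynomial_function.intros(3,4))
qed

text \<open>The functions \<open>p x * flat_exp k (1 - x \<bullet> x)\<close> with \<open>p\<close> a polynomial are closed under directional
  derivatives.\<close>
lemma bump_exists:
  obtains phi :: "'a::euclidean_space \<Rightarrow> real"
  where "test_fun phi" "\<And>x. 0 \<le> phi x" "0 < phi 0"
proof -
  define T where "T x = 1 - x \<bullet> x" for x :: 'a
  have T: "(T has_derivative (\<lambda>h. - 2 * (x \<bullet> h))) (at x)" for x
    unfolding T_def by (auto intro!: derivative_eq_intros simp: inner_commute)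
  have inner: "real_polynomial_function (\<lambda>x::'a. x \<bullet> b)" for b
    by (intro real_polynomial_function.intros(1) bounded_linear_inner_left)
  have T_sum: "T = (\<lambda>x. 1 - (\<Sum>b\<in>Basis. (x \<bullet> b) * (x \<bullet> b)))" unfolding T_def by (subst euclidean_inner) simp
  have polyT: "real_polynomial_function T"
    unfolding T_sum by (intro real_polynomial_function_diff real_polynomial_function_sum inner
        real_polynomial_function.intros(2,4) finite_Basis)
  define P where "P = {\<lambda>x. p x * flat_exp k (T x) | p k. real_polynomial_function p}"
  have step: "((\<lambda>x. p x * flat_exp k (T x)) has_derivative
      (\<lambda>h. p x * ((flat_exp (k + 2) (T x) - real k * flat_exp (k + 1) (T x)) * (- 2 * (x \<bullet> h))) + p' h * flat_exp k (T x))) (at x)"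
    if "(p has_derivative p') (at x)" for p p' x k
  proof -
    have "((\<lambda>x. flat_exp k (T x)) has_derivative (\<lambda>h. (flat_exp (k + 2) (T x) - real k * flat_exp (k + 1) (T x)) * (- 2 * (x \<bullet> h)))) (at x)"
      by (rule has_derivative_compose[OF T DERIV_flat_exp[unfolded has_field_derivative_def]])
    then show ?thesis using that by (intro has_derivative_mult)
  qed
  have "smooth_fun (\<lambda>x. flat_exp 0 (T x))"
  proof (rule smooth_coinduct[of _ P])
    show "(\<lambda>x. flat_exp 0 (T x)) \<in> P" unfolding P_def by (auto intro!: exI[of _ "\<lambda>_. 1"] exI[of _ 0])
  next
    fix g x assume "g \<in> P"
    then obtain p k where g: "g = (\<lambda>x. p x * flat_exp k (T x))" and p: "real_polynomial_function p" by (auto simp: P_def)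
    show "g differentiable (at x)"
      unfolding g differentiable_def using step[OF frechet_derivative_works[THEN iffD1, OF differentiable_at_real_polynomial_function[OF p]]] by blast
  next
    fix g and v :: 'a assume "g \<in> P" "v \<in> Basis"
    then obtain p k where g: "g = (\<lambda>x. p x * flat_exp k (T x))" and p: "real_polynomial_function p" by (auto simp: P_def)
    define q where "q x = frechet_derivative p (at x) v" for x
    have qp: "real_polynomial_function q"
    proof -
      obtain p' where p': "\<And>x. (p has_derivative p' x) (at x)" "\<And>v. real_polynomial_function (\<lambda>x. p' x v)"
        using real_polynomial_function_has_derivative[OF p] by blast
      have "q = (\<lambda>x. p' x v)" unfolding q_def using frechet_derivative_at[OF p'(1)] by metis
      then show ?thesis using p'(2) by simp
    qed
    \<comment> \<open>Differentiation produces the indices k, k + 1 and k + 2. Lower indices are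
      rewritten as index k + 2 times powers of t, so that the derivative is again one polynomial
      times one \<open>flat_exp\<close>. For t <= 0 all sides are 0.\<close>
    have e1: "flat_exp (k + 1) t = t * flat_exp (k + 2) t" and e2: "flat_exp k t = t * (t * flat_exp (k + 2) t)" for t k
      by (auto simp: flat_exp_def field_simps)
    have "(\<lambda>x. frechet_derivative g (at x) v)
       = (\<lambda>x. (p x * (1 - real k * T x) * (- 2 * (x \<bullet> v)) + q x * (T x * T x)) * flat_exp (k + 2) (T x))"
    proof
      fix x
      have "frechet_derivative g (at x) = (\<lambda>h. p x * ((flat_exp (k + 2) (T x) - real k * flat_exp (k + 1) (T x)) * (- 2 * (x \<bullet> h)))
          + frechet_derivative p (at x) h * flat_exp k (T x))"
        unfolding g by (rule frechet_derivative_at[symmetric], rule step, rule frechet_derivative_works[THEN iffD1], rule differentiable_at_real_polynomial_function[OF p])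
      then show "frechet_derivative g (at x) v
       = (p x * (1 - real k * T x) * (- 2 * (x \<bullet> v)) + q x * (T x * T x)) * flat_exp (k + 2) (T x)"
        by (simp only: e1[of k] e2[of k] q_def) (simp add: algebra_simps)
    qed
    moreover have "real_polynomial_function (\<lambda>x. p x * (1 - real k * T x) * (- 2 * (x \<bullet> v)) + q x * (T x * T x))"
      by (intro real_polynomial_function.intros(3,4) real_polynomial_function_diff
          real_polynomial_function.intros(2) p qp polyT inner)
    ultimately show "(\<lambda>x. frechet_derivative g (at x) v) \<in> P"
      unfolding P_def by (intro CollectI exI[of _ "\<lambda>x. p x * (1 - real k * T x) * (- 2 * (x \<bullet> v)) + q x * (T x * T x)"]
          exI[of _ "k + 2"] conjI)
  qed
  moreover have "bounded {x. flat_exp 0 (T x) \<noteq> 0}"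
  proof (rule bounded_subset[OF bounded_cball[of 0 1]], rule subsetI)
    fix x assume "x \<in> {x. flat_exp 0 (T x) \<noteq> 0}"
    then have "x \<bullet> x < 1" by (auto simp: flat_exp_def T_def split: if_splits)
    then have "norm x < 1" by (simp add: norm_eq_sqrt_inner)
    then show "x \<in> cball 0 1" by simp
  qed
  ultimately have "test_fun (\<lambda>x. flat_exp 0 (T x))" by (simp add: test_fun_def)
  then show thesis by (rule that) (auto simp: flat_exp_def T_def)
qed

section \<open>The characteristic exponent and its modular\<close>

text \<open>An even substitute for |psi| that increases with |u| and contains no drift, the drift
  being absorbed by the compensator once the symbol is centered. It takes values in the extended
  half line because its finiteness rests on the first moment of the large jumps, which is
  established only later. \<open>modular\<close> is the corresponding Orlicz modular.\<close>

definition levy_modular :: "real \<Rightarrow> real measure \<Rightarrow> real \<Rightarrow> ennreal" where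
  "levy_modular a nu u = ennreal (a * u\<^sup>2 / 2) + (\<integral>\<^sup>+r. ennreal (huber (r * u)) \<partial>nu)"

definition modular :: "real \<Rightarrow> real measure \<Rightarrow> ('a::euclidean_space \<Rightarrow> real) \<Rightarrow> ennreal" where
  "modular a nu h = (\<integral>\<^sup>+x. levy_modular a nu (h x) \<partial>lborel)"

locale levy_symbol =
  fixes a \<gamma> :: real and nu :: "real measure"
  assumes triplet: "levy_triplet a \<gamma> nu"
begin

lemma a_nonneg [simp]: "0 \<le> a"
  using triplet by (simp add: levy_triplet_def)

lemma levy_measure: "levy_measure nu"
  using triplet by (simp add: levy_triplet_def)

lemma sets_nu [measurable_cong, simp]: "sets nu = sets borel"
  using levy_measure by (simp add: levy_measure_def)

lemma space_nu [simp]: "space nu = UNIV"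
  using sets_eq_imp_space_eq[OF sets_nu] by simp

lemma measurable_nu [simp]: "measurable nu N = measurable borel N"
  by (rule measurable_cong_sets) simp_all

lemma nn_integral_min_sq: "(\<integral>\<^sup>+r. ennreal (min 1 (r\<^sup>2)) \<partial>nu) < \<infinity>"
  using levy_measure by (simp add: levy_measure_def)

lemma integrable_min_sq: "integrable nu (\<lambda>r. min 1 (r\<^sup>2))"
  using nn_integral_min_sq by (intro integrableI_nonneg) auto

text \<open>The exchange of integrals over jumps and over space requires this. The Levy measure may
  be infinite near 0, but on the set where |r| > 1/(n+1) the integrable function min(1, r^2) is at
  least 1/(n+1)^2; the remaining point 0 carries no mass.\<close>

sublocale sigma_finite_measure nu
proof
  define A where "A n = {r::real. 1 / real (Suc n) < \<bar>r\<bar>}" for n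
  have "emeasure nu (A n) < \<infinity>" for n
  proof -
    define c where "c = (real (Suc n))\<^sup>2"
    have "emeasure nu (A n) = (\<integral>\<^sup>+r. indicator (A n) r \<partial>nu)" by (simp add: A_def)
    also have "\<dots> \<le> (\<integral>\<^sup>+r. ennreal c * ennreal (min 1 (r\<^sup>2)) \<partial>nu)"
    proof (intro nn_integral_mono)
      fix r :: real
      show "indicator (A n) r \<le> ennreal c * ennreal (min 1 (r\<^sup>2))"
      proof (cases "r \<in> A n")
        case True
        then have "1 < \<bar>r\<bar> * real (Suc n)" by (simp add: A_def pos_divide_less_eq)
        then have "1\<^sup>2 \<le> (\<bar>r\<bar> * real (Suc n))\<^sup>2" by (intro power_mono) auto
        moreover have "1\<^sup>2 \<le> (real (Suc n))\<^sup>2" by (intro power_mono) auto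
        ultimately have "1 \<le> c * min 1 (r\<^sup>2)" by (simp add: c_def min_def power_mult_distrib mult.commute)
        then have "ennreal 1 \<le> ennreal (c * min 1 (r\<^sup>2))" by (rule ennreal_leI)
        then show ?thesis using True by (simp add: ennreal_mult c_def)
      qed simp
    qed
    also have "\<dots> < \<infinity>"
      using nn_integral_min_sq by (simp add: nn_integral_cmult ennreal_mult_less_top)
    finally show ?thesis .
  qed
  moreover have "emeasure nu {0} = 0" using levy_measure by (simp add: levy_measure_def)
  moreover have "(\<Union>n. A n) \<union> {0} = UNIV"
  proof -
    have "r \<in> (\<Union>n. A n) \<union> {0}" for r
    proof (cases "r = 0")
      case False
      then obtain n where "inverse (real (Suc n)) < \<bar>r\<bar>" using reals_Archimedean[of "\<bar>r\<bar>"] by auto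
      then show ?thesis by (auto simp: A_def inverse_eq_divide)
    qed simp
    then show ?thesis by auto
  qed
  moreover have "\<Union>(insert {0} (range A)) = (\<Union>n. A n) \<union> {0}" by auto
  moreover have "A n \<in> sets nu" for n by (simp add: A_def)
  ultimately show "\<exists>B. countable B \<and> B \<subseteq> sets nu \<and> \<Union>B = space nu \<and> (\<forall>b\<in>B. emeasure nu b \<noteq> \<infinity>)"
    by (intro exI[of _ "insert {0} (range A)"] conjI) (auto simp: less_top)
qed

abbreviation psi :: "real \<Rightarrow> complex" where "psi \<equiv> levy_exponent a \<gamma> nu"

definition compensated :: "real \<Rightarrow> real \<Rightarrow> complex" where
  "compensated z x = cis (x * z) - 1 - \<i> * of_real (x * z) * (if \<bar>x\<bar> \<le> 1 then 1 else 0)"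

lemma borel_measurable_compensated [measurable]: "compensated z \<in> borel_measurable borel"
  unfolding compensated_def by measurable

lemma psi_compensated: "psi z = \<i> * of_real (\<gamma> * z) - of_real (a * z\<^sup>2 / 2) + (\<integral>x. compensated z x \<partial>nu)"
  by (simp add: levy_exponent_def compensated_def)

lemma compensated_le: "norm (compensated z x) \<le> (2 + z\<^sup>2) * min 1 (x\<^sup>2)"
proof (cases "\<bar>x\<bar> \<le> 1")
  case True
  then have "x\<^sup>2 \<le> 1" by (simp add: abs_square_le_1)
  have "norm (compensated z x) \<le> \<bar>x * z\<bar>\<^sup>2 / 2"
    using iexp_approx1[of "x * z" 1] True by (simp add: compensated_def cis_conv_exp algebra_simps numeral_2_eq_2)
  also have "\<dots> \<le> (2 + z\<^sup>2) * x\<^sup>2"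
    by (simp add: power_mult_distrib algebra_simps)
  finally show ?thesis using \<open>x\<^sup>2 \<le> 1\<close> by (simp add: min_absorb2)
next
  case False
  have "1\<^sup>2 \<le> \<bar>x\<bar>\<^sup>2" using False by (intro power_mono) auto
  then have "min 1 (x\<^sup>2) = 1" by simp
  moreover have "norm (cis (x * z) - 1) \<le> 2"
    using norm_triangle_ineq4[of "cis (x * z)" 1] by simp
  moreover have "2 \<le> 2 + z\<^sup>2" by simp
  moreover have "compensated z x = cis (x * z) - 1" using False by (simp add: compensated_def)
  ultimately show ?thesis by (metis mult.right_neutral order_trans)
qed

lemma integrable_compensated: "integrable nu (compensated z)"
proof (rule Bochner_Integration.integrable_bound[OF integrable_mult_right[OF integrable_min_sq, of "2 + z\<^sup>2"]])
  show "AE x in nu. norm (compensated z x) \<le> norm ((2 + z\<^sup>2) * min 1 (x\<^sup>2))"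
    by (intro AE_I2 order_trans[OF compensated_le]) (simp add: abs_ge_self)
qed simp

lemma borel_measurable_psi [measurable]: "psi \<in> borel_measurable borel"
  unfolding levy_exponent_def by measurable

lemma norm_psi_le:
  "norm (psi z) \<le> \<bar>\<gamma>\<bar> * \<bar>z\<bar> + a * z\<^sup>2 / 2 + (2 + z\<^sup>2) * (\<integral>r. min 1 (r\<^sup>2) \<partial>nu)"
proof -
  have "norm (\<integral>x. compensated z x \<partial>nu) \<le> (\<integral>x. (2 + z\<^sup>2) * min 1 (x\<^sup>2) \<partial>nu)"
    by (rule order_trans[OF integral_norm_bound integral_mono])
       (use compensated_le integrable_compensated integrable_min_sq in auto)
  also have "\<dots> = (2 + z\<^sup>2) * (\<integral>r. min 1 (r\<^sup>2) \<partial>nu)" by (rule integral_mult_right_zero)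
  finally have "norm (\<integral>x. compensated z x \<partial>nu) \<le> (2 + z\<^sup>2) * (\<integral>r. min 1 (r\<^sup>2) \<partial>nu)" .
  moreover have "norm (\<i> * of_real (\<gamma> * z) - of_real (a * z\<^sup>2 / 2) :: complex) \<le> \<bar>\<gamma>\<bar> * \<bar>z\<bar> + a * z\<^sup>2 / 2"
    by (rule order_trans[OF norm_triangle_ineq4]) (simp add: norm_mult abs_mult norm_divide norm_power)
  ultimately show ?thesis
    unfolding psi_compensated by (rule order_trans[OF norm_triangle_ineq add_mono, rotated])
qed

lemma psi_0 [simp]: "psi 0 = 0"
  by (simp add: levy_exponent_def)

lemma integrable_1_minus_cos: "integrable nu (\<lambda>r. 1 - cos (r * z))"
proof -
  have "integrable nu (\<lambda>r. Re (compensated z r))" using integrable_compensated by (rule integrable_Re)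
  then have "integrable nu (\<lambda>r. - Re (compensated z r))" by (rule Bochner_Integration.integrable_minus)
  moreover have "- Re (compensated z r) = 1 - cos (r * z)" for r by (simp add: compensated_def)
  ultimately show ?thesis by simp
qed

text \<open>Drift and compensator are purely imaginary. The real part can therefore be analysed
  before anything is known about the first moment, and this is the entry point of
  \<open>first_moment\<close>.\<close>

lemma Re_psi: "Re (psi z) = - (a * z\<^sup>2 / 2) - (\<integral>r. 1 - cos (r * z) \<partial>nu)"
proof -
  have "Re (\<integral>r. compensated z r \<partial>nu) = (\<integral>r. Re (compensated z r) \<partial>nu)"
    by (rule integral_Re[OF integrable_compensated, symmetric])
  also have "\<dots> = (\<integral>r. - (1 - cos (r * z)) \<partial>nu)"
    by (rule Bochner_Integration.integral_cong) (auto simp: compensated_def)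
  also have "\<dots> = - (\<integral>r. 1 - cos (r * z) \<partial>nu)" by (rule Bochner_Integration.integral_minus)
  finally show ?thesis by (simp add: psi_compensated)
qed

section \<open>Monotonicity, scaling and quasi-subadditivity of the modular\<close>

lemma borel_measurable_levy_modular [measurable]: "levy_modular a nu \<in> borel_measurable borel"
  unfolding levy_modular_def by measurable

lemma levy_modular_0 [simp]: "levy_modular a nu 0 = 0"
  by (simp add: levy_modular_def)

lemma levy_modular_mono:
  assumes "\<bar>u\<bar> \<le> \<bar>v\<bar>"
  shows "levy_modular a nu u \<le> levy_modular a nu v"
proof -
  have "u\<^sup>2 \<le> v\<^sup>2" using assms by (simp add: abs_le_square_iff)
  moreover have "huber (r * u) \<le> huber (r * v)" for r
    using assms by (intro huber_mono) (simp add: abs_mult mult_left_mono)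
  ultimately show ?thesis unfolding levy_modular_def
    by (intro add_mono nn_integral_mono ennreal_leI) (auto intro!: mult_left_mono)
qed

lemma levy_modular_scale:
  "levy_modular a nu (c * u) \<le> ennreal (max \<bar>c\<bar> (c\<^sup>2)) * levy_modular a nu u"
proof -
  have "ennreal (a * (c * u)\<^sup>2 / 2) \<le> ennreal (max \<bar>c\<bar> (c\<^sup>2)) * ennreal (a * u\<^sup>2 / 2)"
  proof -
    have "c\<^sup>2 * (a * u\<^sup>2 / 2) \<le> max \<bar>c\<bar> (c\<^sup>2) * (a * u\<^sup>2 / 2)"
      by (intro mult_right_mono) auto
    then show ?thesis by (simp add: ennreal_mult[symmetric] power_mult_distrib ac_simps ennreal_leI)
  qed
  moreover have "(\<integral>\<^sup>+r. ennreal (huber (r * (c * u))) \<partial>nu) \<le> ennreal (max \<bar>c\<bar> (c\<^sup>2)) * (\<integral>\<^sup>+r. ennreal (huber (r * u)) \<partial>nu)"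
  proof -
    have "(\<integral>\<^sup>+r. ennreal (huber (r * (c * u))) \<partial>nu) \<le> (\<integral>\<^sup>+r. ennreal (max \<bar>c\<bar> (c\<^sup>2)) * ennreal (huber (r * u)) \<partial>nu)"
    proof (intro nn_integral_mono)
      fix r
      have "huber (r * (c * u)) \<le> max \<bar>c\<bar> (c\<^sup>2) * huber (r * u)"
        using huber_scale[of c "r * u"] by (simp add: mult.left_commute)
      then show "ennreal (huber (r * (c * u))) \<le> ennreal (max \<bar>c\<bar> (c\<^sup>2)) * ennreal (huber (r * u))"
        by (simp add: ennreal_mult[symmetric] ennreal_leI)
    qed
    then show ?thesis by (simp add: nn_integral_cmult)
  qed
  ultimately show ?thesis unfolding levy_modular_def distrib_left by (rule add_mono)
qed

lemma levy_modular_le: "levy_modular a nu u \<le> ennreal (max \<bar>u\<bar> (u\<^sup>2)) * levy_modular a nu 1"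
  using levy_modular_scale[of u 1] by simp

text \<open>The sum is at most twice the larger argument in absolute value, and doubling the
  argument costs the factor max(2, 2^2) = 4.\<close>

lemma levy_modular_add:
  "levy_modular a nu (u + v) \<le> 4 * (levy_modular a nu u + levy_modular a nu v)"
proof -
  have *: "levy_modular a nu (u + v) \<le> 4 * levy_modular a nu w" if "\<bar>u\<bar> \<le> \<bar>w\<bar>" "\<bar>v\<bar> \<le> \<bar>w\<bar>" for w
  proof -
    have "levy_modular a nu (u + v) \<le> levy_modular a nu (2 * w)" using that by (intro levy_modular_mono) auto
    also have "\<dots> \<le> 4 * levy_modular a nu w" using levy_modular_scale[of 2 w] by simp
    finally show ?thesis .
  qed
  have "levy_modular a nu (u + v) \<le> 4 * max (levy_modular a nu u) (levy_modular a nu v)"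
    using *[of u] *[of v] levy_modular_mono[of u v] levy_modular_mono[of v u]
    by (cases "\<bar>u\<bar> \<le> \<bar>v\<bar>") (simp_all add: max_absorb1 max_absorb2)
  also have "\<dots> \<le> 4 * (levy_modular a nu u + levy_modular a nu v)"
    by (intro mult_left_mono) (auto simp: max_def)
  finally show ?thesis .
qed

lemma modular_mono:
  assumes "\<And>x. \<bar>f x\<bar> \<le> \<bar>g x\<bar>"
  shows "modular a nu f \<le> modular a nu g"
  unfolding modular_def using assms by (intro nn_integral_mono levy_modular_mono) auto

lemma modular_scale:
  assumes [measurable]: "f \<in> borel_measurable borel"
  shows "modular a nu (\<lambda>x. c * f x) \<le> ennreal (max \<bar>c\<bar> (c\<^sup>2)) * modular a nu f"
  unfolding modular_def
  by (subst nn_integral_cmult[symmetric]) (auto intro!: nn_integral_mono levy_modular_scale)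

lemma modular_add:
  assumes [measurable]: "f \<in> borel_measurable borel" "g \<in> borel_measurable borel"
  shows "modular a nu (\<lambda>x. f x + g x) \<le> 4 * (modular a nu f + modular a nu g)"
proof -
  have "modular a nu (\<lambda>x. f x + g x) \<le> (\<integral>\<^sup>+x. 4 * (levy_modular a nu (f x) + levy_modular a nu (g x)) \<partial>lborel)"
    unfolding modular_def by (intro nn_integral_mono levy_modular_add)
  also have "\<dots> = 4 * (modular a nu f + modular a nu g)"
    unfolding modular_def by (simp add: nn_integral_cmult nn_integral_add)
  finally show ?thesis .
qed

end

text \<open>The drift is minus the mean of the large jumps, so it turns the compensator of the small
  jumps into a compensator of all jumps. This is what vanishing mean of the noise says about the
  triplet.\<close>

locale centered_levy_symbol = levy_symbol +
  assumes moment: "integrable nu (\<lambda>r. if \<bar>r\<bar> \<le> 1 then 0 else r)"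
    and centered: "\<gamma> + (\<integral>r. (if \<bar>r\<bar> \<le> 1 then 0 else r) \<partial>nu) = 0"
begin

lemma integrable_huber: "integrable nu huber"
proof (rule Bochner_Integration.integrable_bound)
  show "integrable nu (\<lambda>r. min 1 (r\<^sup>2) + norm (if \<bar>r\<bar> \<le> 1 then 0 else r))"
    using integrable_min_sq moment by (intro Bochner_Integration.integrable_add integrable_norm)
  have "\<bar>huber r\<bar> \<le> \<bar>min 1 (r\<^sup>2) + \<bar>if \<bar>r\<bar> \<le> 1 then 0 else r\<bar>\<bar>" for r
  proof (cases "\<bar>r\<bar> \<le> 1")
    case True
    then have "r\<^sup>2 \<le> 1" by (simp add: abs_square_le_1)
    then show ?thesis using True by (simp add: huber_def min_absorb2)
  next
    case False
    then have "1\<^sup>2 \<le> \<bar>r\<bar>\<^sup>2" by (intro power_mono) auto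
    then show ?thesis using False by (simp add: huber_def)
  qed
  then show "AE r in nu. norm (huber r) \<le> norm (min 1 (r\<^sup>2) + norm (if \<bar>r\<bar> \<le> 1 then 0 else r))"
    by (auto intro!: AE_I2)
qed simp

lemma levy_modular_1_finite: "levy_modular a nu 1 < \<infinity>"
  unfolding levy_modular_def
  by (simp add: nn_integral_eq_integral[OF integrable_huber] less_top)

lemma levy_modular_finite: "levy_modular a nu u < \<infinity>"
  using levy_modular_1_finite
  by (intro le_less_trans[OF levy_modular_le]) (auto simp: ennreal_mult_less_top)

lemma levy_modular_tendsto_0:
  assumes "u \<longlonglongrightarrow> 0"
  shows "(\<lambda>n. levy_modular a nu (u n)) \<longlonglongrightarrow> 0"
proof (rule tendsto_sandwich[OF _ _ tendsto_const])
  have "(\<lambda>n. max \<bar>u n\<bar> ((u n)\<^sup>2)) \<longlonglongrightarrow> max \<bar>0\<bar> (0\<^sup>2)"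
    using assms by (intro tendsto_intros)
  then have "(\<lambda>n. ennreal (max \<bar>u n\<bar> ((u n)\<^sup>2)) * levy_modular a nu 1) \<longlonglongrightarrow> ennreal (max \<bar>0\<bar> (0\<^sup>2)) * levy_modular a nu 1"
    using levy_modular_1_finite by (intro tendsto_mult_ennreal tendsto_ennrealI tendsto_const) auto
  then show "(\<lambda>n. ennreal (max \<bar>u n\<bar> ((u n)\<^sup>2)) * levy_modular a nu 1) \<longlonglongrightarrow> 0" by simp
qed (simp_all add: levy_modular_le)

lemma integrable_cis_compensated: "integrable nu (\<lambda>r. cis (r * z) - 1 - \<i> * of_real (r * z))"
proof -
  have "integrable nu (\<lambda>r. compensated z r - \<i> * z * of_real (if \<bar>r\<bar> \<le> 1 then 0 else r))"
    using moment integrable_compensated[of z]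
    by (intro Bochner_Integration.integrable_diff integrable_mult_right integrable_of_real)
  also have "(\<lambda>r. compensated z r - \<i> * z * of_real (if \<bar>r\<bar> \<le> 1 then 0 else r)) = (\<lambda>r. cis (r * z) - 1 - \<i> * of_real (r * z))"
    by (auto simp: compensated_def)
  finally show ?thesis .
qed

lemma psi_eq: "psi z = (\<integral>r. cis (r * z) - 1 - \<i> * of_real (r * z) \<partial>nu) - of_real (a * z\<^sup>2 / 2)"
proof -
  let ?m = "\<integral>r. (if \<bar>r\<bar> \<le> 1 then 0 else r) \<partial>nu"
  have "(\<integral>r. compensated z r \<partial>nu) = (\<integral>r. (cis (r * z) - 1 - \<i> * of_real (r * z)) + \<i> * z * of_real (if \<bar>r\<bar> \<le> 1 then 0 else r) \<partial>nu)"
    by (intro Bochner_Integration.integral_cong) (auto simp: compensated_def)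
  also have "\<dots> = (\<integral>r. cis (r * z) - 1 - \<i> * of_real (r * z) \<partial>nu) + \<i> * z * of_real ?m"
    using moment integrable_cis_compensated[of z]
    by (subst Bochner_Integration.integral_add)
       (auto simp del: of_real_mult intro!: integrable_mult_right integrable_of_real)
  also have "?m = - \<gamma>" using centered by linarith
  finally show ?thesis unfolding psi_compensated by simp
qed

lemma psi_le_modular: "ennreal (norm (psi z)) \<le> 4 * levy_modular a nu z"
proof -
  have int: "integrable nu (\<lambda>r. huber (r * z))"
  proof (rule Bochner_Integration.integrable_bound)
    show "integrable nu (\<lambda>r. max \<bar>z\<bar> (z\<^sup>2) * huber r)" using integrable_huber by (rule integrable_mult_right)
    show "AE r in nu. norm (huber (r * z)) \<le> norm (max \<bar>z\<bar> (z\<^sup>2) * huber r)"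
      using huber_scale[of z] by (auto intro!: AE_I2 simp: mult.commute[of _ z] intro: order_trans[OF _ abs_ge_self])
  qed simp
  have "norm (\<integral>r. cis (r * z) - 1 - \<i> * of_real (r * z) \<partial>nu) \<le> (\<integral>r. 4 * huber (r * z) \<partial>nu)"
    by (rule order_trans[OF integral_norm_bound integral_mono])
       (use cis_approx_huber int integrable_cis_compensated in \<open>auto simp del: of_real_mult\<close>)
  then have "norm (psi z) \<le> 4 * (\<integral>r. huber (r * z) \<partial>nu) + a * z\<^sup>2 / 2"
    unfolding psi_eq
    by (intro order_trans[OF norm_triangle_ineq4] add_mono) (auto simp: norm_mult norm_divide norm_power)
  also have "\<dots> \<le> 4 * (a * z\<^sup>2 / 2 + (\<integral>r. huber (r * z) \<partial>nu))" by simp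
  finally have "ennreal (norm (psi z)) \<le> ennreal (4 * (a * z\<^sup>2 / 2 + (\<integral>r. huber (r * z) \<partial>nu)))"
    by (rule ennreal_leI)
  also have "\<dots> = 4 * levy_modular a nu z"
    unfolding levy_modular_def using int
    by (subst ennreal_mult) (auto simp: nn_integral_eq_integral)
  finally show ?thesis .
qed

lemma psi_tendsto:
  assumes u: "u \<longlonglongrightarrow> z"
  shows "(\<lambda>n. psi (u n)) \<longlonglongrightarrow> psi z"
proof -
  obtain B where B: "\<And>n. \<bar>u n\<bar> \<le> B" using convergent_imp_Bseq[OF convergentI[OF u]] by (auto simp: Bseq_def)
  have B0: "0 \<le> B" using B[of 0] by linarith
  have "(\<lambda>n. \<integral>r. cis (r * u n) - 1 - \<i> * of_real (r * u n) \<partial>nu) \<longlonglongrightarrow> (\<integral>r. cis (r * z) - 1 - \<i> * of_real (r * z) \<partial>nu)"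
  proof (rule integral_dominated_convergence[where w="\<lambda>r. 4 * (max B (B\<^sup>2) * huber r)"])
    show "integrable nu (\<lambda>r. 4 * (max B (B\<^sup>2) * huber r))"
      using integrable_huber by (intro integrable_mult_right)
    have "(\<lambda>n. cis (r * u n) - 1 - \<i> * of_real (r * u n)) \<longlonglongrightarrow> cis (r * z) - 1 - \<i> * of_real (r * z)" for r
      unfolding cis_conv_exp using u by (intro tendsto_intros)
    then show "AE r in nu. (\<lambda>n. cis (r * u n) - 1 - \<i> * of_real (r * u n)) \<longlonglongrightarrow> cis (r * z) - 1 - \<i> * of_real (r * z)"
      by (intro AE_I2)
    fix n
    have "norm (cis (r * u n) - 1 - \<i> * of_real (r * u n)) \<le> 4 * (max B (B\<^sup>2) * huber r)" for r
    proof -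
      have "huber (r * u n) \<le> huber (B * r)"
        using B[of n] B0 by (intro huber_mono) (simp add: abs_mult mult.commute[of _ "\<bar>r\<bar>"] mult_left_mono)
      also have "\<dots> \<le> max B (B\<^sup>2) * huber r" using huber_scale[of B r] B0 by simp
      finally show ?thesis using cis_approx_huber[of "r * u n"] by linarith
    qed
    then show "AE r in nu. norm (cis (r * u n) - 1 - \<i> * of_real (r * u n)) \<le> 4 * (max B (B\<^sup>2) * huber r)"
      by (intro AE_I2)
  qed simp_all
  moreover have "(\<lambda>n. complex_of_real (a * (u n)\<^sup>2 / 2)) \<longlonglongrightarrow> of_real (a * z\<^sup>2 / 2)"
    using u by (intro tendsto_intros) auto
  ultimately show ?thesis unfolding psi_eq by (intro tendsto_diff)
qed

text \<open>Scaling of the modular moves z into a factor, so finiteness for h alone covers every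
  frequency, and the exponent is small uniformly for z in a bounded interval when the modular is
  small.\<close>

lemma modular_char:
  fixes h :: "'b::euclidean_space \<Rightarrow> real"
  assumes [measurable]: "h \<in> borel_measurable borel" and fin: "modular a nu h < \<infinity>"
  shows integrable_psi: "integrable lborel (\<lambda>x. psi (z * h x))"
    and integral_psi_le: "ennreal (norm (\<integral>x. psi (z * h x) \<partial>lborel)) \<le> ennreal (4 * max \<bar>z\<bar> (z\<^sup>2)) * modular a nu h"
proof -
  have le: "(\<integral>\<^sup>+x. ennreal (norm (psi (z * h x))) \<partial>lborel) \<le> ennreal (4 * max \<bar>z\<bar> (z\<^sup>2)) * modular a nu h"
  proof -
    have "(\<integral>\<^sup>+x. ennreal (norm (psi (z * h x))) \<partial>lborel) \<le> (\<integral>\<^sup>+x. 4 * levy_modular a nu (z * h x) \<partial>lborel)"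
      by (intro nn_integral_mono psi_le_modular)
    also have "\<dots> = 4 * modular a nu (\<lambda>x. z * h x)" by (simp add: nn_integral_cmult modular_def)
    also have "\<dots> \<le> 4 * (ennreal (max \<bar>z\<bar> (z\<^sup>2)) * modular a nu h)" by (intro mult_left_mono modular_scale) auto
    also have "\<dots> = ennreal (4 * max \<bar>z\<bar> (z\<^sup>2)) * modular a nu h"
      by (subst ennreal_mult) (auto simp: mult.assoc)
    finally show ?thesis .
  qed
  also have "\<dots> < \<infinity>" using fin by (simp add: ennreal_mult_less_top)
  finally show int: "integrable lborel (\<lambda>x. psi (z * h x))" by (intro integrableI_bounded) auto
  have "ennreal (norm (\<integral>x. psi (z * h x) \<partial>lborel)) \<le> ennreal (\<integral>x. norm (psi (z * h x)) \<partial>lborel)"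
    by (intro ennreal_leI integral_norm_bound)
  also have "\<dots> = (\<integral>\<^sup>+x. ennreal (norm (psi (z * h x))) \<partial>lborel)"
    using int by (intro nn_integral_eq_integral[symmetric]) auto
  finally show "ennreal (norm (\<integral>x. psi (z * h x) \<partial>lborel)) \<le> ennreal (4 * max \<bar>z\<bar> (z\<^sup>2)) * modular a nu h"
    using le by (rule order_trans)
qed

end

section \<open>Integrals of simple functions\<close>

text \<open>Mean value inequality on the convex half plane Re z <= 0, where the derivative of exp
  has modulus at most 1.\<close>

lemma norm_exp_minus_1_le:
  fixes w :: complex
  assumes "Re w \<le> 0"
  shows "norm (1 - exp w) \<le> norm w"
proof -
  have "norm (exp 0 - exp w) \<le> 1 * norm (0 - w)"
    by (rule field_differentiable_bound[of "{z. Re z \<le> 0}" exp exp])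
       (use assms in \<open>auto intro!: convex_halfspace_Re_le derivative_eq_intros simp: norm_exp_eq_Re\<close>)
  then show ?thesis by simp
qed

lemma bsetsI: "A \<in> sets borel \<Longrightarrow> bounded A \<Longrightarrow> A \<in> bsets"
  by (simp add: bsets_def)

lemma bsets_borel [measurable_dest]: "A \<in> bsets \<Longrightarrow> A \<in> sets borel"
  by (simp add: bsets_def)

lemma bsets_empty [simp]: "{} \<in> bsets"
  by (simp add: bsets_def)

lemma bsets_Int: "A \<in> bsets \<Longrightarrow> B \<in> sets borel \<Longrightarrow> B \<inter> A \<in> bsets"
  by (auto simp: bsets_def intro: bounded_subset)

lemma bsets_Diff: "A \<in> bsets \<Longrightarrow> B \<in> sets borel \<Longrightarrow> A - B \<in> bsets"
  by (auto simp: bsets_def intro: bounded_subset)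

lemma bsets_Un: "A \<in> bsets \<Longrightarrow> B \<in> bsets \<Longrightarrow> A \<union> B \<in> bsets"
  by (auto simp: bsets_def)

lemma bsets_UN: "finite I \<Longrightarrow> (\<And>i. i \<in> I \<Longrightarrow> A i \<in> bsets) \<Longrightarrow> (\<Union>i\<in>I. A i) \<in> bsets"
  by (induction I rule: finite_induct) (auto intro: bsets_Un)

lemma emeasure_bsets_finite: "A \<in> bsets \<Longrightarrow> emeasure lborel A < \<infinity>"
  using emeasure_bounded_finite[of A] by (simp add: bsets_def)

locale centered_levy_basis = prob_space M + nu: centered_levy_symbol a \<gamma> nu
  for M :: "'w measure" and a \<gamma> nu +
  fixes L :: "'a::euclidean_space set \<Rightarrow> 'w \<Rightarrow> real"
  assumes basis: "levy_basis M a \<gamma> nu L"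
begin

abbreviation psi :: "real \<Rightarrow> complex" where "psi \<equiv> levy_exponent a \<gamma> nu"

lemma L_measurable [measurable]: "A \<in> bsets \<Longrightarrow> L A \<in> borel_measurable M"
  using basis by (simp add: levy_basis_def)

lemma L_char: "A \<in> bsets \<Longrightarrow> (\<integral>\<omega>. cis (z * L A \<omega>) \<partial>M) = exp (of_real (measure lborel A) * psi z)"
  using basis by (simp add: levy_basis_def)

lemma L_indep:
  fixes I :: "nat set"
  assumes "finite I" "\<And>i. i \<in> I \<Longrightarrow> A i \<in> bsets" "disjoint_family_on A I"
  shows "indep_vars (\<lambda>_. borel) (\<lambda>i. L (A i)) I"
proof -
  have "\<forall>(I::nat set) A. finite I \<longrightarrow> (\<forall>i\<in>I. A i \<in> bsets) \<longrightarrow> disjoint_family_on A I \<longrightarrow>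
      indep_vars (\<lambda>_. borel) (\<lambda>i. L (A i)) I"
    using basis unfolding levy_basis_def by (elim conjE) assumption
  then show ?thesis using assms by simp
qed

lemma L_sums:
  assumes "range A \<subseteq> bsets" "disjoint_family A" "\<Union>(range A) \<in> bsets"
  shows "AE \<omega> in M. (\<lambda>n. L (A n) \<omega>) sums L (\<Union>(range A)) \<omega>"
proof -
  have "\<forall>A. range A \<subseteq> bsets \<longrightarrow> disjoint_family A \<longrightarrow> \<Union>(range A) \<in> bsets \<longrightarrow>
      (AE \<omega> in M. (\<lambda>n. L (A n) \<omega>) sums L (\<Union>(range A)) \<omega>)"
    using basis unfolding levy_basis_def by (elim conjE) assumption
  then show ?thesis using assms by simp
qed

text \<open>Countable additivity is applied to the constant sequence of empty sets: a convergent
  series with constant terms has terms 0.\<close>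

lemma L_empty: "AE \<omega> in M. L {} \<omega> = 0"
proof -
  have "AE \<omega> in M. (\<lambda>n::nat. L {} \<omega>) sums L {} \<omega>"
    using L_sums[of "\<lambda>_. {}"] by (simp add: disjoint_family_on_def)
  then show ?thesis
    by eventually_elim (auto dest!: sums_summable simp: summable_const_iff)
qed

lemma L_Un:
  assumes A: "A \<in> bsets" and B: "B \<in> bsets" and disj: "A \<inter> B = {}"
  shows "AE \<omega> in M. L (A \<union> B) \<omega> = L A \<omega> + L B \<omega>"
proof -
  define C where "C n = (if n = 0 then A else if n = 1 then B else {})" for n :: nat
  have U: "\<Union>(range C) = A \<union> B"
    by (auto simp: C_def split: if_splits intro: exI[of _ 0] exI[of _ "1::nat"])
  have "AE \<omega> in M. (\<lambda>n. L (C n) \<omega>) sums L (\<Union>(range C)) \<omega>"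
    by (rule L_sums) (use A B disj bsets_Un in \<open>auto simp: C_def U disjoint_family_on_def\<close>)
  with L_empty show ?thesis
  proof eventually_elim
    case (elim \<omega>)
    have "(\<lambda>n. L (C n) \<omega>) sums (\<Sum>n\<in>{0, 1}. L (C n) \<omega>)"
      by (rule sums_finite) (auto simp: C_def elim)
    then have "(\<lambda>n. L (C n) \<omega>) sums (L A \<omega> + L B \<omega>)" by (simp add: C_def)
    with elim(2) show ?case unfolding U by (rule sums_unique2)
  qed
qed

lemma L_UN:
  assumes "finite I" "\<And>i. i \<in> I \<Longrightarrow> A i \<in> bsets" "disjoint_family_on A I"
  shows "AE \<omega> in M. L (\<Union>i\<in>I. A i) \<omega> = (\<Sum>i\<in>I. L (A i) \<omega>)"
  using assms
proof (induction I rule: finite_induct)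
  case empty
  then show ?case using L_empty by simp
next
  case (insert i I)
  have "A i \<inter> (\<Union>j\<in>I. A j) = {}" using insert by (auto simp: disjoint_family_on_def)
  then have "AE \<omega> in M. L (A i \<union> (\<Union>j\<in>I. A j)) \<omega> = L (A i) \<omega> + L (\<Union>j\<in>I. A j) \<omega>"
    using insert by (intro L_Un bsets_UN) auto
  moreover have "AE \<omega> in M. L (\<Union>j\<in>I. A j) \<omega> = (\<Sum>j\<in>I. L (A j) \<omega>)"
    using insert by (auto simp: disjoint_family_on_def)
  ultimately show ?case by eventually_elim (use insert in simp)
qed

text \<open>A relation instead of a function of h: a step function has many representations, and
  since L is additive only almost surely they give random variables that agree merely up to null
  sets.\<close>

definition simple_integral :: "('a \<Rightarrow> real) \<Rightarrow> ('w \<Rightarrow> real) \<Rightarrow> bool" where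
  "simple_integral h S \<longleftrightarrow> (\<exists>(n::nat) c A. (\<forall>j. A j \<in> bsets) \<and>
     h = (\<lambda>x. \<Sum>j<n. c j * indicator (A j) x) \<and> S = (\<lambda>\<omega>. \<Sum>j<n. c j * L (A j) \<omega>))"

lemma simple_integralI:
  fixes n :: nat
  assumes "\<And>j. A j \<in> bsets"
  shows "simple_integral (\<lambda>x. \<Sum>j<n. c j * indicator (A j) x) (\<lambda>\<omega>. \<Sum>j<n. c j * L (A j) \<omega>)"
  unfolding simple_integral_def 
  by (intro exI[of _ n] exI[of _ c] exI[of _ A] conjI allI refl assms)

lemma simple_integralE:
  assumes "simple_integral h S"
  obtains n :: nat and c A where "\<And>j. A j \<in> bsets" "h = (\<lambda>x. \<Sum>j<n. c j * indicator (A j) x)"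
    "S = (\<lambda>\<omega>. \<Sum>j<n. c j * L (A j) \<omega>)"
  using assms unfolding simple_integral_def by auto

lemma simple_integral_measurable:
  assumes "simple_integral h S"
  shows "h \<in> borel_measurable borel" "S \<in> borel_measurable M"
proof -
  obtain n c A where A: "\<And>j. A j \<in> bsets"
    and h: "h = (\<lambda>x. \<Sum>j<(n::nat). c j * indicator (A j) x)" "S = (\<lambda>\<omega>. \<Sum>j<n. c j * L (A j) \<omega>)"
    using assms by (rule simple_integralE) (rule that)
  have [measurable]: "A j \<in> sets borel" "A j \<in> bsets" for j using A bsets_borel by auto
  show "h \<in> borel_measurable borel" "S \<in> borel_measurable M"
    unfolding h by (intro borel_measurable_sum borel_measurable_times borel_measurable_const, measurable)+
qed

lemma simple_integral_lincomb:
  assumes "simple_integral h S" "simple_integral g T"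
  shows "simple_integral (\<lambda>x. \<alpha> * h x + \<beta> * g x) (\<lambda>\<omega>. \<alpha> * S \<omega> + \<beta> * T \<omega>)"
proof -
  obtain n c A where A: "\<And>j. A j \<in> bsets"
    and h: "h = (\<lambda>x. \<Sum>j<(n::nat). c j * indicator (A j) x)" "S = (\<lambda>\<omega>. \<Sum>j<n. c j * L (A j) \<omega>)"
    using assms(1) by (rule simple_integralE) (rule that)
  obtain m d B where B: "\<And>j. B j \<in> bsets"
    and g: "g = (\<lambda>x. \<Sum>j<(m::nat). d j * indicator (B j) x)" "T = (\<lambda>\<omega>. \<Sum>j<m. d j * L (B j) \<omega>)"
    using assms(2) by (rule simple_integralE) (rule that)
  define e where "e j = (if j < n then \<alpha> * c j else \<beta> * d (j - n))" for j
  define C where "C j = (if j < n then A j else B (j - n))" for j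
  have *: "(\<Sum>j<n+m. e j * F (C j)) = \<alpha> * (\<Sum>j<n. c j * F (A j)) + \<beta> * (\<Sum>j<m. d j * F (B j))" for F :: "'a set \<Rightarrow> real"
  proof -
    have U: "{..<n+m} = {..<n} \<union> {n..<n+m}" by auto
    have "(\<Sum>j<n+m. e j * F (C j)) = (\<Sum>j<n. e j * F (C j)) + (\<Sum>j\<in>{n..<n+m}. e j * F (C j))"
      by (subst U, rule sum.union_disjoint) auto
    also have "(\<Sum>j\<in>{n..<n+m}. e j * F (C j)) = (\<Sum>j<m. e (j + n) * F (C (j + n)))"
      by (rule sum.reindex_bij_witness[of _ "\<lambda>j. j + n" "\<lambda>j. j - n"]) auto
    finally show ?thesis by (simp add: e_def C_def sum_distrib_left mult.assoc)
  qed
  have "simple_integral (\<lambda>x. \<Sum>j<n+m. e j * indicator (C j) x) (\<lambda>\<omega>. \<Sum>j<n+m. e j * L (C j) \<omega>)"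
    using A B by (intro simple_integralI) (auto simp: C_def)
  then show ?thesis
    unfolding h g using *[of "\<lambda>X. indicator X _"] *[of "\<lambda>X. L X _"] by simp
qed

lemma simple_integral_diff:
  "simple_integral h S \<Longrightarrow> simple_integral g T \<Longrightarrow> simple_integral (\<lambda>x. h x - g x) (\<lambda>\<omega>. S \<omega> - T \<omega>)"
  using simple_integral_lincomb[of h S g T 1 "-1"] by simp

text \<open>Independence of L is available for disjoint sets only, so the representation has to be
  refined. The sets are added one at a time: a new set A n cuts each block D j into D j \<inter> A n
  and D j - A n and contributes the rest A n - U as a further block.\<close>

lemma simple_integral_disjoint:
  assumes "simple_integral h S"
  shows "\<exists>(n::nat) c A. (\<forall>j. A j \<in> bsets) \<and> disjoint_family_on A {..<n} \<and>
     h = (\<lambda>x. \<Sum>j<n. c j * indicator (A j) x) \<and> (AE \<omega> in M. S \<omega> = (\<Sum>j<n. c j * L (A j) \<omega>))"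
proof -
  have "\<exists>(m::nat) d D. (\<forall>j. D j \<in> bsets) \<and> disjoint_family_on D {..<m} \<and>
     (\<lambda>x. \<Sum>j<n. c j * indicator (A j) x) = (\<lambda>x. \<Sum>j<m. d j * indicator (D j) x) \<and>
     (AE \<omega> in M. (\<Sum>j<n. c j * L (A j) \<omega>) = (\<Sum>j<m. d j * L (D j) \<omega>))"
    if A: "\<And>j. A j \<in> bsets" for n :: nat and c :: "nat \<Rightarrow> real" and A :: "nat \<Rightarrow> 'a set"
  proof (induction n)
    case 0
    show ?case
      by (rule exI[of _ "0::nat"], rule exI[of _ "\<lambda>_. 0"], rule exI[of _ "\<lambda>_. {}"]) (simp add: disjoint_family_on_def)
  next
    case (Suc n)
    then obtain m d D where D: "\<And>j. D j \<in> bsets" "disjoint_family_on D {..<(m::nat)}"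
      "\<And>x. (\<Sum>j<n. c j * indicator (A j) x) = (\<Sum>j<m. d j * indicator (D j) x)"
      "AE \<omega> in M. (\<Sum>j<n. c j * L (A j) \<omega>) = (\<Sum>j<m. d j * L (D j) \<omega>)" by metis
    define U where "U = (\<Union>j<m. D j)"
    have U: "U \<in> bsets" unfolding U_def using D by (intro bsets_UN) auto
    \<comment> \<open>Indices below m hold the inner pieces, those from m to 2m - 1 the outer
      pieces, and index 2m the part of A n that is new. Later indices repeat that set so that every
      E j is admissible.\<close>
    define E where "E j = (if j < m then D j \<inter> A n else if j < 2 * m then D (j - m) - A n else A n - U)" for j
    define e where "e j = (if j < m then d j + c n else if j < 2 * m then d (j - m) else c n)" for j
    have sum_E: "(\<Sum>j<2*m+1. e j * F (E j)) =
        (\<Sum>j<m. (d j + c n) * F (D j \<inter> A n)) + (\<Sum>j<m. d j * F (D j - A n)) + c n * F (A n - U)" for F :: "'a set \<Rightarrow> real"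
    proof -
      have "(\<Sum>j<2*m. e j * F (E j)) = (\<Sum>j<m. e j * F (E j)) + (\<Sum>j\<in>{m..<2*m}. e j * F (E j))"
      proof -
        have U: "{..<2*m} = {..<m} \<union> {m..<2*m}" by auto
        show ?thesis by (subst U, rule sum.union_disjoint) auto
      qed
      also have "(\<Sum>j\<in>{m..<2*m}. e j * F (E j)) = (\<Sum>j<m. e (j + m) * F (E (j + m)))"
        by (rule sum.reindex_bij_witness[of _ "\<lambda>j. j + m" "\<lambda>j. j - m"]) auto
      finally show ?thesis by (simp add: E_def e_def)
    qed
    \<comment> \<open>F is kept abstract because the same identity is used twice: for the indicators
      at a point x, and for the values of L at a sample point where the finitely additive relations
      hold.\<close>
    have sum_split: "(\<Sum>j<m. d j * F (D j)) + c n * F (A n) = (\<Sum>j<2*m+1. e j * F (E j))"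
      if An: "F (A n) = (\<Sum>j<m. F (D j \<inter> A n)) + F (A n - U)"
        and Dj: "\<And>j. F (D j) = F (D j \<inter> A n) + F (D j - A n)" for F :: "'a set \<Rightarrow> real"
    proof -
      have "(\<Sum>j<m. d j * F (D j)) = (\<Sum>j<m. d j * F (D j \<inter> A n) + d j * F (D j - A n))"
        by (intro sum.cong refl) (simp only: Dj distrib_left)
      moreover have "c n * F (A n) = (\<Sum>j<m. c n * F (D j \<inter> A n)) + c n * F (A n - U)"
        by (simp only: An distrib_left sum_distrib_left)
      ultimately show ?thesis
        unfolding sum_E distrib_right sum.distrib by linarith
    qed
    have D': "D i \<inter> D j = {}" if "i < m" "j < m" "i \<noteq> j" for i j
      using D(2) that by (auto simp: disjoint_family_on_def)
    have disj: "disjoint_family_on E {..<2*m+1}"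
      unfolding disjoint_family_on_def
    proof (intro ballI impI)
      fix i j assume ij: "i \<in> {..<2*m+1}" "j \<in> {..<2*m+1}" "i \<noteq> j"
      have DU: "D i \<subseteq> U" if "i < m" for i using that by (auto simp: U_def)
      have "i - m \<noteq> j - m" if "\<not> i < m" "\<not> j < m" using ij that by arith
      moreover have "k - m < m" if "\<not> k < m" "k < 2 * m" for k using that by arith
      ultimately show "E i \<inter> E j = {}"
        using ij D'[of i j] D'[of "i - m" "j - m"] D'[of i "j - m"] D'[of "i - m" j] DU[of i] DU[of j] DU[of "i - m"] DU[of "j - m"]
        by (cases "i < m"; cases "j < m"; cases "i < 2 * m"; cases "j < 2 * m") (auto simp: E_def)
    qed
    have h: "(\<Sum>j<Suc n. c j * indicator (A j) x) = (\<Sum>j<2*m+1. e j * indicator (E j) x)" for x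
    proof -
      have "indicator (A n) x = (\<Sum>j<m. indicator (D j \<inter> A n) x) + (indicator (A n - U) x :: real)"
      proof -
        have "indicator (U \<inter> A n) x = (\<Sum>j<m. indicator (D j \<inter> A n) x :: real)"
        proof -
          have "disjoint_family_on (\<lambda>j. D j \<inter> A n) {..<m}" using D(2) by (auto simp: disjoint_family_on_def)
          then have "indicator (\<Union>j<m. D j \<inter> A n) x = (\<Sum>j<m. indicator (D j \<inter> A n) x :: real)"
            by (rule indicator_UN_disjoint[OF finite_lessThan])
          then show ?thesis by (simp add: U_def)
        qed
        moreover have "indicator (A n) x = indicator (U \<inter> A n) x + (indicator (A n - U) x :: real)"
          by (simp add: indicator_def)
        ultimately show ?thesis by simp
      qed
      moreover have "indicator (D j) x = indicator (D j \<inter> A n) x + (indicator (D j - A n) x :: real)" for j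
        by (simp add: indicator_def)
      ultimately show ?thesis
        unfolding sum.lessThan_Suc D(3) by (rule sum_split[of "\<lambda>X. indicator X x"])
    qed
    have "AE \<omega> in M. \<forall>j. L (D j) \<omega> = L (D j \<inter> A n) \<omega> + L (D j - A n) \<omega>"
    proof (subst AE_all_countable, intro allI)
      fix j
      have "D j = (D j \<inter> A n) \<union> (D j - A n)" by auto
      then show "AE \<omega> in M. L (D j) \<omega> = L (D j \<inter> A n) \<omega> + L (D j - A n) \<omega>"
        using L_Un[of "D j \<inter> A n" "D j - A n"] D A bsets_Int[OF A bsets_borel[OF D(1)]] bsets_Diff[OF D(1) bsets_borel[OF A]] by fastforce
    qed
    moreover have "AE \<omega> in M. L (U \<inter> A n) \<omega> = (\<Sum>j<m. L (D j \<inter> A n) \<omega>)"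
    proof -
      have "U \<inter> A n = (\<Union>j<m. D j \<inter> A n)" by (auto simp: U_def)
      moreover have "disjoint_family_on (\<lambda>j. D j \<inter> A n) {..<m}" using D(2) by (auto simp: disjoint_family_on_def)
      ultimately show ?thesis
        using L_UN[of "{..<m}" "\<lambda>j. D j \<inter> A n"] bsets_Int[OF A bsets_borel[OF D(1)]] by simp
    qed
    moreover have "AE \<omega> in M. L (A n) \<omega> = L (U \<inter> A n) \<omega> + L (A n - U) \<omega>"
    proof -
      have "A n = (U \<inter> A n) \<union> (A n - U)" by auto
      then show ?thesis
        using L_Un[of "U \<inter> A n" "A n - U"] bsets_Int[OF A bsets_borel[OF U]] bsets_Diff[OF A bsets_borel[OF U]] by fastforce
    qed
    ultimately have "AE \<omega> in M. (\<Sum>j<Suc n. c j * L (A j) \<omega>) = (\<Sum>j<2*m+1. e j * L (E j) \<omega>)"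
      using D(4)
    proof eventually_elim
      case (elim \<omega>)
      have "L (A n) \<omega> = (\<Sum>j<m. L (D j \<inter> A n) \<omega>) + L (A n - U) \<omega>" using elim by simp
      from sum_split[of "\<lambda>X. L X \<omega>", OF this] elim(1,4)
      show ?case unfolding sum.lessThan_Suc by simp
    qed
    moreover have "\<forall>j. E j \<in> bsets"
      using bsets_Int[OF A bsets_borel[OF D(1)]] bsets_Diff[OF D(1) bsets_borel[OF A]]
        bsets_Diff[OF A bsets_borel[OF U]] by (simp add: E_def)
    ultimately show ?case using disj h by blast
  qed
  note * = this
  obtain n c A where A: "\<And>j. A j \<in> bsets"
    and h: "h = (\<lambda>x. \<Sum>j<(n::nat). c j * indicator (A j) x)" "S = (\<lambda>\<omega>. \<Sum>j<n. c j * L (A j) \<omega>)"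
    using assms by (rule simple_integralE) (rule that)
  show ?thesis unfolding h by (rule *[OF A])
qed

text \<open>Common interface of integrals of step functions and of their limits in probability: the
  tail bound uses these properties only and never the approximating sequence.\<close>

definition has_levy_char :: "('a \<Rightarrow> real) \<Rightarrow> ('w \<Rightarrow> real) \<Rightarrow> bool" where
  "has_levy_char h X \<longleftrightarrow> h \<in> borel_measurable borel \<and> modular a nu h < \<infinity> \<and> X \<in> borel_measurable M \<and>
     (\<forall>z. (\<integral>\<omega>. cis (z * X \<omega>) \<partial>M) = exp (\<integral>x. psi (z * h x) \<partial>lborel))"

text \<open>The averaging bound is applied with T = 2/e, so that 2/T is the threshold e. The factor
  8 is the 2 of that bound times the 4 in \<open>integral_psi_le\<close>.\<close>

lemma has_levy_char_tail:
  assumes "has_levy_char h X" "e > 0"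
  shows "prob {\<omega>\<in>space M. e < \<bar>X \<omega>\<bar>} \<le> 8 * max (2/e) ((2/e)\<^sup>2) * enn2real (modular a nu h)"
proof -
  have [measurable]: "h \<in> borel_measurable borel" "X \<in> borel_measurable M" and fin: "modular a nu h < \<infinity>"
    and char: "\<And>z. (\<integral>\<omega>. cis (z * X \<omega>) \<partial>M) = exp (\<integral>x. psi (z * h x) \<partial>lborel)"
    using assms(1) by (auto simp: has_levy_char_def)
  let ?q = "4 * max (2/e) ((2/e)\<^sup>2) * enn2real (modular a nu h)"
  have "1 - Re (\<integral>\<omega>. cis (z * X \<omega>) \<partial>M) \<le> ?q" if z: "0 \<le> z" "z \<le> 2 / e" for z
  proof -
    let ?w = "\<integral>x. psi (z * h x) \<partial>lborel"
    \<comment> \<open>A characteristic function has modulus at most 1. This gives the nonpositive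
      real part of the exponent without any computation with psi.\<close>
    have "norm (\<integral>\<omega>. cis (z * X \<omega>) \<partial>M) \<le> (\<integral>\<omega>. 1 \<partial>M)"
      by (rule order_trans[OF integral_norm_bound]) simp
    then have "norm (exp ?w) \<le> 1" by (simp add: char prob_space)
    then have Re: "Re ?w \<le> 0" by (simp add: norm_exp_eq_Re)
    have "1 - Re (exp ?w) \<le> norm (1 - exp ?w)" using complex_Re_le_cmod[of "1 - exp ?w"] by simp
    also have "\<dots> \<le> norm ?w" using Re by (rule norm_exp_minus_1_le)
    also have "\<dots> \<le> 4 * max \<bar>z\<bar> (z\<^sup>2) * enn2real (modular a nu h)"
    proof -
      have "ennreal (norm ?w) \<le> ennreal (4 * max \<bar>z\<bar> (z\<^sup>2)) * ennreal (enn2real (modular a nu h))"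
        using nu.integral_psi_le[of h z] fin by (simp add: less_top)
      also have "\<dots> = ennreal (4 * max \<bar>z\<bar> (z\<^sup>2) * enn2real (modular a nu h))"
        by (subst ennreal_mult) auto
      finally show ?thesis by (subst (asm) ennreal_le_iff) (auto simp: max_def)
    qed
    also have "\<dots> \<le> ?q"
      using z by (intro mult_right_mono mult_left_mono max.mono power_mono) auto
    finally show ?thesis by (simp add: char)
  qed
  then have "prob {\<omega>\<in>space M. 2 / (2/e) < \<bar>X \<omega>\<bar>} \<le> 2 * ?q"
    using assms(2) by (intro prob_abs_gt_le_char) auto
  then show ?thesis by simp
qed

lemma simple_integral_has_levy_char:
  assumes "simple_integral h S"
  shows "has_levy_char h S"
proof -
  obtain n c A where A: "\<And>j. A j \<in> bsets" and disj: "disjoint_family_on A {..<(n::nat)}"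
    and h: "h = (\<lambda>x. \<Sum>j<n. c j * indicator (A j) x)" and S: "AE \<omega> in M. S \<omega> = (\<Sum>j<n. c j * L (A j) \<omega>)"
    using simple_integral_disjoint[OF assms] by blast
  have [measurable]: "A j \<in> sets borel" "A j \<in> bsets" for j using A bsets_borel by auto
  have [measurable]: "h \<in> borel_measurable borel" "S \<in> borel_measurable M"
    using simple_integral_measurable[OF assms] by auto
  have fin: "emeasure lborel (A j) < \<infinity>" for j using emeasure_bsets_finite[OF A] .
  \<comment> \<open>By disjointness at most one block contains x, and f 0 = 0 takes care of the
    points outside all blocks. Applied to psi(z u), this turns the space integral of the exponent
    into the finite sum supplied by independence.\<close>
  have split: "f (h x) = (\<Sum>j<n. indicator (A j) x *\<^sub>R f (c j))" if f0: "f 0 = 0" for f :: "real \<Rightarrow> 'v::real_vector" and x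
  proof (cases "\<exists>i<n. x \<in> A i")
    case True
    then obtain i where i: "i < n" "x \<in> A i" by blast
    have ne: "x \<notin> A j" if "j < n" "j \<noteq> i" for j
      using disj i that by (auto simp: disjoint_family_on_def)
    have "h x = c i"
      unfolding h using i ne by (subst sum.remove[of _ i]) (auto intro!: sum.neutral)
    moreover have "(\<Sum>j<n. indicator (A j) x *\<^sub>R f (c j)) = f (c i)"
      using i ne by (subst sum.remove[of _ i]) (auto intro!: sum.neutral)
    ultimately show ?thesis by simp
  next
    case False
    then have "h x = 0" unfolding h by (auto intro!: sum.neutral)
    moreover have "(\<Sum>j<n. indicator (A j) x *\<^sub>R f (c j)) = 0" using False by (auto intro!: sum.neutral)
    ultimately show ?thesis using f0 by simp
  qed
  have char: "(\<integral>\<omega>. cis (z * S \<omega>) \<partial>M) = exp (\<integral>x. psi (z * h x) \<partial>lborel)" for z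
  proof -
    have ind: "indep_vars (\<lambda>_. borel) (\<lambda>j \<omega>. c j * L (A j) \<omega>) {..<n}"
      by (rule indep_vars_compose2[OF L_indep]) (use A disj in auto)
    have char_eq: "char (distr M borel X) z = (\<integral>\<omega>. cis (z * X \<omega>) \<partial>M)" if [measurable]: "X \<in> borel_measurable M" for X z
      unfolding char_def by (subst integral_distr) (auto simp: cis_conv_exp)
    have "(\<integral>\<omega>. cis (z * S \<omega>) \<partial>M) = (\<integral>\<omega>. cis (z * (\<Sum>j<n. c j * L (A j) \<omega>)) \<partial>M)"
      using S by (intro integral_cong_AE) auto
    also have "\<dots> = char (distr M borel (\<lambda>\<omega>. \<Sum>j<n. c j * L (A j) \<omega>)) z" by (simp add: char_eq)
    also have "\<dots> = (\<Prod>j<n. char (distr M borel (\<lambda>\<omega>. c j * L (A j) \<omega>)) z)"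
      by (rule char_distr_sum[OF ind])
    also have "\<dots> = (\<Prod>j<n. exp (of_real (measure lborel (A j)) * psi (z * c j)))"
      using A by (intro prod.cong refl) (simp add: char_eq L_char mult.assoc[symmetric])
    also have "\<dots> = exp (\<Sum>j<n. of_real (measure lborel (A j)) * psi (z * c j))"
      by (simp add: exp_sum)
    also have "(\<Sum>j<n. of_real (measure lborel (A j)) * psi (z * c j)) = (\<integral>x. (\<Sum>j<n. indicator (A j) x *\<^sub>R psi (z * c j)) \<partial>lborel)"
      using fin by (subst Bochner_Integration.integral_sum) (auto simp: scaleR_conv_of_real less_top)
    also have "\<dots> = (\<integral>x. psi (z * h x) \<partial>lborel)"
      using split[of "\<lambda>u. psi (z * u)"] by simp
    finally show ?thesis .
  qed
  have "modular a nu h < \<infinity>"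
  proof -
    define C where "C = (\<Sum>j<n. \<bar>c j\<bar>)"
    have "\<bar>h x\<bar> \<le> C" for x
      unfolding h C_def by (rule order_trans[OF sum_abs sum_mono]) (auto simp: abs_mult split: split_indicator)
    then have C: "levy_modular a nu (h x) \<le> levy_modular a nu C" for x
      by (intro nu.levy_modular_mono) (meson abs_ge_self order_trans)
    define U where "U = (\<Union>j<n. A j)"
    have U: "U \<in> bsets" unfolding U_def using A by (intro bsets_UN) auto
    then have [measurable]: "U \<in> sets borel" by (rule bsets_borel)
    have "h x = 0" if "x \<notin> U" for x using that unfolding h U_def by (auto intro!: sum.neutral)
    then have "modular a nu h \<le> (\<integral>\<^sup>+x. levy_modular a nu C * indicator U x \<partial>lborel)"
      unfolding modular_def using C by (intro nn_integral_mono) (auto split: split_indicator)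
    also have "\<dots> < \<infinity>"
      using emeasure_bsets_finite[OF U] nu.levy_modular_finite[of C]
      by (simp add: nn_integral_cmult_indicator ennreal_mult_less_top)
    finally show ?thesis .
  qed
  then show ?thesis using char by (simp add: has_levy_char_def)
qed

end

section \<open>Existence and uniqueness of the Rajput-Rosinski integral\<close>

text \<open>Level sets of a simple function may be unbounded, whereas L is defined on bounded sets;
  intersecting with a bounded B repairs this.\<close>

lemma simple_function_bsets_repr:
  fixes g :: "'a::euclidean_space \<Rightarrow> real"
  assumes g: "simple_function lborel g" and B: "B \<in> bsets"
  shows "\<exists>(n::nat) c A. (\<forall>j. A j \<in> bsets) \<and> (\<forall>x. indicator B x * g x = (\<Sum>j<n. c j * indicator (A j) x))"
proof -
  have "finite (range g)" using simple_functionD(1)[OF g] by simp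
  then obtain b where b: "bij_betw b {..<card (range g)} (range g)"
    using ex_bij_betw_nat_finite[of "range g"] by (auto simp: atLeast0LessThan)
  define A where "A j = (g -` {b j} \<inter> B)" for j
  have "A j \<in> bsets" for j
    using simple_functionD(2)[OF g, of "{b j}"] bsets_Int[OF B, of "g -` {b j}"] by (simp add: A_def)
  moreover have "indicator B x * g x = (\<Sum>j<card (range g). b j * indicator (A j) x)" for x
  proof -
    obtain i where i: "i < card (range g)" "b i = g x"
      using b by (metis bij_betw_imp_surj_on imageE lessThan_iff rangeI)
    have ne: "b j \<noteq> g x" if "j < card (range g)" "j \<noteq> i" for j
      using b i that by (auto simp: bij_betw_def inj_on_def)
    have "(\<Sum>j<card (range g). b j * indicator (A j) x) = (\<Sum>j\<in>{i}. b j * indicator (A j) x)"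
    proof (rule sum.mono_neutral_right)
      show "\<forall>j\<in>{..<card (range g)} - {i}. b j * indicator (A j) x = 0"
      proof
        fix j assume "j \<in> {..<card (range g)} - {i}"
        then have "x \<notin> A j" using ne[of j] by (auto simp: A_def)
        then show "b j * indicator (A j) x = 0" by simp
      qed
    qed (use i in auto)
    also have "\<dots> = indicator B x * g x" using i by (simp add: A_def indicator_def)
    finally show ?thesis by simp
  qed
  ultimately show ?thesis by blast
qed

context centered_levy_basis
begin

lemma conv_prob_0_if_modular:
  assumes S: "\<And>i. simple_integral (g i) (T i)" and le: "\<And>i. modular a nu (g i) \<le> ennreal (d i)"
    and d: "d \<longlonglongrightarrow> 0" "\<And>i. 0 \<le> d i"
  shows "conv_prob M T (\<lambda>_. 0)"
proof (rule conv_probI)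
  show "T n \<in> borel_measurable M" for n using simple_integral_measurable[OF S] by simp
  fix e :: real assume e: "e > 0"
  let ?C = "8 * max (2/e) ((2/e)\<^sup>2)"
  have lim: "(\<lambda>i. ?C * d i) \<longlonglongrightarrow> 0" using tendsto_mult_right_zero[OF d(1)] .
  have "prob {\<omega>\<in>space M. e < \<bar>T i \<omega>\<bar>} \<le> ?C * d i" for i
  proof -
    have "prob {\<omega>\<in>space M. e < \<bar>T i \<omega>\<bar>} \<le> ?C * enn2real (modular a nu (g i))"
      by (rule has_levy_char_tail[OF simple_integral_has_levy_char[OF S] e])
    also have "\<dots> \<le> ?C * d i"
      using le[of i] d(2)[of i] e by (intro mult_left_mono enn2real_leI) (auto simp: max_def)
    finally show ?thesis .
  qed
  then show "(\<lambda>n. prob {\<omega>\<in>space M. e < \<bar>T n \<omega> - 0\<bar>}) \<longlonglongrightarrow> 0"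
    by (intro tendsto_sandwich[OF _ _ tendsto_const lim] always_eventually allI) simp_all
qed simp

text \<open>Restriction to B maps step functions to step functions. Convergence of the integrals
  over every Borel set thus becomes a statement about the restricted integrands, to which the
  modular estimates apply.\<close>

lemma RR_integralE:
  assumes "RR_integral M L f X"
  obtains h S where "\<And>n B. B \<in> sets borel \<Longrightarrow> simple_integral (\<lambda>x. indicator B x * h n x) (S n B)"
    "AE x in lborel. (\<lambda>n. h n x) \<longlonglongrightarrow> f x"
    "\<And>B. B \<in> sets borel \<Longrightarrow> \<exists>Y. conv_prob M (\<lambda>n. S n B) Y"
    "conv_prob M (\<lambda>n. S n UNIV) X"
proof -
  obtain ns :: "nat \<Rightarrow> nat" and cs :: "nat \<Rightarrow> nat \<Rightarrow> real" and As :: "nat \<Rightarrow> nat \<Rightarrow> 'a set"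
    where As: "\<forall>n j. As n j \<in> bsets"
      and lim: "AE x in lborel. (\<lambda>n. \<Sum>j<ns n. cs n j * indicator (As n j) x) \<longlonglongrightarrow> f x"
      and B: "\<forall>B\<in>sets lborel. \<exists>Y. conv_prob M (\<lambda>n \<omega>. \<Sum>j<ns n. cs n j * L (B \<inter> As n j) \<omega>) Y"
      and X: "conv_prob M (\<lambda>n \<omega>. \<Sum>j<ns n. cs n j * L (As n j) \<omega>) X"
    using assms unfolding RR_integral_def by (elim conjE exE) (rule that)
  define h where "h n x = (\<Sum>j<ns n. cs n j * indicator (As n j) x)" for n x
  define S where "S n B = (\<lambda>\<omega>. \<Sum>j<ns n. cs n j * L (B \<inter> As n j) \<omega>)" for n B
  have "simple_integral (\<lambda>x. indicator B x * h n x) (S n B)" if "B \<in> sets borel" for n B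
  proof -
    have "(\<lambda>x. indicator B x * h n x) = (\<lambda>x. \<Sum>j<ns n. cs n j * indicator (B \<inter> As n j) x)"
      by (simp add: h_def sum_distrib_left indicator_inter_arith mult.left_commute del: sum_mult_indicator)
    moreover have "simple_integral (\<lambda>x. \<Sum>j<ns n. cs n j * indicator (B \<inter> As n j) x) (S n B)"
      unfolding S_def using As that by (intro simple_integralI bsets_Int) auto
    ultimately show ?thesis by simp
  qed
  then show thesis
    using lim B X by (intro that[of h S]) (simp_all add: h_def S_def)
qed

text \<open>Gliding hump: along a subsequence the integrands \<open>h\<close> live essentially on disjoint blocks \<open>D j\<close>.
  For the union \<open>B\<close> of the even blocks, the integrals over \<open>B\<close> are close to those over the whole space
  for even \<open>j\<close> and close to \<open>0\<close> for odd \<open>j\<close>; since they converge, the limit must vanish.\<close>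
lemma simple_integral_limit_unique:
  assumes S: "\<And>n B. B \<in> sets borel \<Longrightarrow> simple_integral (\<lambda>x. indicator B x * h n x) (S n B)"
    and h0: "AE x in lborel. (\<lambda>n. h n x) \<longlonglongrightarrow> 0"
    and conv: "\<And>B. B \<in> sets borel \<Longrightarrow> \<exists>Y. conv_prob M (\<lambda>n. S n B) Y"
    and Z: "conv_prob M (\<lambda>n. S n UNIV) Z"
  shows "AE \<omega> in M. Z \<omega> = 0"
proof -
  have [measurable]: "h n \<in> borel_measurable borel" for n
    using simple_integral_measurable(1)[OF S[of UNIV n]] by simp
  have hfin: "modular a nu (h n) < \<infinity>" for n
    using simple_integral_has_levy_char[OF S[of UNIV n]] by (simp add: has_levy_char_def)
  define q where "q n A = modular a nu (\<lambda>x. indicator A x * h n x)" for n and A :: "'a set"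
  have q_eq: "q n A = (\<integral>\<^sup>+x. levy_modular a nu (h n x) * indicator A x \<partial>lborel)" for n A
    unfolding q_def modular_def by (intro nn_integral_cong) (simp split: split_indicator)
  have q_mono: "q n A \<le> q n B" if "A \<subseteq> B" for n A B
    unfolding q_def using that by (intro nu.modular_mono) (auto split: split_indicator)
  have q_Un: "q n (A \<union> B) \<le> q n A + q n B" if [measurable]: "A \<in> sets borel" "B \<in> sets borel" for n A B
  proof -
    have "q n (A \<union> B) \<le> (\<integral>\<^sup>+x. levy_modular a nu (h n x) * indicator A x + levy_modular a nu (h n x) * indicator B x \<partial>lborel)"
      unfolding q_eq by (intro nn_integral_mono) (simp split: split_indicator)
    also have "\<dots> = q n A + q n B" unfolding q_eq by (subst nn_integral_add) simp_all
    finally show ?thesis .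
  qed
  \<comment> \<open>Bounded sets on which the integrands are bounded by 1 from index k on. They
    increase to a set of full measure. For fixed k the modular over E k tends to 0 in n by bounded
    convergence; for fixed n the modular over the complement of E k tends to 0 in k.\<close>
  define E where "E k = {x. norm x < real k \<and> (\<forall>n\<ge>k. \<bar>h n x\<bar> \<le> 1)}" for k :: nat
  have E [measurable]: "E k \<in> sets borel" for k unfolding E_def by measurable
  have E_mono: "E k \<subseteq> E l" if "k \<le> l" for k l using that by (auto simp: E_def)
  have q1: "(\<lambda>n. q n (E k)) \<longlonglongrightarrow> 0" for k
  proof -
    have "(\<lambda>n. \<integral>\<^sup>+x. levy_modular a nu (h (n + k) x) * indicator (E k) x \<partial>lborel) \<longlonglongrightarrow> (\<integral>\<^sup>+x. 0 \<partial>(lborel :: 'a measure))"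
    proof (rule nn_integral_dominated_convergence[where w="\<lambda>x. levy_modular a nu 1 * indicator (ball 0 (real k)) x"])
      show "AE x in lborel. levy_modular a nu (h (j + k) x) * indicator (E k) x \<le> levy_modular a nu 1 * indicator (ball 0 (real k)) x" for j
        by (intro AE_I2) (auto simp: E_def intro!: nu.levy_modular_mono split: split_indicator)
      show "(\<integral>\<^sup>+x. levy_modular a nu 1 * indicator (ball (0::'a) (real k)) x \<partial>lborel) < \<infinity>"
        using nu.levy_modular_1_finite emeasure_bounded_finite[of "ball (0::'a) (real k)"]
        by (simp add: nn_integral_cmult_indicator ennreal_mult_less_top)
      show "AE x in lborel. (\<lambda>n. levy_modular a nu (h (n + k) x) * indicator (E k) x) \<longlonglongrightarrow> 0"
        using h0
      proof eventually_elim
        case (elim x)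
        then have "(\<lambda>n. levy_modular a nu (h (n + k) x)) \<longlonglongrightarrow> 0"
          by (intro nu.levy_modular_tendsto_0 LIMSEQ_ignore_initial_segment)
        then show ?case by (cases "x \<in> E k") auto
      qed
    qed (auto intro!: borel_measurable_times_ennreal borel_measurable_indicator)
    then have "(\<lambda>n. q (n + k) (E k)) \<longlonglongrightarrow> 0" by (simp add: q_eq)
    then show ?thesis by (rule LIMSEQ_offset)
  qed
  have q2: "(\<lambda>k. q n (- E k)) \<longlonglongrightarrow> 0" for n
  proof -
    have "(\<lambda>k. \<integral>\<^sup>+x. levy_modular a nu (h n x) * indicator (- E k) x \<partial>lborel) \<longlonglongrightarrow> (\<integral>\<^sup>+x. 0 \<partial>(lborel :: 'a measure))"
    proof (rule nn_integral_dominated_convergence[where w="\<lambda>x. levy_modular a nu (h n x)"])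
      show "(\<integral>\<^sup>+x. levy_modular a nu (h n x) \<partial>lborel) < \<infinity>" using hfin by (simp add: modular_def)
      show "AE x in lborel. (\<lambda>k. levy_modular a nu (h n x) * indicator (- E k) x) \<longlonglongrightarrow> 0"
        using h0
      proof eventually_elim
        case (elim x)
        then have "eventually (\<lambda>n. \<bar>h n x\<bar> < 1) sequentially"
          by (auto simp: tendsto_iff dist_real_def)
        then obtain K where K: "\<And>n. n \<ge> K \<Longrightarrow> \<bar>h n x\<bar> < 1" by (auto simp: eventually_sequentially)
        obtain K' :: nat where K': "norm x < real K'" using reals_Archimedean2 by blast
        have "x \<in> E k" if "k \<ge> max K K'" for k
        proof -
          have "real K' \<le> real k" using that by simp
          then have "norm x < real k" using K' by linarith
          moreover have "\<bar>h m x\<bar> \<le> 1" if "m \<ge> k" for m using K[of m] that \<open>k \<ge> max K K'\<close> by simp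
          ultimately show ?thesis by (simp add: E_def)
        qed
        then have "eventually (\<lambda>k. levy_modular a nu (h n x) * indicator (- E k) x = 0) sequentially"
          by (intro eventually_sequentiallyI[of "max K K'"]) simp
        then show ?case by (rule tendsto_eventually)
      qed
    qed (auto intro!: AE_I2 split: split_indicator)
    then show ?thesis by (simp add: q_eq)
  qed
  have small1: "\<exists>n'>n. q n' (E k) < ennreal ((1/2)^j)" for n k j
  proof -
    have "eventually (\<lambda>n'. q n' (E k) < ennreal ((1/2)^j)) sequentially"
      by (rule order_tendstoD(2)[OF q1]) simp
    then show ?thesis
      using eventually_happens'[OF sequentially_bot eventually_conj[OF _ eventually_gt_at_top[of n]]] by blast
  qed
  have small2: "\<exists>k'\<ge>k. q n (- E k') < ennreal ((1/2)^j)" for n k j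
  proof -
    have "eventually (\<lambda>k'. q n (- E k') < ennreal ((1/2)^j)) sequentially"
      by (rule order_tendstoD(2)[OF q2]) simp
    then show ?thesis
      using eventually_happens'[OF sequentially_bot eventually_conj[OF _ eventually_ge_at_top[of k]]] by blast
  qed
  \<comment> \<open>The pair consists of the index of an integrand and the index of a set E. The new
    integrand is chosen small on the previous set, and then the new set is chosen so large that this
    integrand is small outside it.\<close>
  obtain p :: "nat \<Rightarrow> nat \<times> nat" where p: "\<And>j. q (fst (p j)) (- E (snd (p j))) < ennreal ((1/2)^j) \<and>
      (fst (p j) < fst (p (Suc j)) \<and> snd (p j) \<le> snd (p (Suc j)) \<and>
       q (fst (p (Suc j))) (E (snd (p j))) < ennreal ((1/2)^Suc j))"
  proof (atomize_elim, rule dependent_nat_choice)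
    obtain k where "q 0 (- E k) < ennreal ((1/2)^0)" using small2[of 0 0 0] by blast
    then show "\<exists>x. q (fst x) (- E (snd x)) < ennreal ((1/2)^0)" by (intro exI[of _ "(0, k)"]) simp
    fix x :: "nat \<times> nat" and j
    obtain n' where n': "n' > fst x" "q n' (E (snd x)) < ennreal ((1/2)^Suc j)" using small1 by blast
    obtain k' where k': "k' \<ge> snd x" "q n' (- E k') < ennreal ((1/2)^Suc j)" using small2 by blast
    show "\<exists>y. q (fst y) (- E (snd y)) < ennreal ((1/2)^Suc j) \<and> fst x < fst y \<and> snd x \<le> snd y \<and>
       q (fst y) (E (snd x)) < ennreal ((1/2)^Suc j)"
      using n' k' by (intro exI[of _ "(n', k')"]) simp
  qed
  define m where "m j = fst (p (Suc j))" for j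
  define D where "D j = E (snd (p (Suc j))) - E (snd (p j))" for j
  have D [measurable]: "D j \<in> sets borel" for j unfolding D_def by measurable
  have m_mono: "strict_mono m" unfolding m_def using p by (intro strict_monoI_Suc) auto
  have k_mono: "snd (p i) \<le> snd (p j)" if "i \<le> j" for i j
    using p by (intro lift_Suc_mono_le[OF _ that]) auto
  have D_disj: "D i \<inter> D j = {}" if "i < j" for i j
    using E_mono[OF k_mono[of "Suc i" j]] that by (auto simp: D_def)
  \<comment> \<open>The complement of D j is covered by the earlier set and by the complement of the
    later one. Each of the two carries at most (1/2)^(j+1), because m j belongs to stage j + 1 of
    the recursion.\<close>
  have qD: "q (m j) (- D j) \<le> ennreal ((1/2)^j)" for j
  proof -
    have "q (m j) (- D j) \<le> q (m j) (E (snd (p j)) \<union> - E (snd (p (Suc j))))"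
      by (rule q_mono) (auto simp: D_def)
    also have "\<dots> \<le> q (m j) (E (snd (p j))) + q (m j) (- E (snd (p (Suc j))))" by (rule q_Un) auto
    also have "\<dots> \<le> ennreal ((1/2)^Suc j) + ennreal ((1/2)^Suc j)"
      using p[of j] p[of "Suc j"] unfolding m_def by (intro add_mono) (auto intro: less_imp_le)
    also have "\<dots> = ennreal ((1/2)^j)" by (subst ennreal_plus[symmetric]) auto
    finally show ?thesis .
  qed
  define B where "B = (\<Union>i. D (2 * i))"
  have B [measurable]: "B \<in> sets borel" unfolding B_def by measurable
  obtain Y where Y: "conv_prob M (\<lambda>n. S n B) Y" using conv[OF B] by blast
  have pow: "(\<lambda>i::nat. (1/2::real) ^ (2 * i)) \<longlonglongrightarrow> 0" "(\<lambda>i::nat. (1/2::real) ^ (2 * i + 1)) \<longlonglongrightarrow> 0"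
    using LIMSEQ_subseq_LIMSEQ[OF LIMSEQ_realpow_zero[of "1/2::real"], of "\<lambda>i. 2 * i"]
      LIMSEQ_subseq_LIMSEQ[OF LIMSEQ_realpow_zero[of "1/2::real"], of "\<lambda>i. 2 * i + 1"]
    by (auto simp: comp_def strict_mono_def)
  have "conv_prob M (\<lambda>i \<omega>. S (m (2 * i)) UNIV \<omega> - S (m (2 * i)) B \<omega>) (\<lambda>_. 0)"
  proof (rule conv_prob_0_if_modular[OF _ _ pow(1)])
    fix i
    show "simple_integral (\<lambda>x. indicator UNIV x * h (m (2 * i)) x - indicator B x * h (m (2 * i)) x)
        (\<lambda>\<omega>. S (m (2 * i)) UNIV \<omega> - S (m (2 * i)) B \<omega>)"
      by (intro simple_integral_diff S) auto
    have "(\<lambda>x. indicator UNIV x * h (m (2 * i)) x - indicator B x * h (m (2 * i)) x) = (\<lambda>x. indicator (- B) x * h (m (2 * i)) x)"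
      by (auto split: split_indicator)
    then have "modular a nu (\<lambda>x. indicator UNIV x * h (m (2 * i)) x - indicator B x * h (m (2 * i)) x) = q (m (2 * i)) (- B)"
      by (simp add: q_def)
    also have "\<dots> \<le> q (m (2 * i)) (- D (2 * i))" by (rule q_mono) (auto simp: B_def)
    also have "\<dots> \<le> ennreal ((1/2) ^ (2 * i))" by (rule qD)
    finally show "modular a nu (\<lambda>x. indicator UNIV x * h (m (2 * i)) x - indicator B x * h (m (2 * i)) x) \<le> ennreal ((1/2) ^ (2 * i))" .
  qed simp
  moreover have "conv_prob M (\<lambda>i \<omega>. S (m (2 * i)) UNIV \<omega> - S (m (2 * i)) B \<omega>) (\<lambda>\<omega>. Z \<omega> - Y \<omega>)"
  proof -
    have "strict_mono (\<lambda>i. m (2 * i))" using m_mono by (auto simp: strict_mono_def)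
    then show ?thesis
      using conv_prob_diff[OF conv_prob_subseq[OF Z] conv_prob_subseq[OF Y]] by blast
  qed
  ultimately have ZY: "AE \<omega> in M. 0 = Z \<omega> - Y \<omega>" by (rule conv_prob_AE_unique)
  have "conv_prob M (\<lambda>i. S (m (2 * i + 1)) B) (\<lambda>_. 0)"
  proof (rule conv_prob_0_if_modular[OF S[OF B] _ pow(2)])
    fix i
    have "D (2 * i') \<inter> D (2 * i + 1) = {}" for i'
    proof -
      have "2 * i' < 2 * i + 1 \<or> 2 * i + 1 < 2 * i'" by presburger
      then show ?thesis using D_disj[of "2 * i'" "2 * i + 1"] D_disj[of "2 * i + 1" "2 * i'"] by blast
    qed
    then have "B \<subseteq> - D (2 * i + 1)" unfolding B_def by blast
    then have "q (m (2 * i + 1)) B \<le> q (m (2 * i + 1)) (- D (2 * i + 1))" by (rule q_mono)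
    also have "\<dots> \<le> ennreal ((1/2) ^ (2 * i + 1))" by (rule qD)
    finally show "modular a nu (\<lambda>x. indicator B x * h (m (2 * i + 1)) x) \<le> ennreal ((1/2) ^ (2 * i + 1))"
      by (simp add: q_def)
  qed simp
  moreover have "conv_prob M (\<lambda>i. S (m (2 * i + 1)) B) Y"
    using m_mono by (intro conv_prob_subseq[OF Y]) (auto simp: strict_mono_def)
  ultimately have "AE \<omega> in M. 0 = Y \<omega>" by (rule conv_prob_AE_unique)
  with ZY show ?thesis by eventually_elim simp
qed

text \<open>The three integrals come with unrelated approximating sequences. Their combination tends
  to 0 almost everywhere and its integrals converge over every Borel set, so
  \<open>simple_integral_limit_unique\<close> forces its limit to vanish. Uniqueness of the integral
  is the case of coefficients 1 and 0.\<close>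

lemma RR_integral_lincomb_AE:
  assumes f: "RR_integral M L f X" and g: "RR_integral M L g Y"
    and w: "RR_integral M L (\<lambda>x. \<alpha> * f x + \<beta> * g x) W"
  shows "AE \<omega> in M. W \<omega> = \<alpha> * X \<omega> + \<beta> * Y \<omega>"
proof -
  obtain hf Sf where f: "\<And>n B. B \<in> sets borel \<Longrightarrow> simple_integral (\<lambda>x. indicator B x * hf n x) (Sf n B)"
    "AE x in lborel. (\<lambda>n. hf n x) \<longlonglongrightarrow> f x"
    "\<And>B. B \<in> sets borel \<Longrightarrow> \<exists>Y. conv_prob M (\<lambda>n. Sf n B) Y" "conv_prob M (\<lambda>n. Sf n UNIV) X"
    using f by (rule RR_integralE) (rule that)
  obtain hg Sg where g: "\<And>n B. B \<in> sets borel \<Longrightarrow> simple_integral (\<lambda>x. indicator B x * hg n x) (Sg n B)"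
    "AE x in lborel. (\<lambda>n. hg n x) \<longlonglongrightarrow> g x"
    "\<And>B. B \<in> sets borel \<Longrightarrow> \<exists>Y. conv_prob M (\<lambda>n. Sg n B) Y" "conv_prob M (\<lambda>n. Sg n UNIV) Y"
    using g by (rule RR_integralE) (rule that)
  obtain hw Sw where w: "\<And>n B. B \<in> sets borel \<Longrightarrow> simple_integral (\<lambda>x. indicator B x * hw n x) (Sw n B)"
    "AE x in lborel. (\<lambda>n. hw n x) \<longlonglongrightarrow> \<alpha> * f x + \<beta> * g x"
    "\<And>B. B \<in> sets borel \<Longrightarrow> \<exists>Y. conv_prob M (\<lambda>n. Sw n B) Y" "conv_prob M (\<lambda>n. Sw n UNIV) W"
    using w by (rule RR_integralE) (rule that)
  have conv: "conv_prob M (\<lambda>n \<omega>. Sw n B \<omega> - \<alpha> * Sf n B \<omega> - \<beta> * Sg n B \<omega>) (\<lambda>\<omega>. W' \<omega> - \<alpha> * X' \<omega> - \<beta> * Y' \<omega>)"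
    if "conv_prob M (\<lambda>n. Sf n B) X'" "conv_prob M (\<lambda>n. Sg n B) Y'" "conv_prob M (\<lambda>n. Sw n B) W'" for B X' Y' W'
    using that by (intro conv_prob_diff conv_prob_const_cmult)
  have "AE \<omega> in M. W \<omega> - \<alpha> * X \<omega> - \<beta> * Y \<omega> = 0"
  proof (rule simple_integral_limit_unique)
    fix n and B :: "'a set" assume B: "B \<in> sets borel"
    have "simple_integral (\<lambda>x. 1 * (indicator B x * hw n x) + (-1) * (\<alpha> * (indicator B x * hf n x) + \<beta> * (indicator B x * hg n x)))
      (\<lambda>\<omega>. 1 * Sw n B \<omega> + (-1) * (\<alpha> * Sf n B \<omega> + \<beta> * Sg n B \<omega>))"
      using f(1) g(1) w(1) B by (intro simple_integral_lincomb) auto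
    then show "simple_integral (\<lambda>x. indicator B x * (hw n x - \<alpha> * hf n x - \<beta> * hg n x)) (\<lambda>\<omega>. Sw n B \<omega> - \<alpha> * Sf n B \<omega> - \<beta> * Sg n B \<omega>)"
      by (simp add: algebra_simps)
  next
    show "AE x in lborel. (\<lambda>n. hw n x - \<alpha> * hf n x - \<beta> * hg n x) \<longlonglongrightarrow> 0"
      using f(2) g(2) w(2)
    proof eventually_elim
      case (elim x)
      have "(\<lambda>n. hw n x - \<alpha> * hf n x - \<beta> * hg n x) \<longlonglongrightarrow> \<alpha> * f x + \<beta> * g x - \<alpha> * f x - \<beta> * g x"
        using elim by (intro tendsto_intros)
      then show ?case by simp
    qed
  next
    fix B :: "'a set" assume B: "B \<in> sets borel"
    show "\<exists>Y. conv_prob M (\<lambda>n \<omega>. Sw n B \<omega> - \<alpha> * Sf n B \<omega> - \<beta> * Sg n B \<omega>) Y"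
    proof -
      obtain X' Y' W' where "conv_prob M (\<lambda>n. Sf n B) X'" "conv_prob M (\<lambda>n. Sg n B) Y'" "conv_prob M (\<lambda>n. Sw n B) W'"
        using f(3)[OF B] g(3)[OF B] w(3)[OF B] by (elim exE) (rule that)
      from conv[OF this] show ?thesis by (rule exI[where x="\<lambda>\<omega>. W' \<omega> - \<alpha> * X' \<omega> - \<beta> * Y' \<omega>"])
    qed
  next
    show "conv_prob M (\<lambda>n \<omega>. Sw n UNIV \<omega> - \<alpha> * Sf n UNIV \<omega> - \<beta> * Sg n UNIV \<omega>) (\<lambda>\<omega>. W \<omega> - \<alpha> * X \<omega> - \<beta> * Y \<omega>)"
      using f(4) g(4) w(4) by (rule conv)
  qed
  then show ?thesis by eventually_elim simp
qed

lemma RR_integral_unique: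
  assumes "RR_integral M L f X" "RR_integral M L f Y"
  shows "AE \<omega> in M. X \<omega> = Y \<omega>"
  using RR_integral_lincomb_AE[of f Y f Y 1 0 X] assms by simp

text \<open>Simple functions dominated by 2|f| and cut off to balls converge to f in modular by
  dominated convergence. Restriction to B only decreases the modular, so the integrals over every B
  form a Cauchy sequence in probability. The same domination passes the characteristic function to
  the limit.\<close>

theorem RR_integral_exists:
  assumes f [measurable]: "f \<in> borel_measurable borel" and fin: "modular a nu f < \<infinity>"
  shows "\<exists>X. RR_integral M L f X \<and> has_levy_char f X"
proof -
  obtain F where F: "\<And>i. simple_function lborel (F i)" "\<And>x. (\<lambda>i. F i x) \<longlonglongrightarrow> f x" "\<And>i x. \<bar>F i x\<bar> \<le> 2 * \<bar>f x\<bar>"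
    using borel_measurable_implies_sequence_metric[of f lborel 0] by auto
  have "ball 0 (real n) \<in> (bsets :: 'a set set)" for n by (intro bsetsI) auto
  from simple_function_bsets_repr[OF F(1) this]
  have "\<forall>n. \<exists>(N::nat) c A. (\<forall>j. A j \<in> bsets) \<and> (\<forall>x. indicator (ball 0 (real n)) x * F n x = (\<Sum>j<N. c j * indicator (A j) x))" by blast
  then obtain ns :: "nat \<Rightarrow> nat" and cs As where As: "\<And>n j. As n j \<in> bsets"
    and h_eq: "\<And>n x. indicator (ball 0 (real n)) x * F n x = (\<Sum>j<ns n. cs n j * indicator (As n j) x)"
    by metis
  define h where "h n x = indicator (ball 0 (real n)) x * F n x" for n x
  have h_le: "\<bar>h n x\<bar> \<le> 2 * \<bar>f x\<bar>" for n x
    using F(3)[of n x] by (simp add: h_def split: split_indicator)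
  have h_lim: "(\<lambda>n. h n x) \<longlonglongrightarrow> f x" for x
  proof -
    obtain K :: nat where K: "norm x < real K" using reals_Archimedean2 by blast
    have "F n x = h n x" if "n \<ge> K" for n
    proof -
      have "norm x < real n" using K that by (meson le_less_trans less_le_trans of_nat_le_iff)
      then show ?thesis by (simp add: h_def)
    qed
    then have "eventually (\<lambda>n. F n x = h n x) sequentially" by (rule eventually_sequentiallyI)
    then show ?thesis by (rule Lim_transform_eventually[OF F(2)])
  qed
  define S where "S n B = (\<lambda>\<omega>. \<Sum>j<ns n. cs n j * L (B \<inter> As n j) \<omega>)" for n B
  have S: "simple_integral (\<lambda>x. indicator B x * h n x) (S n B)" if "B \<in> sets borel" for n B
  proof -
    have "(\<lambda>x. indicator B x * h n x) = (\<lambda>x. \<Sum>j<ns n. cs n j * indicator (B \<inter> As n j) x)"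
      unfolding h_def h_eq by (simp add: sum_distrib_left indicator_inter_arith mult.left_commute del: sum_mult_indicator)
    moreover have "simple_integral (\<lambda>x. \<Sum>j<ns n. cs n j * indicator (B \<inter> As n j) x) (S n B)"
      unfolding S_def using As that by (intro simple_integralI bsets_Int) auto
    ultimately show ?thesis by simp
  qed
  have [measurable]: "h n \<in> borel_measurable borel" for n
    using simple_integral_measurable(1)[OF S[of UNIV n]] by simp
  define d where "d n = enn2real (modular a nu (\<lambda>x. h n x - f x))" for n
  \<comment> \<open>|h - f| <= 3 |f| because |h| <= 2 |f|, and dilation by 3 costs max(3,
    9).\<close>
  have diff_le: "levy_modular a nu (h n x - f x) \<le> ennreal 9 * levy_modular a nu (f x)" for n x
  proof -
    have "levy_modular a nu (h n x - f x) \<le> levy_modular a nu (3 * f x)"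
      using h_le[of n x] by (intro nu.levy_modular_mono) (simp add: abs_mult)
    also have "\<dots> \<le> ennreal 9 * levy_modular a nu (f x)" using nu.levy_modular_scale[of 3 "f x"] by simp
    finally show ?thesis .
  qed
  have bound_fin: "(\<integral>\<^sup>+x. ennreal 9 * levy_modular a nu (f x) \<partial>lborel) < \<infinity>"
    using fin by (simp add: nn_integral_cmult modular_def ennreal_mult_less_top)
  have mod_fin: "modular a nu (\<lambda>x. h n x - f x) < \<infinity>" for n
    unfolding modular_def using bound_fin by (rule le_less_trans[rotated]) (intro nn_integral_mono diff_le)
  have d: "modular a nu (\<lambda>x. h n x - f x) = ennreal (d n)" "0 \<le> d n" for n
    using mod_fin by (auto simp: d_def less_top)
  have d0: "d \<longlonglongrightarrow> 0"
  proof -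
    have "(\<lambda>n. modular a nu (\<lambda>x. h n x - f x)) \<longlonglongrightarrow> (\<integral>\<^sup>+x. 0 \<partial>(lborel :: 'a measure))"
      unfolding modular_def
    proof (rule nn_integral_dominated_convergence[OF _ _ _ _ bound_fin])
      have "(\<lambda>n. levy_modular a nu (h n x - f x)) \<longlonglongrightarrow> 0" for x
        using h_lim[of x] by (intro nu.levy_modular_tendsto_0) (simp add: LIM_zero)
      then show "AE x in lborel. (\<lambda>n. levy_modular a nu (h n x - f x)) \<longlonglongrightarrow> 0" by simp
    qed (use diff_le in auto)
    then have "(\<lambda>n. ennreal (d n)) \<longlonglongrightarrow> ennreal 0" by (simp add: d(1))
    then show ?thesis using d(2) by (subst (asm) tendsto_ennreal_iff) auto
  qed
  have conv: "\<exists>Y. conv_prob M (\<lambda>n. S n B) Y" if B: "B \<in> sets borel" for B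
  proof (rule Cauchy_prob_imp_conv_prob)
    show "S n B \<in> borel_measurable M" for n by (rule simple_integral_measurable(2)[OF S[OF B]])
    fix e \<delta> :: real assume e: "e > 0" and \<delta>: "\<delta> > 0"
    \<comment> \<open>The tail constant times the 4 lost in the quasi-triangle inequality for the
      modular, when h m and h n are compared through f.\<close>
    define C where "C = 8 * max (2/e) ((2/e)\<^sup>2) * 4"
    have C: "C > 0" using e by (auto simp: C_def max_def)
    have le: "prob {\<omega>\<in>space M. e < \<bar>S m B \<omega> - S n B \<omega>\<bar>} \<le> C * (d m + d n)" for m n
    proof -
      let ?g = "\<lambda>x. indicator B x * h m x - indicator B x * h n x"
      have "modular a nu ?g \<le> modular a nu (\<lambda>x. (h m x - f x) + - (h n x - f x))"
        by (rule nu.modular_mono) (auto split: split_indicator)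
      also have "\<dots> \<le> 4 * (modular a nu (\<lambda>x. h m x - f x) + modular a nu (\<lambda>x. - (h n x - f x)))"
        by (rule nu.modular_add) measurable
      also have "modular a nu (\<lambda>x. - (h n x - f x)) \<le> modular a nu (\<lambda>x. h n x - f x)"
        by (rule nu.modular_mono) simp
      also have "4 * (modular a nu (\<lambda>x. h m x - f x) + modular a nu (\<lambda>x. h n x - f x)) = ennreal (4 * (d m + d n))"
        using ennreal_mult[of 4 "d m + d n"] d(2)[of m] d(2)[of n] by (simp add: d(1))
      finally have g_le: "enn2real (modular a nu ?g) \<le> 4 * (d m + d n)"
        using d(2)[of m] d(2)[of n] by (intro enn2real_leI) (auto simp: add_left_mono mult_left_mono)
      have "prob {\<omega>\<in>space M. e < \<bar>S m B \<omega> - S n B \<omega>\<bar>} \<le> 8 * max (2/e) ((2/e)\<^sup>2) * enn2real (modular a nu ?g)"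
        by (intro has_levy_char_tail simple_integral_has_levy_char simple_integral_diff S B e)
      also have "\<dots> \<le> 8 * max (2/e) ((2/e)\<^sup>2) * (4 * (d m + d n))"
        using g_le by (rule mult_left_mono) (simp add: le_max_iff_disj)
      finally have "prob {\<omega>\<in>space M. e < \<bar>S m B \<omega> - S n B \<omega>\<bar>} \<le> 8 * max (2/e) ((2/e)\<^sup>2) * (4 * (d m + d n))" .
      then show ?thesis unfolding C_def by (simp only: mult.assoc)
    qed
    obtain N where N: "\<And>n. n \<ge> N \<Longrightarrow> d n < \<delta> / (2 * C)"
      using order_tendstoD(2)[OF d0, of "\<delta> / (2 * C)"] C \<delta> by (auto simp: eventually_sequentially)
    have "prob {\<omega>\<in>space M. e < \<bar>S m B \<omega> - S n B \<omega>\<bar>} < \<delta>" if "m \<ge> N" "n \<ge> N" for m n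
    proof -
      have "C * (d m + d n) < C * (\<delta> / (2 * C) + \<delta> / (2 * C))"
        using N[OF that(1)] N[OF that(2)] C by (intro mult_strict_left_mono add_strict_mono)
      also have "\<dots> = \<delta>" using C by (simp add: field_simps)
      finally show ?thesis using le[of m n] by linarith
    qed
    then show "\<exists>N. \<forall>m\<ge>N. \<forall>n\<ge>N. prob {\<omega>\<in>space M. e < \<bar>S m B \<omega> - S n B \<omega>\<bar>} < \<delta>" by blast
  qed
  obtain X where X: "conv_prob M (\<lambda>n. S n UNIV) X" using conv[of UNIV] by auto
  have "RR_integral M L f X"
    unfolding RR_integral_def
  proof (intro conjI exI[of _ ns] exI[of _ cs] exI[of _ As] allI ballI)
    show "AE x in lborel. (\<lambda>n. \<Sum>j<ns n. cs n j * indicator (As n j) x) \<longlonglongrightarrow> f x"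
      using h_lim unfolding h_def h_eq by (intro AE_I2)
    show "\<exists>Y. conv_prob M (\<lambda>n \<omega>. \<Sum>j<ns n. cs n j * L (B \<inter> As n j) \<omega>) Y" if "B \<in> sets lborel" for B
      using conv[of B] that by (simp add: S_def)
    show "conv_prob M (\<lambda>n \<omega>. \<Sum>j<ns n. cs n j * L (As n j) \<omega>) X"
      using X by (simp add: S_def)
  qed (use As in auto)
  moreover have "has_levy_char f X"
    unfolding has_levy_char_def
  proof (intro conjI allI f fin)
    show "X \<in> borel_measurable M" using X by (simp add: conv_prob_def)
    fix z
    have hc: "(\<integral>\<omega>. cis (z * S n UNIV \<omega>) \<partial>M) = exp (\<integral>x. psi (z * h n x) \<partial>lborel)" for n
      using simple_integral_has_levy_char[OF S[of UNIV n]] by (simp add: has_levy_char_def)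
    have psi_lim: "(\<lambda>n. \<integral>x. psi (z * h n x) \<partial>lborel) \<longlonglongrightarrow> (\<integral>x. psi (z * f x) \<partial>lborel)"
    proof -
      \<comment> \<open>The integrands are bounded by the modular density at 2 z f. It is finite at
        every point, so the passage to real values loses nothing.\<close>
      define w where "w x = enn2real (4 * levy_modular a nu (z * (2 * f x)))" for x
      have wfin: "(\<integral>\<^sup>+x. 4 * levy_modular a nu (z * (2 * f x)) \<partial>lborel) < \<infinity>"
      proof -
        have "modular a nu (\<lambda>x. (z * 2) * f x) \<le> ennreal (max \<bar>z * 2\<bar> ((z * 2)\<^sup>2)) * modular a nu f"
          by (rule nu.modular_scale) simp
        also have "\<dots> < \<infinity>" using fin by (simp add: ennreal_mult_less_top)
        finally show ?thesis by (simp add: modular_def nn_integral_cmult ennreal_mult_less_top mult.assoc)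
      qed
      have w_eq: "ennreal (w x) = 4 * levy_modular a nu (z * (2 * f x))" for x
        unfolding w_def using nu.levy_modular_finite[of "z * (2 * f x)"]
        by (intro ennreal_enn2real) (simp add: ennreal_mult_less_top)
      have [measurable]: "w \<in> borel_measurable borel" unfolding w_def by measurable
      show ?thesis
      proof (rule integral_dominated_convergence[where w=w])
        show "integrable lborel w"
        proof (rule integrableI_nonneg)
          show "AE x in lborel. 0 \<le> w x" by (simp add: w_def)
          show "(\<integral>\<^sup>+x. ennreal (w x) \<partial>lborel) < \<infinity>" using wfin by (simp add: w_eq)
        qed simp
        show "AE x in lborel. norm (psi (z * h n x)) \<le> w x" for n
        proof (intro AE_I2)
          fix x
          have "ennreal (norm (psi (z * h n x))) \<le> 4 * levy_modular a nu (z * h n x)" by (rule nu.psi_le_modular)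
          also have "\<dots> \<le> 4 * levy_modular a nu (z * (2 * f x))"
            using h_le[of n x] by (intro mult_left_mono nu.levy_modular_mono) (auto simp: abs_mult intro!: mult_left_mono)
          finally have "ennreal (norm (psi (z * h n x))) \<le> ennreal (w x)" by (simp add: w_eq)
          then show "norm (psi (z * h n x)) \<le> w x" by (subst (asm) ennreal_le_iff) (auto simp: w_def)
        qed
        show "AE x in lborel. (\<lambda>n. psi (z * h n x)) \<longlonglongrightarrow> psi (z * f x)"
          using h_lim by (intro AE_I2 nu.psi_tendsto tendsto_mult_left)
      qed measurable
    qed
    have "(\<lambda>n. \<integral>\<omega>. cis (z * S n UNIV \<omega>) \<partial>M) \<longlonglongrightarrow> exp (\<integral>x. psi (z * f x) \<partial>lborel)"
      unfolding hc using psi_lim by (rule tendsto_exp)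
    then show "(\<integral>\<omega>. cis (z * X \<omega>) \<partial>M) = exp (\<integral>x. psi (z * f x) \<partial>lborel)"
      using conv_prob_cis[OF X, of z] LIMSEQ_unique by blast
  qed
  ultimately show ?thesis by blast
qed

end

section \<open>First moment and centering of the characteristic triplet\<close>

text \<open>\<open>\<Sum>k. 2 ^ k * (1 - cos (x / 2 ^ k))\<close> is comparable to \<open>\<bar>x\<bar>\<close> for large \<open>x\<close>, so finiteness of a first
  absolute moment can be read off from a characteristic function.\<close>
lemma dyadic_one_minus_cos_le:
  "(\<Sum>k. ennreal (2 ^ k * (1 - cos (x / 2 ^ k)))) \<le> ennreal (8 * \<bar>x\<bar>)"
proof (rule suminf_le_const[OF summableI])
  fix n
  \<comment> \<open>By \<open>one_minus_cos_le_huber\<close> at x / 2^k the sum telescopes; the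
    remaining term at scale n is nonnegative and is dropped afterwards.\<close>
  have le: "(\<Sum>k<n. 2 ^ k * (1 - cos (x / 2 ^ k))) \<le> 8 * (huber x - 2 ^ n * huber (x / 2 ^ n))"
  proof (induction n)
    case (Suc n)
    have "2 ^ n * (1 - cos (x / 2 ^ n)) \<le> 2 ^ n * (8 * (huber (x / 2 ^ n) - 2 * huber (x / 2 ^ n / 2)))"
      by (intro mult_left_mono one_minus_cos_le_huber) simp
    also have "x / 2 ^ n / 2 = x / 2 ^ Suc n" by simp
    also have "2 ^ n * (8 * (huber (x / 2 ^ n) - 2 * huber (x / 2 ^ Suc n)))
        = 8 * (2 ^ n * huber (x / 2 ^ n)) - 8 * (2 ^ Suc n * huber (x / 2 ^ Suc n))"
      by (simp only: power_Suc right_diff_distrib mult_ac)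
    finally show ?case using Suc.IH by (simp only: sum.lessThan_Suc right_diff_distrib)
  qed simp
  have "huber x - 2 ^ n * huber (x / 2 ^ n) \<le> \<bar>x\<bar> - 0"
    by (intro diff_mono huber_le_abs) simp
  then have "8 * (huber x - 2 ^ n * huber (x / 2 ^ n)) \<le> 8 * \<bar>x\<bar>" by simp
  then have "(\<Sum>k<n. 2 ^ k * (1 - cos (x / 2 ^ k))) \<le> 8 * \<bar>x\<bar>" using le by linarith
  then have "ennreal (\<Sum>k<n. 2 ^ k * (1 - cos (x / 2 ^ k))) \<le> ennreal (8 * \<bar>x\<bar>)"
    by (rule ennreal_leI)
  then show "(\<Sum>k<n. ennreal (2 ^ k * (1 - cos (x / 2 ^ k)))) \<le> ennreal (8 * \<bar>x\<bar>)"
    by (subst sum_ennreal) auto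
qed

text \<open>One term suffices. For 2^k <= |u| < 2^(k+1) the rescaled argument lies between 1 and 2,
  where cos is at most cos 1, and the weight 2^k is at least |u|/2.\<close>

lemma dyadic_one_minus_cos_ge:
  assumes u: "1 \<le> \<bar>u\<bar>"
  shows "ennreal ((1 - cos 1) / 2 * \<bar>u\<bar>) \<le> (\<Sum>k. ennreal (2 ^ k * (1 - cos (u / 2 ^ k))))"
proof -
  obtain k :: nat where k: "2 ^ k \<le> \<bar>u\<bar>" "\<bar>u\<bar> < 2 ^ Suc k"
  proof -
    define m where "m = nat \<lfloor>\<bar>u\<bar>\<rfloor>"
    have m: "1 \<le> m" "real m \<le> \<bar>u\<bar>" "\<bar>u\<bar> < real m + 1" using u by (auto simp: m_def le_nat_floor)
    obtain k where k: "2 ^ k \<le> m" "m < 2 ^ (k + 1)" using ex_power_ivl1[of 2 m] m(1) by auto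
    have "real (2 ^ k) \<le> real m" using k(1) by (simp only: of_nat_le_iff)
    then have "real (2 ^ k) \<le> \<bar>u\<bar>" using m(2) by (rule order_trans)
    then have "2 ^ k \<le> \<bar>u\<bar>" by (simp only: of_nat_power of_nat_numeral)
    moreover have "m + 1 \<le> 2 ^ Suc k" using k(2) by simp
    then have "real (m + 1) \<le> real (2 ^ Suc k)" by (simp only: of_nat_le_iff)
    then have "real m + 1 \<le> 2 ^ Suc k" by (simp only: of_nat_power of_nat_numeral of_nat_add of_nat_1)
    then have "\<bar>u\<bar> < 2 ^ Suc k" using m(3) by linarith
    ultimately show thesis by (rule that)
  qed
  define v where "v = \<bar>u\<bar> / 2 ^ k"
  have v: "1 \<le> v" "v \<le> 2" using k by (auto simp: v_def field_simps)
  have "cos v \<le> cos 1" using v pi_gt3 by (intro cos_monotone_0_pi_le) auto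
  moreover have "cos (u / 2 ^ k) = cos v" by (cases "0 \<le> u") (simp_all add: v_def)
  moreover have "\<bar>u\<bar> / 2 \<le> 2 ^ k" using k by simp
  ultimately have "\<bar>u\<bar> / 2 * (1 - cos 1) \<le> 2 ^ k * (1 - cos (u / 2 ^ k))"
    by (intro mult_mono) auto
  then have "ennreal ((1 - cos 1) / 2 * \<bar>u\<bar>) \<le> ennreal (2 ^ k * (1 - cos (u / 2 ^ k)))"
    by (intro ennreal_leI) (simp add: mult.commute)
  also have "\<dots> \<le> (\<Sum>k. ennreal (2 ^ k * (1 - cos (u / 2 ^ k))))"
  proof -
    have "f k \<le> (\<Sum>k. f k)" for f :: "nat \<Rightarrow> ennreal"
      using sum_le_suminf[OF summableI, of "{k}" f] by simp
    then show ?thesis .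
  qed
  finally show ?thesis .
qed

context levy_symbol
begin

text \<open>At this stage the modular need not be finite. Local boundedness of psi and psi 0 = 0
  replace it for bounded integrands with bounded support. Uniformity over |t| <= 1 allows one
  constant C for all dyadic scales.\<close>

lemma integrable_psi_bounded_support:
  assumes [measurable]: "f \<in> borel_measurable borel"
    and B: "\<And>x::'b::euclidean_space. \<bar>f x\<bar> \<le> B" and R: "{x. f x \<noteq> 0} \<subseteq> ball 0 R"
  obtains C where "\<And>t. \<bar>t\<bar> \<le> 1 \<Longrightarrow> integrable lborel (\<lambda>x. psi (t * f x))"
    "\<And>t. \<bar>t\<bar> \<le> 1 \<Longrightarrow> norm (\<integral>x. psi (t * f x) \<partial>lborel) \<le> C"
proof -
  define K where "K = \<bar>\<gamma>\<bar> * B + a * B\<^sup>2 / 2 + (2 + B\<^sup>2) * (\<integral>r. min 1 (r\<^sup>2) \<partial>nu)"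
  define w :: "'b \<Rightarrow> real" where "w x = K * indicator (ball 0 R) x" for x
  have w: "integrable lborel w" unfolding w_def by (intro integrable_mult_right integrable_real_indicator) (use emeasure_bounded_finite[of "ball (0::'b) R"] in auto)
  have B0: "0 \<le> B" using B[of 0] by linarith
  have le: "norm (psi (t * f x)) \<le> w x" if t: "\<bar>t\<bar> \<le> 1" for t x
  proof (cases "f x = 0")
    case True
    have "0 \<le> (\<integral>r. min 1 (r\<^sup>2) \<partial>nu)" by (intro Bochner_Integration.integral_nonneg) auto
    then have "0 \<le> K" using B0 by (simp add: K_def)
    then show ?thesis using True by (simp add: w_def)
  next
    case False
    then have x: "x \<in> ball 0 R" using R by auto
    have "\<bar>t * f x\<bar> \<le> 1 * B" unfolding abs_mult using t B by (intro mult_mono) auto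
    then have tB: "\<bar>t * f x\<bar> \<le> B" by simp
    have tB2: "(t * f x)\<^sup>2 \<le> B\<^sup>2" using power_mono[OF tB abs_ge_zero, of 2] by simp
    have "norm (psi (t * f x)) \<le> \<bar>\<gamma>\<bar> * \<bar>t * f x\<bar> + a * (t * f x)\<^sup>2 / 2 + (2 + (t * f x)\<^sup>2) * (\<integral>r. min 1 (r\<^sup>2) \<partial>nu)"
      by (rule norm_psi_le)
    also have "\<dots> \<le> K"
      unfolding K_def using tB tB2
      by (intro add_mono mult_left_mono divide_right_mono mult_right_mono Bochner_Integration.integral_nonneg) auto
    finally show ?thesis using x by (simp add: w_def)
  qed
  have int: "integrable lborel (\<lambda>x. psi (t * f x))" if "\<bar>t\<bar> \<le> 1" for t
    by (rule Bochner_Integration.integrable_bound[OF w]) (use le[OF that] in \<open>auto intro!: AE_I2 intro: order_trans[OF _ abs_ge_self]\<close>)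
  moreover have "norm (\<integral>x. psi (t * f x) \<partial>lborel) \<le> (\<integral>x. w x \<partial>lborel)" if "\<bar>t\<bar> \<le> 1" for t
    by (rule order_trans[OF integral_norm_bound integral_mono]) (use le[OF that] int[OF that] w in auto)
  ultimately show thesis by (rule that)
qed

lemma Re_psi_nonpos: "Re (psi z) \<le> 0"
proof -
  have "0 \<le> (\<integral>r. 1 - cos (r * z) \<partial>nu)" by (intro Bochner_Integration.integral_nonneg) auto
  moreover have "0 \<le> a * z\<^sup>2 / 2" by simp
  ultimately show ?thesis unfolding Re_psi by linarith
qed

lemma nn_integral_1_minus_cos_le: "(\<integral>\<^sup>+r. ennreal (1 - cos (r * z)) \<partial>nu) \<le> ennreal (- Re (psi z))"
proof -
  have "(\<integral>\<^sup>+r. ennreal (1 - cos (r * z)) \<partial>nu) = ennreal (\<integral>r. 1 - cos (r * z) \<partial>nu)"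
    using integrable_1_minus_cos by (intro nn_integral_eq_integral) auto
  also have "\<dots> \<le> ennreal (- Re (psi z))"
    unfolding Re_psi by (intro ennreal_leI) simp
  finally show ?thesis .
qed

text \<open>With n(t) the integral of -Re psi(t phi), the modulus of E cis(t X) is exp(-n(t)), which
  bounds n(t) by a multiple of E(1 - cos(t X)). At t = 2^-k, with weights 2^k, summation gives at
  most a multiple of E|X| on the right. On the left it gives the dyadic sums of r phi(x), which
  dominate |r phi(x)| wherever this is at least 1.\<close>

lemma first_moment:
  fixes phi :: "'b::euclidean_space \<Rightarrow> real"
  assumes "prob_space M" and X: "integrable M X"
    and cont: "continuous_on UNIV phi" and bd: "\<And>x. \<bar>phi x\<bar> \<le> B" and supp: "{x. phi x \<noteq> 0} \<subseteq> ball 0 R" and pos: "0 < phi 0"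
    and char: "\<And>t. (\<integral>\<omega>. cis (t * X \<omega>) \<partial>M) = exp (\<integral>x. psi (t * phi x) \<partial>lborel)"
  shows "integrable nu (\<lambda>r. if \<bar>r\<bar> \<le> 1 then 0 else r)"
proof -
  interpret M: prob_space M by fact
  have [measurable]: "X \<in> borel_measurable M" using X by simp
  have [measurable]: "phi \<in> borel_measurable borel" using cont by (rule borel_measurable_continuous_onI)
  obtain C where int: "\<And>t. \<bar>t\<bar> \<le> 1 \<Longrightarrow> integrable lborel (\<lambda>x. psi (t * phi x))"
    and C: "\<And>t. \<bar>t\<bar> \<le> 1 \<Longrightarrow> norm (\<integral>x. psi (t * phi x) \<partial>lborel) \<le> C"
    using integrable_psi_bounded_support[OF _ bd supp] by auto
  have n_le: "ennreal (\<integral>x. - Re (psi (t * phi x)) \<partial>lborel) \<le> ennreal (exp C) * (\<integral>\<^sup>+\<omega>. ennreal (1 - cos (t * X \<omega>)) \<partial>M)"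
    if t: "\<bar>t\<bar> \<le> 1" for t
  proof -
    define n where "n = (\<integral>x. - Re (psi (t * phi x)) \<partial>lborel)"
    have n: "n = - Re (\<integral>x. psi (t * phi x) \<partial>lborel)"
      unfolding n_def using int[OF t] by (simp add: integral_Re)
    have nC: "n \<le> C" unfolding n using C[OF t] abs_Re_le_cmod[of "\<integral>x. psi (t * phi x) \<partial>lborel"] by linarith
    have n0: "0 \<le> n" unfolding n_def using Re_psi_nonpos by (intro Bochner_Integration.integral_nonneg) simp
    \<comment> \<open>This gives n exp(-n) <= 1 - exp(-n). For n <= C one has n <= exp(C) n exp(-n),
      hence n <= exp(C) (1 - exp(-n)), an estimate linear in 1 - exp(-n) with a constant independent
      of t.\<close>
    have "exp (- n) * (1 + n) \<le> exp (- n) * exp n" by (intro mult_left_mono exp_ge_add_one_self) auto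
    then have 1: "exp (- n) * n \<le> 1 - exp (- n)" by (simp add: algebra_simps exp_minus_inverse flip: exp_add)
    have "n * 1 \<le> n * exp (C - n)" using nC n0 by (intro mult_left_mono) auto
    also have "\<dots> = exp C * (exp (- n) * n)" by (simp add: exp_diff exp_minus divide_inverse)
    also have "\<dots> \<le> exp C * (1 - exp (- n))" using 1 by (intro mult_left_mono) auto
    also have "exp (- n) = norm (\<integral>\<omega>. cis (t * X \<omega>) \<partial>M)" by (simp add: char n norm_exp_eq_Re)
    also have "1 - norm (\<integral>\<omega>. cis (t * X \<omega>) \<partial>M) \<le> 1 - Re (\<integral>\<omega>. cis (t * X \<omega>) \<partial>M)"
      using complex_Re_le_cmod[of "\<integral>\<omega>. cis (t * X \<omega>) \<partial>M"] by simp
    also have "1 - Re (\<integral>\<omega>. cis (t * X \<omega>) \<partial>M) = (\<integral>\<omega>. 1 - cos (t * X \<omega>) \<partial>M)"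
    proof -
      have "Re (\<integral>\<omega>. cis (t * X \<omega>) \<partial>M) = (\<integral>\<omega>. cos (t * X \<omega>) \<partial>M)"
        by (subst integral_Re[symmetric]) auto
      moreover have "integrable M (\<lambda>\<omega>. cos (t * X \<omega>))" by (rule M.integrable_const_bound[where B=1]) auto
      ultimately show ?thesis by (simp add: M.prob_space)
    qed
    finally have "n \<le> exp C * (\<integral>\<omega>. 1 - cos (t * X \<omega>) \<partial>M)" by (simp add: mult_left_mono)
    then have "ennreal n \<le> ennreal (exp C * (\<integral>\<omega>. 1 - cos (t * X \<omega>) \<partial>M))" by (rule ennreal_leI)
    also have "\<dots> = ennreal (exp C) * ennreal (\<integral>\<omega>. 1 - cos (t * X \<omega>) \<partial>M)"
      by (rule ennreal_mult) (auto intro!: Bochner_Integration.integral_nonneg)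
    also have "ennreal (\<integral>\<omega>. 1 - cos (t * X \<omega>) \<partial>M) = (\<integral>\<^sup>+\<omega>. ennreal (1 - cos (t * X \<omega>)) \<partial>M)"
    proof (intro nn_integral_eq_integral[symmetric] M.integrable_const_bound[where B=2] AE_I2)
      show "norm (1 - cos (t * X \<omega>)) \<le> 2" for \<omega>
        using cos_ge_minus_one[of "t * X \<omega>"] cos_le_one[of "t * X \<omega>"] unfolding real_norm_def by linarith
    qed auto
    finally show ?thesis by (simp add: n_def)
  qed
  have fin: "(\<integral>\<^sup>+x. (\<integral>\<^sup>+r. (\<Sum>k. ennreal (2 ^ k * (1 - cos (r * phi x / 2 ^ k)))) \<partial>nu) \<partial>lborel) < \<infinity>"
  proof -
    have "(\<integral>\<^sup>+x. (\<integral>\<^sup>+r. (\<Sum>k. ennreal (2 ^ k * (1 - cos (r * phi x / 2 ^ k)))) \<partial>nu) \<partial>lborel)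
       = (\<Sum>k. ennreal (2 ^ k) * (\<integral>\<^sup>+x. (\<integral>\<^sup>+r. ennreal (1 - cos (r * (1 / 2 ^ k * phi x))) \<partial>nu) \<partial>lborel))"
      by (simp add: nn_integral_suminf nn_integral_cmult ennreal_mult)
    also have "\<dots> \<le> (\<Sum>k. ennreal (exp C) * (\<integral>\<^sup>+\<omega>. ennreal (2 ^ k * (1 - cos (X \<omega> / 2 ^ k))) \<partial>M))"
    proof (intro suminf_le summableI)
      fix k :: nat
      let ?t = "1 / 2 ^ k :: real"
      have t: "\<bar>?t\<bar> \<le> 1" by simp
      have "(\<integral>\<^sup>+x. (\<integral>\<^sup>+r. ennreal (1 - cos (r * (?t * phi x))) \<partial>nu) \<partial>lborel) \<le> (\<integral>\<^sup>+x. ennreal (- Re (psi (?t * phi x))) \<partial>lborel)"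
        by (intro nn_integral_mono nn_integral_1_minus_cos_le)
      also have "\<dots> = ennreal (\<integral>x. - Re (psi (?t * phi x)) \<partial>lborel)"
        using int[OF t] Re_psi_nonpos by (intro nn_integral_eq_integral Bochner_Integration.integrable_minus integrable_Re) auto
      also have "\<dots> \<le> ennreal (exp C) * (\<integral>\<^sup>+\<omega>. ennreal (1 - cos (?t * X \<omega>)) \<partial>M)" by (rule n_le[OF t])
      finally have "ennreal (2 ^ k) * (\<integral>\<^sup>+x. (\<integral>\<^sup>+r. ennreal (1 - cos (r * (?t * phi x))) \<partial>nu) \<partial>lborel)
        \<le> ennreal (2 ^ k) * (ennreal (exp C) * (\<integral>\<^sup>+\<omega>. ennreal (1 - cos (?t * X \<omega>)) \<partial>M))"
        by (rule mult_left_mono) simp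
      also have "\<dots> = ennreal (exp C) * (\<integral>\<^sup>+\<omega>. ennreal (2 ^ k * (1 - cos (X \<omega> / 2 ^ k))) \<partial>M)"
        by (subst mult.left_commute) (simp add: ennreal_mult nn_integral_cmult)
      finally show "ennreal (2 ^ k) * (\<integral>\<^sup>+x. (\<integral>\<^sup>+r. ennreal (1 - cos (r * (?t * phi x))) \<partial>nu) \<partial>lborel)
        \<le> ennreal (exp C) * (\<integral>\<^sup>+\<omega>. ennreal (2 ^ k * (1 - cos (X \<omega> / 2 ^ k))) \<partial>M)" .
    qed
    also have "\<dots> = ennreal (exp C) * (\<integral>\<^sup>+\<omega>. (\<Sum>k. ennreal (2 ^ k * (1 - cos (X \<omega> / 2 ^ k)))) \<partial>M)"
      by (simp add: nn_integral_suminf ennreal_suminf_cmult)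
    also have "\<dots> \<le> ennreal (exp C) * (\<integral>\<^sup>+\<omega>. ennreal (8 * \<bar>X \<omega>\<bar>) \<partial>M)"
      by (intro mult_left_mono nn_integral_mono dyadic_one_minus_cos_le) simp
    also have "\<dots> < \<infinity>"
    proof -
      have "integrable M (\<lambda>\<omega>. 8 * \<bar>X \<omega>\<bar>)" using X by auto
      then have "(\<integral>\<^sup>+\<omega>. ennreal (8 * \<bar>X \<omega>\<bar>) \<partial>M) < \<infinity>" by (simp add: nn_integral_eq_integral less_top)
      then show ?thesis by (simp add: ennreal_mult_less_top)
    qed
    finally show ?thesis .
  qed
  \<comment> \<open>On a ball of positive volume around 0 the function phi stays above delta. Jumps
    with delta |r| >= 1 then satisfy |r phi x| >= 1, so the dyadic lower bound applies to them; J
    collects exactly these jumps.\<close>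
  define \<delta> where "\<delta> = phi 0 / 2"
  have \<delta>: "\<delta> > 0" using pos by (simp add: \<delta>_def)
  obtain \<rho> where \<rho>: "\<rho> > 0" "\<And>x. x \<in> ball 0 \<rho> \<Longrightarrow> \<delta> \<le> phi x"
  proof -
    have "isCont phi 0" using cont by (simp add: continuous_on_eq_continuous_at)
    then obtain \<rho> where "\<rho> > 0" and r: "\<And>x. dist x 0 < \<rho> \<Longrightarrow> dist (phi x) (phi 0) < \<delta>"
      unfolding continuous_at_eps_delta using \<delta> by metis
    then show thesis
    proof (intro that[of \<rho>])
      fix x :: 'b assume "x \<in> ball 0 \<rho>"
      then have "dist (phi x) (phi 0) < \<delta>" by (intro r) (simp add: dist_commute)
      then show "\<delta> \<le> phi x" unfolding dist_real_def \<delta>_def by linarith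
    qed
  qed
  define c :: real where "c = (1 - cos 1) / 2"
  have c: "c > 0"
    using cos_monotone_0_pi[of 0 1] pi_gt3 by (simp add: c_def)
  define J where "J = (\<integral>\<^sup>+r. ennreal \<bar>r\<bar> * indicator {r. 1 \<le> \<delta> * \<bar>r\<bar>} r \<partial>nu)"
  have "ennreal (c * \<delta>) * J * emeasure lborel (ball (0::'b) \<rho>) = (\<integral>\<^sup>+x. ennreal (c * \<delta>) * J * indicator (ball (0::'b) \<rho>) x \<partial>lborel)"
    by (simp add: nn_integral_cmult_indicator)
  also have "\<dots> \<le> (\<integral>\<^sup>+x. (\<integral>\<^sup>+r. (\<Sum>k. ennreal (2 ^ k * (1 - cos (r * phi x / 2 ^ k)))) \<partial>nu) \<partial>lborel)"
  proof (intro nn_integral_mono)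
    fix x :: 'b
    show "ennreal (c * \<delta>) * J * indicator (ball (0::'b) \<rho>) x \<le> (\<integral>\<^sup>+r. (\<Sum>k. ennreal (2 ^ k * (1 - cos (r * phi x / 2 ^ k)))) \<partial>nu)"
    proof (cases "x \<in> ball 0 \<rho>")
      case True
      have "ennreal (c * \<delta>) * J = (\<integral>\<^sup>+r. ennreal (c * \<delta>) * (ennreal \<bar>r\<bar> * indicator {r. 1 \<le> \<delta> * \<bar>r\<bar>} r) \<partial>nu)"
        unfolding J_def by (subst nn_integral_cmult) auto
      also have "\<dots> \<le> (\<integral>\<^sup>+r. (\<Sum>k. ennreal (2 ^ k * (1 - cos (r * phi x / 2 ^ k)))) \<partial>nu)"
      proof (intro nn_integral_mono)
        fix r :: real
        show "ennreal (c * \<delta>) * (ennreal \<bar>r\<bar> * indicator {r. 1 \<le> \<delta> * \<bar>r\<bar>} r) \<le> (\<Sum>k. ennreal (2 ^ k * (1 - cos (r * phi x / 2 ^ k))))"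
        proof (cases "1 \<le> \<delta> * \<bar>r\<bar>")
          case r: True
          have le: "\<delta> * \<bar>r\<bar> \<le> \<bar>r * phi x\<bar>"
            using \<rho>(2)[OF True] \<delta> by (simp add: abs_mult mult.commute[of \<delta>] mult_left_mono)
          have "ennreal (c * \<delta>) * (ennreal \<bar>r\<bar> * indicator {r. 1 \<le> \<delta> * \<bar>r\<bar>} r) = ennreal (c * (\<delta> * \<bar>r\<bar>))"
            using r c \<delta> by (simp add: ennreal_mult[symmetric] mult.assoc)
          also have "\<dots> \<le> ennreal (c * \<bar>r * phi x\<bar>)" using le c by (intro ennreal_leI mult_left_mono) auto
          also have "\<dots> \<le> (\<Sum>k. ennreal (2 ^ k * (1 - cos (r * phi x / 2 ^ k))))"
            unfolding c_def using r le by (intro dyadic_one_minus_cos_ge) linarith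
          finally show ?thesis .
        qed simp
      qed
      finally show ?thesis using True by simp
    qed simp
  qed
  finally have "ennreal (c * \<delta>) * J * emeasure lborel (ball (0::'b) \<rho>) < \<infinity>" using fin by (rule le_less_trans)
  moreover have "emeasure lborel (ball (0::'b) \<rho>) \<noteq> 0"
    using content_ball_pos[OF \<rho>(1), of "0::'b"] by (auto simp: measure_def)
  ultimately have J: "J < \<infinity>" using c \<delta> by (auto simp: ennreal_mult_less_top)
  have "(\<integral>\<^sup>+r. ennreal (norm (if \<bar>r\<bar> \<le> 1 then 0 else r)) \<partial>nu)
      \<le> (\<integral>\<^sup>+r. ennreal (1 / \<delta>) * ennreal (min 1 (r\<^sup>2)) + ennreal \<bar>r\<bar> * indicator {r. 1 \<le> \<delta> * \<bar>r\<bar>} r \<partial>nu)"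
  proof (intro nn_integral_mono)
    fix r :: real
    show "ennreal (norm (if \<bar>r\<bar> \<le> 1 then 0 else r)) \<le> ennreal (1 / \<delta>) * ennreal (min 1 (r\<^sup>2)) + ennreal \<bar>r\<bar> * indicator {r. 1 \<le> \<delta> * \<bar>r\<bar>} r"
    \<comment> \<open>The large jumps missed by J have 1 < |r| < 1/delta. There min(1, r^2) is 1, so
      |r| is at most min(1, r^2) / delta, which is integrable.\<close>
    proof (cases "\<bar>r\<bar> \<le> 1 \<or> 1 \<le> \<delta> * \<bar>r\<bar>")
      case False
      then have "1\<^sup>2 \<le> \<bar>r\<bar>\<^sup>2" by (intro power_mono) auto
      then have "min 1 (r\<^sup>2) = 1" by simp
      moreover have "\<bar>r\<bar> \<le> 1 / \<delta>" using False \<delta> by (simp add: field_simps)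
      ultimately show ?thesis using False by (simp add: ennreal_leI)
    qed auto
  qed
  also have "\<dots> = ennreal (1 / \<delta>) * (\<integral>\<^sup>+r. ennreal (min 1 (r\<^sup>2)) \<partial>nu) + J"
    unfolding J_def by (subst nn_integral_add) (auto simp: nn_integral_cmult)
  also have "\<dots> < \<infinity>" using J nn_integral_min_sq by (simp add: ennreal_mult_less_top)
  finally show ?thesis by (intro integrableI_bounded) auto
qed

text \<open>Both sides of the characteristic function identity are expanded to first order as t
  decreases to 0. The left side gives i E X = 0, the right side i m times the integral of phi, where
  m is the drift plus the mean of the large jumps. A nonnegative phi with phi 0 > 0 has positive
  integral, hence m = 0.\<close>

lemma centering:
  fixes phi :: "'b::euclidean_space \<Rightarrow> real"
  assumes "prob_space M" and X: "integrable M X" and mean: "(\<integral>\<omega>. X \<omega> \<partial>M) = 0"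
    and cont: "continuous_on UNIV phi" and bd: "\<And>x. \<bar>phi x\<bar> \<le> B" and supp: "{x. phi x \<noteq> 0} \<subseteq> ball 0 R"
    and nonneg: "\<And>x. 0 \<le> phi x" and pos: "0 < phi 0"
    and char: "\<And>t. (\<integral>\<omega>. cis (t * X \<omega>) \<partial>M) = exp (\<integral>x. psi (t * phi x) \<partial>lborel)"
    and moment: "integrable nu (\<lambda>r. if \<bar>r\<bar> \<le> 1 then 0 else r)"
  shows "\<gamma> + (\<integral>r. (if \<bar>r\<bar> \<le> 1 then 0 else r) \<partial>nu) = 0"
proof -
  interpret M: prob_space M by fact
  define m where "m = \<gamma> + (\<integral>r. (if \<bar>r\<bar> \<le> 1 then 0 else r) \<partial>nu)"
  \<comment> \<open>Subtracting m from the drift gives a centered symbol, so all centered estimates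
    hold for it, and psi differs from it by the linear term i m z alone. The modular does not depend
    on the drift.\<close>
  interpret c: centered_levy_symbol a "\<gamma> - m" nu
  proof
    show "levy_triplet a (\<gamma> - m) nu" using triplet by (simp add: levy_triplet_def)
    show "\<gamma> - m + (\<integral>r. (if \<bar>r\<bar> \<le> 1 then 0 else r) \<partial>nu) = 0" by (simp add: m_def)
  qed (rule moment)
  have psi_m: "psi z = \<i> * of_real (m * z) + c.psi z" for z
    by (simp add: levy_exponent_def algebra_simps)
  have [measurable]: "X \<in> borel_measurable M" using X by simp
  have [measurable]: "phi \<in> borel_measurable borel" using cont by (rule borel_measurable_continuous_onI)
  have B0: "0 \<le> B" using bd[of 0] by linarith
  have phi_fin: "modular a nu phi < \<infinity>"
  proof -
    have "modular a nu phi \<le> (\<integral>\<^sup>+x. levy_modular a nu B * indicator (ball (0::'b) R) x \<partial>lborel)"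
      unfolding modular_def
    proof (intro nn_integral_mono)
      fix x
      show "levy_modular a nu (phi x) \<le> levy_modular a nu B * indicator (ball 0 R) x"
        using levy_modular_mono[of "phi x" B] bd[of x] B0 supp by (cases "phi x = 0") (auto split: split_indicator)
    qed
    also have "\<dots> < \<infinity>"
      using c.levy_modular_finite emeasure_bounded_finite[of "ball (0::'b) R"]
      by (simp add: nn_integral_cmult_indicator ennreal_mult_less_top)
    finally show ?thesis .
  qed
  have int_phi: "integrable lborel phi"
  proof (rule Bochner_Integration.integrable_bound)
    show "integrable lborel (\<lambda>x. B * indicator (ball (0::'b) R) x)"
      by (intro integrable_mult_right integrable_real_indicator) (use emeasure_bounded_finite[of "ball (0::'b) R"] in auto)
    show "AE x in lborel. norm (phi x) \<le> norm (B * indicator (ball 0 R) x)"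
      using bd supp B0 by (intro AE_I2) (auto split: split_indicator)
  qed simp
  define I where "I = (\<integral>x. phi x \<partial>lborel)"
  define t where "t n = inverse (real (Suc n))" for n
  have t: "0 < t n" "t n \<le> 1" for n by (auto simp: t_def field_simps)
  have t0: "t \<longlonglongrightarrow> 0" unfolding t_def by (rule LIMSEQ_inverse_real_of_nat)
  define w where "w n = (\<integral>x. psi (t n * phi x) \<partial>lborel)" for n
  have tmax: "max \<bar>t n\<bar> ((t n)\<^sup>2) = t n" for n
    using t[of n] mult_left_mono[of "t n" 1 "t n"] by (simp add: power2_eq_square max_def)
  have huber_t: "huber (t n * u) \<le> t n * huber u" for n u
    using huber_scale[of "t n" u] by (simp add: tmax)
  \<comment> \<open>Convergence is first shown under the jump integral at fixed u, then in
    \<open>outer\<close> under the space integral. For t n <= 1 scaling of H yields a factor t n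
    that cancels the division and gives a majorant free of n; the quadratic bound on H gives the
    pointwise limit.\<close>
  have inner: "(\<lambda>n. c.psi (t n * u) / t n) \<longlonglongrightarrow> 0" for u
  proof -
    have "(\<lambda>n. \<integral>r. (cis (r * (t n * u)) - 1 - \<i> * of_real (r * (t n * u))) / t n \<partial>nu) \<longlonglongrightarrow> (\<integral>r. 0 \<partial>nu)"
    proof (rule integral_dominated_convergence[where w="\<lambda>r. 4 * (max \<bar>u\<bar> (u\<^sup>2) * huber r)"])
      show "integrable nu (\<lambda>r. 4 * (max \<bar>u\<bar> (u\<^sup>2) * huber r))"
        using c.integrable_huber by (intro integrable_mult_right)
      have le: "norm ((cis (r * (t n * u)) - 1 - \<i> * of_real (r * (t n * u))) / t n) \<le> 4 * (huber (t n * (u * r)) / t n)" for n r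
        using cis_approx_huber[of "r * (t n * u)"] t(1)[of n]
        by (simp add: norm_divide divide_right_mono mult.commute mult.left_commute del: of_real_mult)
      show "AE r in nu. norm ((cis (r * (t n * u)) - 1 - \<i> * of_real (r * (t n * u))) / t n) \<le> 4 * (max \<bar>u\<bar> (u\<^sup>2) * huber r)" for n
      proof (intro AE_I2)
        fix r
        have "huber (t n * (u * r)) / t n \<le> huber (u * r)"
          using huber_t[of n "u * r"] t(1)[of n] by (simp add: pos_divide_le_eq mult.commute)
        also have "\<dots> \<le> max \<bar>u\<bar> (u\<^sup>2) * huber r" by (rule huber_scale)
        finally show "norm ((cis (r * (t n * u)) - 1 - \<i> * of_real (r * (t n * u))) / t n) \<le> 4 * (max \<bar>u\<bar> (u\<^sup>2) * huber r)"
          using le[of r n] by linarith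
      qed
      show "AE r in nu. (\<lambda>n. (cis (r * (t n * u)) - 1 - \<i> * of_real (r * (t n * u))) / t n) \<longlonglongrightarrow> 0"
      proof (intro AE_I2)
        fix r
        have "huber (t n * (u * r)) / t n \<le> t n * (u * r)\<^sup>2 / 2" for n
          using huber_le_sq[of "t n * (u * r)"] t(1)[of n]
          by (simp add: pos_divide_le_eq power2_eq_square mult_ac)
        then have "4 * (huber (t n * (u * r)) / t n) \<le> 4 * (t n * (u * r)\<^sup>2 / 2)" for n
          by (intro mult_left_mono) auto
        also have "4 * (t n * (u * r)\<^sup>2 / 2) = t n * (2 * (u * r)\<^sup>2)" for n by simp
        finally have "norm ((cis (r * (t n * u)) - 1 - \<i> * of_real (r * (t n * u))) / t n) \<le> t n * (2 * (u * r)\<^sup>2)" for n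
          by (rule order_trans[OF le])
        then show "(\<lambda>n. (cis (r * (t n * u)) - 1 - \<i> * of_real (r * (t n * u))) / t n) \<longlonglongrightarrow> 0"
          by (intro Lim_null_comparison[OF always_eventually tendsto_mult_left_zero[OF t0]]) auto
      qed
    qed simp_all
    moreover have "(\<lambda>n. complex_of_real (t n * (a * u\<^sup>2 / 2))) \<longlonglongrightarrow> of_real 0"
      by (intro tendsto_of_real tendsto_mult_left_zero[OF t0])
    ultimately have "(\<lambda>n. (\<integral>r. (cis (r * (t n * u)) - 1 - \<i> * of_real (r * (t n * u))) / t n \<partial>nu) - of_real (t n * (a * u\<^sup>2 / 2))) \<longlonglongrightarrow> 0 - 0"
      by (intro tendsto_diff) simp_all
    moreover have "c.psi (t n * u) / t n = (\<integral>r. (cis (r * (t n * u)) - 1 - \<i> * of_real (r * (t n * u))) / t n \<partial>nu) - of_real (t n * (a * u\<^sup>2 / 2))" for n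
      using t(1)[of n] unfolding c.psi_eq
      by (simp add: diff_divide_distrib power2_eq_square del: of_real_mult) (simp add: field_simps)
    ultimately show ?thesis by simp
  qed
  have outer: "(\<lambda>n. \<integral>x. c.psi (t n * phi x) / t n \<partial>lborel) \<longlonglongrightarrow> (\<integral>x. 0 \<partial>(lborel :: 'b measure))"
  proof (rule integral_dominated_convergence[where w="\<lambda>x. enn2real (4 * levy_modular a nu (phi x))"])
    have eq: "ennreal (enn2real (4 * levy_modular a nu u)) = 4 * levy_modular a nu u" for u
      using c.levy_modular_finite[of u] by (intro ennreal_enn2real) (simp add: ennreal_mult_less_top)
    show "integrable lborel (\<lambda>x. enn2real (4 * levy_modular a nu (phi x)))"
    proof (rule integrableI_nonneg)
      show "(\<integral>\<^sup>+x. ennreal (enn2real (4 * levy_modular a nu (phi x))) \<partial>lborel) < \<infinity>"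
        unfolding eq using phi_fin by (simp add: modular_def nn_integral_cmult ennreal_mult_less_top)
    qed auto
    show "AE x in lborel. norm (c.psi (t n * phi x) / t n) \<le> enn2real (4 * levy_modular a nu (phi x))" for n
    proof (intro AE_I2)
      fix x
      have "ennreal (norm (c.psi (t n * phi x))) \<le> 4 * (ennreal (t n) * levy_modular a nu (phi x))"
        by (rule order_trans[OF c.psi_le_modular]) (use levy_modular_scale[of "t n" "phi x"] in \<open>simp add: tmax mult_left_mono\<close>)
      also have "\<dots> = ennreal (t n * enn2real (4 * levy_modular a nu (phi x)))"
        using t(1)[of n] by (simp add: ennreal_mult eq mult.left_commute)
      finally have "norm (c.psi (t n * phi x)) \<le> t n * enn2real (4 * levy_modular a nu (phi x))"
        using t(1)[of n] by (subst (asm) ennreal_le_iff) auto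
      then show "norm (c.psi (t n * phi x) / t n) \<le> enn2real (4 * levy_modular a nu (phi x))"
        using t(1)[of n] by (simp add: norm_divide pos_divide_le_eq mult.commute)
    qed
    show "AE x in lborel. (\<lambda>n. c.psi (t n * phi x) / t n) \<longlonglongrightarrow> 0" using inner by (intro AE_I2)
  qed measurable
  have w_eq: "w n / t n = \<i> * of_real (m * I) + (\<integral>x. c.psi (t n * phi x) / t n \<partial>lborel)" for n
  proof -
    have "w n = (\<integral>x. \<i> * of_real (m * t n) * of_real (phi x) + c.psi (t n * phi x) \<partial>lborel)"
      unfolding w_def psi_m by (simp add: mult.assoc)
    also have "\<dots> = \<i> * of_real (m * t n) * of_real I + (\<integral>x. c.psi (t n * phi x) \<partial>lborel)"
      unfolding I_def using int_phi c.integrable_psi[OF _ phi_fin, of "t n"]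
      by (subst Bochner_Integration.integral_add) (auto simp del: of_real_mult)
    finally show ?thesis using t(1)[of n] by (simp add: add_divide_distrib)
  qed
  have w_lim: "(\<lambda>n. w n / t n) \<longlonglongrightarrow> \<i> * of_real (m * I)"
    unfolding w_eq using tendsto_add[OF tendsto_const outer] by simp
  have w0: "w \<longlonglongrightarrow> 0"
  proof -
    have "(\<lambda>n. w n / t n * of_real (t n)) \<longlonglongrightarrow> \<i> * of_real (m * I) * of_real 0"
      using w_lim t0 by (intro tendsto_mult tendsto_of_real)
    moreover have "w n / t n * of_real (t n) = w n" for n using t(1)[of n] by simp
    ultimately show ?thesis by simp
  qed
  have exp_lim: "(\<lambda>n. (exp (w n) - 1) / t n) \<longlonglongrightarrow> \<i> * of_real (m * I)"
  proof -
    \<comment> \<open>The Taylor remainder is of order |w|^2, and |w|^2 / t = |w| * |w / t| with w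
      tending to 0 and w / t bounded.\<close>
    have "(\<lambda>n. (exp (w n) - 1 - w n) / t n) \<longlonglongrightarrow> 0"
    proof (rule Lim_null_comparison[OF always_eventually])
      show "\<forall>n. norm ((exp (w n) - 1 - w n) / t n) \<le> exp (norm (w n)) * norm (w n) * norm (w n / t n)"
      proof
        fix n
        have "norm (exp (w n) - 1 - w n) \<le> exp \<bar>Re (w n)\<bar> * norm (w n) ^ 2"
          using Taylor_exp[of "w n" 1] by (simp add: algebra_simps numeral_2_eq_2)
        also have "\<dots> \<le> exp (norm (w n)) * norm (w n) ^ 2"
          using abs_Re_le_cmod[of "w n"] by (intro mult_right_mono) auto
        finally have "norm (exp (w n) - 1 - w n) / t n \<le> exp (norm (w n)) * norm (w n) ^ 2 / t n"
          using t(1)[of n] by (intro divide_right_mono) auto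
        then show "norm ((exp (w n) - 1 - w n) / t n) \<le> exp (norm (w n)) * norm (w n) * norm (w n / t n)"
          using t(1)[of n] by (simp add: norm_divide power2_eq_square)
      qed
      have "(\<lambda>n. exp (norm (w n)) * norm (w n) * norm (w n / t n)) \<longlonglongrightarrow> exp (norm (0::complex)) * norm (0::complex) * norm (\<i> * complex_of_real (m * I))"
        using w0 w_lim by (intro tendsto_mult tendsto_exp tendsto_norm)
      then show "(\<lambda>n. exp (norm (w n)) * norm (w n) * norm (w n / t n)) \<longlonglongrightarrow> 0" by simp
    qed
    from tendsto_add[OF this w_lim] show ?thesis by (simp add: diff_divide_distrib)
  qed
  have "(\<lambda>n. \<integral>\<omega>. (cis (t n * X \<omega>) - 1) / t n \<partial>M) \<longlonglongrightarrow> (\<integral>\<omega>. \<i> * of_real (X \<omega>) \<partial>M)"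
  proof (rule integral_dominated_convergence[where w="\<lambda>\<omega>. \<bar>X \<omega>\<bar>"])
    show "AE \<omega> in M. norm ((cis (t n * X \<omega>) - 1) / t n) \<le> \<bar>X \<omega>\<bar>" for n
    proof (intro AE_I2)
      fix \<omega>
      have "norm (cis (t n * X \<omega>) - 1) \<le> \<bar>t n * X \<omega>\<bar>"
        using iexp_approx1[of "t n * X \<omega>" 0] by (simp add: cis_conv_exp)
      then show "norm ((cis (t n * X \<omega>) - 1) / t n) \<le> \<bar>X \<omega>\<bar>"
        using t(1)[of n] by (simp add: norm_divide pos_divide_le_eq abs_mult mult.commute)
    qed
    show "AE \<omega> in M. (\<lambda>n. (cis (t n * X \<omega>) - 1) / t n) \<longlonglongrightarrow> \<i> * of_real (X \<omega>)"
    proof (intro AE_I2)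
      fix \<omega>
      have "norm ((cis (t n * X \<omega>) - 1) / t n - \<i> * of_real (X \<omega>)) \<le> t n * (2 * (X \<omega>)\<^sup>2)" for n
      proof -
        have "norm (cis (t n * X \<omega>) - 1 - \<i> * of_real (t n * X \<omega>)) \<le> 2 * (t n * X \<omega>)\<^sup>2"
          using cis_approx_huber[of "t n * X \<omega>"] huber_le_sq[of "t n * X \<omega>"] by linarith
        then have "norm (cis (t n * X \<omega>) - 1 - \<i> * of_real (t n * X \<omega>)) / t n \<le> 2 * (t n * X \<omega>)\<^sup>2 / t n"
          using t(1)[of n] by (intro divide_right_mono) auto
        moreover have "(cis (t n * X \<omega>) - 1 - \<i> * of_real (t n * X \<omega>)) / t n = (cis (t n * X \<omega>) - 1) / t n - \<i> * of_real (X \<omega>)"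
          using t(1)[of n] by (simp add: diff_divide_distrib)
        moreover have "2 * (t n * X \<omega>)\<^sup>2 / t n = t n * (2 * (X \<omega>)\<^sup>2)"
          using t(1)[of n] by (simp add: power2_eq_square)
        moreover have "norm ((cis (t n * X \<omega>) - 1 - \<i> * of_real (t n * X \<omega>)) / t n)
            = norm (cis (t n * X \<omega>) - 1 - \<i> * of_real (t n * X \<omega>)) / t n"
          using t(1)[of n] by (simp add: norm_divide del: of_real_mult)
        ultimately show ?thesis by (simp only:)
      qed
      then have "(\<lambda>n. (cis (t n * X \<omega>) - 1) / t n - \<i> * of_real (X \<omega>)) \<longlonglongrightarrow> 0"
        by (intro Lim_null_comparison[OF always_eventually tendsto_mult_left_zero[OF t0]]) auto
      then show "(\<lambda>n. (cis (t n * X \<omega>) - 1) / t n) \<longlonglongrightarrow> \<i> * of_real (X \<omega>)"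
        by (rule LIM_zero_cancel)
    qed
  qed (use X in auto)
  moreover have "(\<integral>\<omega>. (cis (t n * X \<omega>) - 1) / t n \<partial>M) = (exp (w n) - 1) / t n" for n
    using char[of "t n"] by (simp add: w_def M.prob_space)
  moreover have "(\<integral>\<omega>. \<i> * of_real (X \<omega>) \<partial>M) = 0" using X mean by simp
  ultimately have "(\<lambda>n. (exp (w n) - 1) / t n) \<longlonglongrightarrow> 0" by (simp only:)
  with exp_lim have "\<i> * complex_of_real (m * I) = 0" by (rule LIMSEQ_unique)
  then have "m * I = 0" by (simp del: of_real_mult)
  moreover have "I \<noteq> 0"
  proof
    assume "I = 0"
    then have "AE x in lborel. phi x = 0"
      unfolding I_def using int_phi nonneg by (subst (asm) integral_nonneg_eq_0_iff_AE) auto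
    moreover have "open {x. phi x \<noteq> 0}"
      using cont by (intro open_Collect_neq continuous_on_const)
    then obtain \<rho> where "\<rho> > 0" "ball 0 \<rho> \<subseteq> {x. phi x \<noteq> 0}"
      by (rule openE[of _ 0]) (use pos in auto)
    ultimately have "AE x in lborel. x \<notin> ball (0::'b) \<rho>" by (auto elim!: eventually_mono)
    then have "emeasure lborel (ball (0::'b) \<rho>) = 0" by (subst (asm) AE_iff_measurable[where N="ball 0 \<rho>"]) auto
    then show False using content_ball_pos[OF \<open>\<rho> > 0\<close>, of "0::'b"] by (simp add: measure_def)
  qed
  ultimately show ?thesis by (simp add: m_def)
qed

end

section \<open>Convolution with the kernel\<close>

text \<open>One nonnegative bump carries all the information about the triplet. The characteristic
  functional gives E cis of the noise at t phi, and almost sure linearity turns this into the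
  characteristic function at t of the single variable \<open>Ld phi\<close>.\<close>

lemma levy_white_noise_centered:
  fixes Ld :: "('a::euclidean_space \<Rightarrow> real) \<Rightarrow> 'w \<Rightarrow> real"
  assumes "prob_space M" and wn: "levy_white_noise M a \<gamma> nu Ld"
    and mean: "\<And>phi. test_fun phi \<Longrightarrow> integrable M (Ld phi) \<and> (\<integral>\<omega>. Ld phi \<omega> \<partial>M) = 0"
  shows "centered_levy_symbol a \<gamma> nu"
proof -
  interpret levy_symbol a \<gamma> nu
    using wn by unfold_locales (simp add: levy_white_noise_def)
  obtain phi :: "'a \<Rightarrow> real" where phi: "test_fun phi" "\<And>x. 0 \<le> phi x" "0 < phi 0"
    using bump_exists by blast
  obtain B where B: "\<And>x. \<bar>phi x\<bar> \<le> B" using test_fun_bounded[OF phi(1)] by blast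
  obtain R where R: "{x. phi x \<noteq> 0} \<subseteq> ball 0 R" using phi(1) by (rule test_fun_support)
  have gp: "gen_random_process M Ld" using wn by (simp add: levy_white_noise_def)
  have char: "(\<integral>\<omega>. cis (t * Ld phi \<omega>) \<partial>M) = exp (\<integral>x. psi (t * phi x) \<partial>lborel)" for t
  proof -
    have t: "test_fun (\<lambda>x. t * phi x)" using phi(1) by (rule test_fun_cmult)
    have [measurable]: "Ld phi \<in> borel_measurable M" "Ld (\<lambda>x. t * phi x) \<in> borel_measurable M"
      using gp phi(1) t by (auto simp: gen_random_process_def)
    have "AE \<omega> in M. Ld (\<lambda>x. t * phi x + 0 * phi x) \<omega> = t * Ld phi \<omega> + 0 * Ld phi \<omega>"
      using gp phi(1) unfolding gen_random_process_def by blast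
    then have "(\<integral>\<omega>. cis (t * Ld phi \<omega>) \<partial>M) = (\<integral>\<omega>. cis (Ld (\<lambda>x. t * phi x) \<omega>) \<partial>M)"
      by (intro integral_cong_AE) auto
    also have "\<dots> = exp (\<integral>x. psi (t * phi x) \<partial>lborel)"
      using wn t by (simp add: levy_white_noise_def)
    finally show ?thesis .
  qed
  have X: "integrable M (Ld phi)" "(\<integral>\<omega>. Ld phi \<omega> \<partial>M) = 0" using mean[OF phi(1)] by auto
  have moment: "integrable nu (\<lambda>r. if \<bar>r\<bar> \<le> 1 then 0 else r)"
    by (rule first_moment[OF assms(1) X(1) test_fun_continuous[OF phi(1)] B R phi(3) char])
  show ?thesis
  proof
    show "\<gamma> + (\<integral>r. (if \<bar>r\<bar> \<le> 1 then 0 else r) \<partial>nu) = 0"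
      by (rule centering[OF assms(1) X test_fun_continuous[OF phi(1)] B R phi(2,3) char moment])
  qed (rule moment)
qed

context
  fixes G :: "'a::euclidean_space \<Rightarrow> real"
  assumes G: "locally_integrable G"
begin

lemma G_measurable [measurable]: "G \<in> borel_measurable borel"
  using G by (simp add: locally_integrable_def)

lemma integrable_G_ball: "integrable lborel (\<lambda>y. indicator (ball x R) y * G y)"
proof -
  have "set_integrable lborel (cball x R) G" using G by (auto simp: locally_integrable_def)
  then have "set_integrable lborel (ball x R) G" by (rule set_integrable_subset) auto
  then show ?thesis by (simp add: set_integrable_def)
qed

lemma integrable_abs_G_ball: "integrable lborel (\<lambda>y. indicator (ball x R) y * \<bar>G y\<bar>)"
  using integrable_abs[OF integrable_G_ball[of x R]] by (simp add: abs_mult)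

lemma G_R_nonneg: "0 \<le> G_R G R x"
  unfolding G_R_def set_lebesgue_integral_def by (intro Bochner_Integration.integral_nonneg) auto

text \<open>The moving ball becomes a fixed open set of pairs (x, y), so that \<open>G_R\<close> is
  an integral with parameter x of a jointly measurable function.\<close>

lemma borel_measurable_G_R [measurable]: "G_R G R \<in> borel_measurable borel"
proof -
  have "G_R G R = (\<lambda>x. \<integral>y. indicator {p. dist (fst p) (snd p) < R} (x, y) * \<bar>G y\<bar> \<partial>lborel)"
    unfolding G_R_def set_lebesgue_integral_def by (intro ext Bochner_Integration.integral_cong) (auto simp: indicator_def)
  moreover have [measurable]: "{p::'a \<times> 'a. dist (fst p) (snd p) < R} \<in> sets (borel \<Otimes>\<^sub>M lborel)"
  proof -
    have op: "open {p::'a \<times> 'a. dist (fst p) (snd p) < R}" by (intro open_Collect_less continuous_intros)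
    have eq: "sets (borel \<Otimes>\<^sub>M (lborel :: 'a measure)) = sets (borel :: ('a \<times> 'a) measure)"
      unfolding borel_prod[symmetric] by (intro sets_pair_measure_cong) auto
    show ?thesis unfolding eq using op by (rule borel_open)
  qed
  ultimately show ?thesis by simp
qed

lemma convolution_props:
  assumes phi: "test_fun phi" and R: "{x. phi x \<noteq> 0} \<subseteq> ball 0 R" and c: "\<And>x. \<bar>phi x\<bar> \<le> c"
  shows integrable_convolution: "integrable lborel (\<lambda>y. G y * phi (x - y))"
    and convolution_le: "\<bar>convolution G phi x\<bar> \<le> c * G_R G R x"
proof -
  have [measurable]: "phi \<in> borel_measurable borel" using phi by (rule borel_measurable_test_fun)
  have le: "norm (G y * phi (x - y)) \<le> c * (indicator (ball x R) y * \<bar>G y\<bar>)" for y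
  proof (cases "phi (x - y) = 0")
    case True
    have "0 \<le> c" using c[of 0] by linarith
    then show ?thesis using True by simp
  next
    case False
    then have "x - y \<in> ball 0 R" using R by blast
    then have "y \<in> ball x R" by (simp add: dist_norm norm_minus_commute)
    then show ?thesis using c[of "x - y"] by (simp add: abs_mult mult.commute[of _ "\<bar>G y\<bar>"] mult_left_mono)
  qed
  have int: "integrable lborel (\<lambda>y. c * (indicator (ball x R) y * \<bar>G y\<bar>))"
    using integrable_abs_G_ball by (rule integrable_mult_right)
  show i: "integrable lborel (\<lambda>y. G y * phi (x - y))"
    by (rule Bochner_Integration.integrable_bound[OF int]) (use le in \<open>auto intro!: AE_I2 intro: order_trans[OF _ abs_ge_self]\<close>)
  have "norm (convolution G phi x) \<le> (\<integral>y. c * (indicator (ball x R) y * \<bar>G y\<bar>) \<partial>lborel)"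
    unfolding convolution_def
    by (rule order_trans[OF integral_norm_bound integral_mono[OF integrable_norm[OF i] int le]])
  then show "\<bar>convolution G phi x\<bar> \<le> c * G_R G R x"
    by (simp add: G_R_def set_lebesgue_integral_def)
qed

lemma convolution_integrable:
  assumes "test_fun phi"
  shows "integrable lborel (\<lambda>y. G y * phi (x - y))"
proof -
  obtain B where B: "\<And>x. \<bar>phi x\<bar> \<le> B" using test_fun_bounded[OF assms] by blast
  obtain R where R: "{x. phi x \<noteq> 0} \<subseteq> ball 0 R" using assms by (rule test_fun_support)
  show ?thesis by (rule integrable_convolution[OF assms R B])
qed

lemma borel_measurable_convolution:
  assumes "test_fun phi"
  shows "convolution G phi \<in> borel_measurable borel"
proof -
  have [measurable]: "phi \<in> borel_measurable borel" using assms by (rule borel_measurable_test_fun)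
  show ?thesis unfolding convolution_def by measurable
qed

lemma convolution_lincomb:
  assumes "test_fun phi" "test_fun psi"
  shows "convolution G (\<lambda>x. \<alpha> * phi x + \<beta> * psi x) = (\<lambda>x. \<alpha> * convolution G phi x + \<beta> * convolution G psi x)"
proof
  fix x
  have "convolution G (\<lambda>x. \<alpha> * phi x + \<beta> * psi x) x = (\<integral>y. \<alpha> * (G y * phi (x - y)) + \<beta> * (G y * psi (x - y)) \<partial>lborel)"
    unfolding convolution_def by (intro Bochner_Integration.integral_cong) (auto simp: algebra_simps)
  also have "\<dots> = \<alpha> * convolution G phi x + \<beta> * convolution G psi x"
    unfolding convolution_def using convolution_integrable[OF assms(1)] convolution_integrable[OF assms(2)]
    by (subst Bochner_Integration.integral_add) auto
  finally show "convolution G (\<lambda>x. \<alpha> * phi x + \<beta> * psi x) x = \<alpha> * convolution G phi x + \<beta> * convolution G psi x" .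
qed

end

lemma convolution_shift: "convolution G (\<lambda>x. phi (x - t)) x = convolution G phi (x - t)"
  by (simp add: convolution_def algebra_simps)

lemma integral_lborel_shift:
  fixes f :: "'a::euclidean_space \<Rightarrow> 'b::{banach, second_countable_topology}"
  assumes "f \<in> borel_measurable borel"
  shows "(\<integral>x. f (x - t) \<partial>lborel) = (\<integral>x. f x \<partial>lborel)"
proof -
  have "(\<integral>x. f x \<partial>lborel) = (\<integral>x. f x \<partial>distr lborel borel ((+) (- t)))"
    by (subst lborel_distr_plus) simp
  also have "\<dots> = (\<integral>x. f (- t + x) \<partial>lborel)" using assms by (intro integral_distr) auto
  finally show ?thesis by simp
qed

section \<open>Distribution functions, layer cake and splitting by jump size\<close>

lemma borel_measurable_distfun [measurable]:
  fixes g :: "'a::euclidean_space \<Rightarrow> real"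
  assumes [measurable]: "g \<in> borel_measurable borel"
  shows "distfun g \<in> borel_measurable borel"
proof -
  have "(\<lambda>\<alpha>. \<integral>\<^sup>+x. (if \<alpha> < \<bar>g x\<bar> then 1 else 0) \<partial>(lborel :: 'a measure)) \<in> borel_measurable borel"
    by measurable
  moreover have "(\<integral>\<^sup>+x. (if \<alpha> < \<bar>g x\<bar> then 1 else 0) \<partial>(lborel :: 'a measure)) = distfun g \<alpha>" for \<alpha>
  proof -
    have "(\<integral>\<^sup>+x. (if \<alpha> < \<bar>g x\<bar> then 1 else 0) \<partial>(lborel :: 'a measure)) = (\<integral>\<^sup>+x. indicator {x. \<bar>g x\<bar> > \<alpha>} x \<partial>lborel)"
      by (intro nn_integral_cong) (simp add: indicator_def)
    then show ?thesis by (simp add: distfun_def)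
  qed
  ultimately show ?thesis by simp
qed

text \<open>Tonelli applied to the pointwise formula: integrating the event alpha < g(x) over x
  produces the distribution function. With r replaced by |r| the two summands are the integrands of
  the two hypotheses of the theorem.\<close>

lemma nn_integral_huber_layer_cake:
  fixes g :: "'a::euclidean_space \<Rightarrow> real"
  assumes [measurable]: "g \<in> borel_measurable borel" and g: "\<And>x. 0 \<le> g x" and r: "r > 0"
  shows "(\<integral>\<^sup>+x. ennreal (huber (r * g x)) \<partial>lborel) =
    ennreal r * (\<integral>\<^sup>+\<alpha>. indicator {1 / r<..} \<alpha> * distfun g \<alpha> \<partial>lborel) +
    ennreal (r\<^sup>2) * (\<integral>\<^sup>+\<alpha>. indicator {0<..<1 / r} \<alpha> * ennreal \<alpha> * distfun g \<alpha> \<partial>lborel)"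
proof -
  let ?w = "\<lambda>\<alpha>. ennreal r * indicator {1/r<..} \<alpha> + ennreal (r\<^sup>2) * (indicator {0<..<1/r} \<alpha> * ennreal \<alpha>)"
  have dist: "(\<integral>\<^sup>+x. indicator {..<g x} \<alpha> * ?w \<alpha> \<partial>(lborel :: 'a measure)) = ?w \<alpha> * distfun g \<alpha>" for \<alpha>
  proof (cases "0 < \<alpha>")
    case True
    have "(\<integral>\<^sup>+x. indicator {..<g x} \<alpha> * ?w \<alpha> \<partial>(lborel :: 'a measure)) = (\<integral>\<^sup>+x. ?w \<alpha> * indicator {x. \<bar>g x\<bar> > \<alpha>} x \<partial>lborel)"
      using g by (intro nn_integral_cong) (simp add: indicator_def)
    also have "\<dots> = ?w \<alpha> * distfun g \<alpha>"
      unfolding distfun_def by (rule nn_integral_cmult_indicator) simp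
    finally show ?thesis .
  next
    case False
    \<comment> \<open>For alpha <= 0 the set where g exceeds alpha is not the level set of |g| used
      in \<open>distfun\<close>, but the weight vanishes there.\<close>
    have "\<alpha> \<notin> {1/r<..}" using False r by (auto simp: not_less intro: order_trans[of \<alpha> 0 "1/r"])
    then have w0: "?w \<alpha> = 0" using False by simp
    show ?thesis unfolding w0 by simp
  qed
  have [measurable]: "Measurable.pred (lborel \<Otimes>\<^sub>M lborel) (\<lambda>p::'a \<times> real. snd p < g (fst p))"
    by measurable
  have [measurable]: "distfun g \<in> borel_measurable borel" by (rule borel_measurable_distfun) simp
  have "(\<integral>\<^sup>+x. ennreal (huber (r * g x)) \<partial>lborel) = (\<integral>\<^sup>+x. (\<integral>\<^sup>+\<alpha>. indicator {..<g x} \<alpha> * ?w \<alpha> \<partial>lborel) \<partial>lborel)"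
    using huber_layer_cake[OF r g] by simp
  also have "\<dots> = (\<integral>\<^sup>+\<alpha>. (\<integral>\<^sup>+x. indicator {..<g x} \<alpha> * ?w \<alpha> \<partial>lborel) \<partial>lborel)"
  proof (rule lborel_pair.Fubini'[symmetric])
    have "(\<lambda>p::'a \<times> real. (if snd p < g (fst p) then 1 else 0) * ?w (snd p)) \<in> borel_measurable (lborel \<Otimes>\<^sub>M lborel)"
      by measurable
    also have "(\<lambda>p::'a \<times> real. (if snd p < g (fst p) then 1 else 0) * ?w (snd p)) = case_prod (\<lambda>x \<alpha>. indicator {..<g x} \<alpha> * ?w \<alpha>)"
      by (auto simp: indicator_def)
    finally show "case_prod (\<lambda>x \<alpha>. indicator {..<g x} \<alpha> * ?w \<alpha>) \<in> borel_measurable (lborel \<Otimes>\<^sub>M lborel)" .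
  qed
  also have "\<dots> = (\<integral>\<^sup>+\<alpha>. ennreal r * (indicator {1 / r<..} \<alpha> * distfun g \<alpha>) + ennreal (r\<^sup>2) * (indicator {0<..<1 / r} \<alpha> * ennreal \<alpha> * distfun g \<alpha>) \<partial>lborel)"
    unfolding dist by (simp add: distrib_right mult.assoc)
  also have "\<dots> = ennreal r * (\<integral>\<^sup>+\<alpha>. indicator {1 / r<..} \<alpha> * distfun g \<alpha> \<partial>lborel) +
    ennreal (r\<^sup>2) * (\<integral>\<^sup>+\<alpha>. indicator {0<..<1 / r} \<alpha> * ennreal \<alpha> * distfun g \<alpha> \<partial>lborel)"
    by (simp add: nn_integral_add nn_integral_cmult)
  finally show ?thesis .
qed

context levy_symbol
begin

lemma modular_le_split:
  fixes f g :: "'b::euclidean_space \<Rightarrow> real"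
  assumes [measurable]: "f \<in> borel_measurable borel" "g \<in> borel_measurable borel"
    and le: "\<And>x. \<bar>f x\<bar> \<le> c * g x" and g: "\<And>x. 0 \<le> g x" and c: "0 \<le> c"
  shows "modular a nu f \<le> ennreal (a + (\<integral>r. min 1 (r\<^sup>2) \<partial>nu)) * (\<integral>\<^sup>+x. ennreal ((f x)\<^sup>2) \<partial>lborel)
     + ennreal (max c (c\<^sup>2)) * (\<integral>\<^sup>+r. (if \<bar>r\<bar> > 1 then \<integral>\<^sup>+x. ennreal (huber (\<bar>r\<bar> * g x)) \<partial>lborel else 0) \<partial>nu)"
proof -
  interpret P: pair_sigma_finite "lborel :: 'b measure" nu ..
  define K where "K = (\<integral>r. min 1 (r\<^sup>2) \<partial>nu)"
  have K0: "0 \<le> K" unfolding K_def by (intro Bochner_Integration.integral_nonneg) auto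
  have K: "(\<integral>\<^sup>+r. ennreal (min 1 (r\<^sup>2)) \<partial>nu) = ennreal K"
    unfolding K_def using integrable_min_sq by (intro nn_integral_eq_integral) auto
  let ?h = "\<lambda>x r. if \<bar>r\<bar> > 1 then ennreal (huber (\<bar>r\<bar> * g x)) else 0"
  have ptw: "levy_modular a nu (f x) \<le> ennreal (a + K) * ennreal ((f x)\<^sup>2) + ennreal (max c (c\<^sup>2)) * (\<integral>\<^sup>+r. ?h x r \<partial>nu)" for x
  proof -
    have "(\<integral>\<^sup>+r. ennreal (huber (r * f x)) \<partial>nu) \<le> (\<integral>\<^sup>+r. ennreal (min 1 (r\<^sup>2)) * ennreal ((f x)\<^sup>2) + ennreal (max c (c\<^sup>2)) * ?h x r \<partial>nu)"
    proof (intro nn_integral_mono)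
      fix r :: real
      show "ennreal (huber (r * f x)) \<le> ennreal (min 1 (r\<^sup>2)) * ennreal ((f x)\<^sup>2) + ennreal (max c (c\<^sup>2)) * ?h x r"
      proof (cases "\<bar>r\<bar> > 1")
        case True
        have "huber (r * f x) \<le> huber (c * (\<bar>r\<bar> * g x))"
          using le[of x] c g[of x] mult_left_mono[OF le[of x], of "\<bar>r\<bar>"]
          by (intro huber_mono) (simp add: abs_mult mult.left_commute)
        also have "\<dots> \<le> max c (c\<^sup>2) * huber (\<bar>r\<bar> * g x)" using huber_scale[of c "\<bar>r\<bar> * g x"] c by simp
        finally have "ennreal (huber (r * f x)) \<le> ennreal (max c (c\<^sup>2)) * ?h x r"
          using True c by (simp add: ennreal_mult[symmetric] ennreal_leI le_max_iff_disj)
        then show ?thesis by (rule order_trans) simp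
      next
        case False
        then have "r\<^sup>2 \<le> 1" by (simp add: abs_square_le_1)
        have "huber (r * f x) \<le> (r * f x)\<^sup>2 / 2" by (rule huber_le_sq)
        also have "\<dots> \<le> min 1 (r\<^sup>2) * (f x)\<^sup>2" using \<open>r\<^sup>2 \<le> 1\<close> by (simp add: power_mult_distrib)
        finally have "ennreal (huber (r * f x)) \<le> ennreal (min 1 (r\<^sup>2)) * ennreal ((f x)\<^sup>2)"
          by (simp add: ennreal_mult[symmetric] ennreal_leI)
        then show ?thesis by (rule order_trans) simp
      qed
    qed
    also have "\<dots> = ennreal K * ennreal ((f x)\<^sup>2) + ennreal (max c (c\<^sup>2)) * (\<integral>\<^sup>+r. ?h x r \<partial>nu)"
      by (simp add: nn_integral_add nn_integral_cmult nn_integral_multc K)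
    finally have "levy_modular a nu (f x) \<le> ennreal (a * (f x)\<^sup>2 / 2) + (ennreal K * ennreal ((f x)\<^sup>2) + ennreal (max c (c\<^sup>2)) * (\<integral>\<^sup>+r. ?h x r \<partial>nu))"
      unfolding levy_modular_def by (intro add_left_mono)
    also have "ennreal (a * (f x)\<^sup>2 / 2) \<le> ennreal a * ennreal ((f x)\<^sup>2)"
      by (simp add: ennreal_mult[symmetric] ennreal_leI)
    finally show ?thesis using K0 by (simp add: distrib_right add.assoc add_right_mono)
  qed
  have hm [measurable]: "case_prod ?h \<in> borel_measurable (lborel \<Otimes>\<^sub>M nu)" by measurable
  have "modular a nu f \<le> (\<integral>\<^sup>+x. ennreal (a + K) * ennreal ((f x)\<^sup>2) + ennreal (max c (c\<^sup>2)) * (\<integral>\<^sup>+r. ?h x r \<partial>nu) \<partial>lborel)"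
    unfolding modular_def by (intro nn_integral_mono ptw)
  also have "\<dots> = ennreal (a + K) * (\<integral>\<^sup>+x. ennreal ((f x)\<^sup>2) \<partial>lborel) + ennreal (max c (c\<^sup>2)) * (\<integral>\<^sup>+x. (\<integral>\<^sup>+r. ?h x r \<partial>nu) \<partial>lborel)"
    by (subst nn_integral_add) (simp_all add: nn_integral_cmult)
  also have "(\<integral>\<^sup>+x. (\<integral>\<^sup>+r. ?h x r \<partial>nu) \<partial>lborel) = (\<integral>\<^sup>+r. (\<integral>\<^sup>+x. ?h x r \<partial>lborel) \<partial>nu)"
    by (rule P.Fubini'[symmetric]) (rule hm)
  also have "\<dots> = (\<integral>\<^sup>+r. (if \<bar>r\<bar> > 1 then \<integral>\<^sup>+x. ennreal (huber (\<bar>r\<bar> * g x)) \<partial>lborel else 0) \<partial>nu)"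
    by (intro nn_integral_cong) simp
  finally show ?thesis by (simp add: K_def)
qed

end

text \<open>That the formula defines a process is split into two claims: the integrals exist, and
  every selection of versions \<open>s\<close> is a stationary generalized random process.\<close>

theorem theorem3p5:
  fixes M :: "'w measure"
    and G :: "'a::euclidean_space \<Rightarrow> real"
    and Ld :: "('a \<Rightarrow> real) \<Rightarrow> 'w \<Rightarrow> real"
    and L :: "'a set \<Rightarrow> 'w \<Rightarrow> real"
    and a \<gamma> :: real
    and nu :: "real measure"
  assumes "prob_space M"
    and "locally_integrable G"
    and "\<forall>phis. D_conv phis (\<lambda>_. 0) \<longrightarrow>
           (\<lambda>n. \<integral>\<^sup>+ x. ennreal ((convolution G (phis n) x)\<^sup>2) \<partial>lborel) \<longlonglongrightarrow> 0"
    and "levy_white_noise M a \<gamma> nu Ld"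
    and "levy_basis M a \<gamma> nu L"
    and "\<forall>phi. test_fun phi \<longrightarrow> RR_integral M L phi (Ld phi)"
    and "\<forall>phi. test_fun phi \<longrightarrow> integrable M (Ld phi) \<and> (\<integral>\<omega>. Ld phi \<omega> \<partial>M) = 0"
    and "\<forall>R>0. (\<integral>\<^sup>+ r. (if \<bar>r\<bar> > 1 then ennreal \<bar>r\<bar> *
              (\<integral>\<^sup>+ \<alpha>. indicator {1 / \<bar>r\<bar><..} \<alpha> * distfun (G_R G R) \<alpha> \<partial>lborel) else 0) \<partial>nu) < \<infinity>"
    and "\<forall>R>0. (\<integral>\<^sup>+ r. (if \<bar>r\<bar> > 1 then ennreal (\<bar>r\<bar>\<^sup>2) *
              (\<integral>\<^sup>+ \<alpha>. indicator {0<..<1 / \<bar>r\<bar>} \<alpha> * ennreal \<alpha> * distfun (G_R G R) \<alpha> \<partial>lborel) else 0) \<partial>nu) < \<infinity>"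
  shows "(\<forall>phi. test_fun phi \<longrightarrow> (\<exists>X. RR_integral M L (convolution G phi) X)) \<and>
         (\<forall>s. (\<forall>phi. test_fun phi \<longrightarrow> RR_integral M L (convolution G phi) (s phi)) \<longrightarrow>
              gen_random_process M s \<and> stationary_process M s)"
proof -
  interpret nu: centered_levy_symbol a \<gamma> nu
    using assms(7) by (intro levy_white_noise_centered[OF assms(1,4)]) auto
  interpret centered_levy_basis M a \<gamma> nu L
    using assms(1,5) nu.centered_levy_symbol_axioms
    by (simp add: centered_levy_basis_def centered_levy_basis_axioms_def)
  note Gm [measurable] = G_measurable[OF assms(2)] borel_measurable_G_R[OF assms(2)]
  have conv_meas [measurable]: "test_fun phi \<Longrightarrow> convolution G phi \<in> borel_measurable borel" for phi
    by (rule borel_measurable_convolution[OF assms(2)])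
  define T where "T R = (\<integral>\<^sup>+r. (if \<bar>r\<bar> > 1 then \<integral>\<^sup>+x. ennreal (huber (\<bar>r\<bar> * G_R G R x)) \<partial>lborel else 0) \<partial>nu)" for R
  have T_fin: "T R < \<infinity>" if R: "R > 0" for R
  proof -
    let ?I = "\<lambda>r. ennreal \<bar>r\<bar> * (\<integral>\<^sup>+ \<alpha>. indicator {1 / \<bar>r\<bar><..} \<alpha> * distfun (G_R G R) \<alpha> \<partial>lborel)"
    let ?J = "\<lambda>r. ennreal (\<bar>r\<bar>\<^sup>2) * (\<integral>\<^sup>+ \<alpha>. indicator {0<..<1 / \<bar>r\<bar>} \<alpha> * ennreal \<alpha> * distfun (G_R G R) \<alpha> \<partial>lborel)"
    have "T R = (\<integral>\<^sup>+r. (if \<bar>r\<bar> > 1 then ?I r else 0) + (if \<bar>r\<bar> > 1 then ?J r else 0) \<partial>nu)"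
      unfolding T_def
    proof (intro nn_integral_cong)
      fix r :: real
      have "(\<integral>\<^sup>+x. ennreal (huber (\<bar>r\<bar> * G_R G R x)) \<partial>lborel) = ?I r + ?J r" if "\<bar>r\<bar> > 1"
        by (rule nn_integral_huber_layer_cake[OF Gm(2) G_R_nonneg[OF assms(2)]]) (use that in simp)
      then show "(if \<bar>r\<bar> > 1 then \<integral>\<^sup>+x. ennreal (huber (\<bar>r\<bar> * G_R G R x)) \<partial>lborel else 0)
          = (if \<bar>r\<bar> > 1 then ?I r else 0) + (if \<bar>r\<bar> > 1 then ?J r else 0)"
        by (cases "\<bar>r\<bar> > 1") (simp_all only: if_True if_False add_0)
    qed
    also have "\<dots> = (\<integral>\<^sup>+r. (if \<bar>r\<bar> > 1 then ?I r else 0) \<partial>nu) + (\<integral>\<^sup>+r. (if \<bar>r\<bar> > 1 then ?J r else 0) \<partial>nu)"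
    proof (rule nn_integral_add)
      have [measurable]: "distfun (G_R G R) \<in> borel_measurable borel" by (intro borel_measurable_distfun Gm)
      have "(\<lambda>r. \<integral>\<^sup>+ \<alpha>. (if 1 / \<bar>r\<bar> < \<alpha> then distfun (G_R G R) \<alpha> else 0) \<partial>lborel) \<in> borel_measurable borel"
        by measurable
      also have "(\<lambda>r. \<integral>\<^sup>+ \<alpha>. (if 1 / \<bar>r\<bar> < \<alpha> then distfun (G_R G R) \<alpha> else 0) \<partial>lborel)
          = (\<lambda>r. \<integral>\<^sup>+ \<alpha>. indicator {1 / \<bar>r\<bar><..} \<alpha> * distfun (G_R G R) \<alpha> \<partial>lborel)"
        by (intro ext nn_integral_cong) (simp add: indicator_def)
      finally have [measurable]: "(\<lambda>r. \<integral>\<^sup>+ \<alpha>. indicator {1 / \<bar>r\<bar><..} \<alpha> * distfun (G_R G R) \<alpha> \<partial>lborel) \<in> borel_measurable borel" .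
      have "(\<lambda>r. \<integral>\<^sup>+ \<alpha>. (if 0 < \<alpha> \<and> \<alpha> < 1 / \<bar>r\<bar> then ennreal \<alpha> * distfun (G_R G R) \<alpha> else 0) \<partial>lborel) \<in> borel_measurable borel"
        by measurable
      also have "(\<lambda>r. \<integral>\<^sup>+ \<alpha>. (if 0 < \<alpha> \<and> \<alpha> < 1 / \<bar>r\<bar> then ennreal \<alpha> * distfun (G_R G R) \<alpha> else 0) \<partial>lborel)
          = (\<lambda>r. \<integral>\<^sup>+ \<alpha>. indicator {0<..<1 / \<bar>r\<bar>} \<alpha> * ennreal \<alpha> * distfun (G_R G R) \<alpha> \<partial>lborel)"
        by (intro ext nn_integral_cong) (simp add: indicator_def)
      finally have [measurable]: "(\<lambda>r. \<integral>\<^sup>+ \<alpha>. indicator {0<..<1 / \<bar>r\<bar>} \<alpha> * ennreal \<alpha> * distfun (G_R G R) \<alpha> \<partial>lborel) \<in> borel_measurable borel" .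
      show "(\<lambda>r. if \<bar>r\<bar> > 1 then ?I r else 0) \<in> borel_measurable nu" "(\<lambda>r. if \<bar>r\<bar> > 1 then ?J r else 0) \<in> borel_measurable nu"
        unfolding nu.measurable_nu by measurable
    qed
    also have "\<dots> < \<infinity>" using assms(8,9) R by simp
    finally show ?thesis .
  qed
  define L2 where "L2 f = (\<integral>\<^sup>+x. ennreal ((f x)\<^sup>2) \<partial>(lborel :: 'a measure))" for f
  define K where "K = a + (\<integral>r. min 1 (r\<^sup>2) \<partial>nu)"
  \<comment> \<open>R depends on the support of phi only and c on its size only. Along a sequence
    converging to 0 in the space of test functions, \<open>T R\<close> is therefore a fixed finite
    number while c tends to 0.\<close>
  have mod_le: "modular a nu (convolution G phi) \<le> ennreal K * L2 (convolution G phi) + ennreal (max c (c\<^sup>2)) * T R"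
    if phi: "test_fun phi" "{x. phi x \<noteq> 0} \<subseteq> ball 0 R" and c: "\<And>x. \<bar>phi x\<bar> \<le> c" for phi c R
  proof -
    have "0 \<le> c" using c[of 0] by linarith
    then show ?thesis unfolding K_def L2_def T_def
      by (intro nu.modular_le_split conv_meas[OF phi(1)] Gm convolution_le[OF assms(2) phi c] G_R_nonneg[OF assms(2)])
  qed
  have L2_fin: "L2 (convolution G phi) < \<infinity>" if phi: "test_fun phi" for phi
  proof -
    have "(\<lambda>n. L2 (convolution G (\<lambda>x. phi x / real (Suc n)))) \<longlonglongrightarrow> 0"
      using assms(3) D_conv_divide_Suc[OF phi] unfolding L2_def by blast
    then have "eventually (\<lambda>n. L2 (convolution G (\<lambda>x. phi x / real (Suc n))) < 1) sequentially"
      by (rule order_tendstoD) simp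
    \<comment> \<open>A single index with norm below 1 is enough: convolution is linear in phi, so
      the squared norm for phi itself is larger by the factor (n + 1)^2.\<close>
    then obtain n where n: "L2 (convolution G (\<lambda>x. phi x / real (Suc n))) < 1"
      by (auto simp: eventually_sequentially)
    have "convolution G phi x = real (Suc n) * convolution G (\<lambda>x. phi x / real (Suc n)) x" for x
      by (simp add: convolution_def del: of_nat_Suc)
    then have "L2 (convolution G phi) = (\<integral>\<^sup>+x. ennreal ((real (Suc n))\<^sup>2) * ennreal ((convolution G (\<lambda>x. phi x / real (Suc n)) x)\<^sup>2) \<partial>lborel)"
      unfolding L2_def by (intro nn_integral_cong) (simp add: power_mult_distrib ennreal_mult del: of_nat_Suc)
    also have "\<dots> = ennreal ((real (Suc n))\<^sup>2) * L2 (convolution G (\<lambda>x. phi x / real (Suc n)))"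
    proof -
      have [measurable]: "convolution G (\<lambda>x. phi x / real (Suc n)) \<in> borel_measurable borel"
        using test_fun_cmult[OF phi, of "1 / real (Suc n)"] by (intro conv_meas) simp
      show ?thesis unfolding L2_def by (rule nn_integral_cmult) measurable
    qed
    also have "\<dots> < \<infinity>" using n by (auto simp: ennreal_mult_less_top intro: less_trans)
    finally show ?thesis .
  qed
  have mod_fin: "modular a nu (convolution G phi) < \<infinity>" if phi: "test_fun phi" for phi
  proof -
    obtain B where B: "\<And>x. \<bar>phi x\<bar> \<le> B" using test_fun_bounded[OF phi] by blast
    obtain R where R: "0 < R" "{x. phi x \<noteq> 0} \<subseteq> ball 0 R" using phi by (rule test_fun_support)
    show ?thesis
      by (rule le_less_trans[OF mod_le[OF phi R(2) B]]) (use L2_fin[OF phi] T_fin[OF R(1)] in \<open>simp add: ennreal_mult_less_top\<close>)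
  qed
  have exists: "\<exists>X. RR_integral M L (convolution G phi) X \<and> has_levy_char (convolution G phi) X" if "test_fun phi" for phi
    using conv_meas[OF that] mod_fin[OF that] by (rule RR_integral_exists)
  have "gen_random_process M s \<and> stationary_process M s"
    if s: "\<forall>phi. test_fun phi \<longrightarrow> RR_integral M L (convolution G phi) (s phi)" for s
  proof
    have s_meas [measurable]: "s phi \<in> borel_measurable M" if "test_fun phi" for phi
      using s that by (auto simp: RR_integral_def conv_prob_def)
    \<comment> \<open>The given version \<open>s phi\<close> may stem from any approximating
      sequence. By uniqueness it agrees almost surely with the version constructed in
      \<open>RR_integral_exists\<close>, whose characteristic function is known.\<close>
    have s_char: "has_levy_char (convolution G phi) (s phi)" if phi: "test_fun phi" for phi
    proof -
      obtain X where X: "RR_integral M L (convolution G phi) X" "has_levy_char (convolution G phi) X" using exists[OF phi] by blast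
      have AE: "AE \<omega> in M. X \<omega> = s phi \<omega>" using s phi by (intro RR_integral_unique[OF X(1)]) blast
      have [measurable]: "X \<in> borel_measurable M" "s phi \<in> borel_measurable M"
        using X(2) s_meas[OF phi] by (auto simp: has_levy_char_def)
      have "(\<integral>\<omega>. cis (z * s phi \<omega>) \<partial>M) = (\<integral>\<omega>. cis (z * X \<omega>) \<partial>M)" for z
        using AE by (intro integral_cong_AE) auto
      then show ?thesis using X(2) by (simp add: has_levy_char_def)
    qed
    have s_lin: "AE \<omega> in M. s (\<lambda>x. \<alpha> * phi x + \<beta> * psi x) \<omega> = \<alpha> * s phi \<omega> + \<beta> * s psi \<omega>"
      if phi: "test_fun phi" and psi: "test_fun psi" for phi psi \<alpha> \<beta>
    proof (rule RR_integral_lincomb_AE)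
      show "RR_integral M L (convolution G phi) (s phi)" "RR_integral M L (convolution G psi) (s psi)"
        using s phi psi by auto
      show "RR_integral M L (\<lambda>x. \<alpha> * convolution G phi x + \<beta> * convolution G psi x) (s (\<lambda>x. \<alpha> * phi x + \<beta> * psi x))"
        using s test_fun_lincomb[OF phi psi, of \<alpha> \<beta>] convolution_lincomb[OF assms(2) phi psi, of \<alpha> \<beta>] by metis
    qed
    have s_cont: "conv_prob M (\<lambda>n. s (phis n)) (s phi)" if D: "D_conv phis phi" for phis phi
    proof (rule conv_probI)
      have phis: "test_fun (phis n)" and phi: "test_fun phi" for n using D by (auto simp: D_conv_def)
      show "s (phis n) \<in> borel_measurable M" "s phi \<in> borel_measurable M" for n
        using phis phi by auto
      fix e :: real assume e: "e > 0"
      define d where "d n = (\<lambda>x. phis n x - phi x)" for n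
      have d: "test_fun (d n)" for n unfolding d_def using phis phi by (rule test_fun_diff)
      have D0: "D_conv d (\<lambda>_. 0)" unfolding d_def using D by (rule D_conv_diff_zero)
      obtain K' where K': "compact K'" "\<And>n. {x. d n x \<noteq> 0} \<subseteq> K'" using D0 unfolding D_conv_def by blast
      obtain R where R: "R > 0" "K' \<subseteq> ball 0 R" using bounded_subset_ballD[OF compact_imp_bounded[OF K'(1)], of 0] by blast
      have supp: "{x. d n x \<noteq> 0} \<subseteq> ball 0 R" for n using K'(2) R(2) by (rule order_trans)
      have unif: "uniform_limit UNIV d (\<lambda>_. 0) sequentially"
      proof -
        have "\<forall>vs. set vs \<subseteq> Basis \<longrightarrow> uniform_limit UNIV (\<lambda>n. dirderiv vs (\<lambda>x. d n x - 0)) (\<lambda>_. 0) sequentially"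
          using D0 by (simp add: D_conv_def)
        from this[rule_format, of "[]"] show ?thesis by simp
      qed
      have L2_lim: "(\<lambda>n. L2 (convolution G (d n))) \<longlonglongrightarrow> 0" using assms(3) D0 unfolding L2_def by blast
      have mod_lim: "(\<lambda>n. modular a nu (convolution G (d n))) \<longlonglongrightarrow> 0"
      proof (rule order_tendstoI)
        fix \<epsilon> :: ennreal assume \<epsilon>: "0 < \<epsilon>"
        \<comment> \<open>Half of the tolerance goes to the large jumps. The bound c <= 1 reduces
          max(c, c^2) to c in \<open>mod_le\<close>; uniform convergence then brings the test
          functions below c, and the L2 hypothesis supplies the other half.\<close>
        have "\<exists>c>0. c \<le> 1 \<and> ennreal c * T R < \<epsilon> / 2"
        proof -
          have "(\<lambda>n. ennreal (inverse (real (Suc n))) * T R) \<longlonglongrightarrow> ennreal 0 * T R"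
            using T_fin[OF R(1)] by (intro tendsto_mult_ennreal tendsto_ennrealI LIMSEQ_inverse_real_of_nat tendsto_const) auto
          then have "eventually (\<lambda>n. ennreal (inverse (real (Suc n))) * T R < \<epsilon> / 2) sequentially"
            by (rule order_tendstoD) (use \<epsilon> in \<open>simp add: ennreal_zero_less_divide\<close>)
          then obtain n where "ennreal (inverse (real (Suc n))) * T R < \<epsilon> / 2" by (auto simp: eventually_sequentially)
          then show ?thesis by (intro exI[of _ "inverse (real (Suc n))"]) (auto simp: field_simps)
        qed
        then obtain c where c: "c > 0" "c \<le> 1" "ennreal c * T R < \<epsilon> / 2" by blast
        have "(\<lambda>n. ennreal K * L2 (convolution G (d n))) \<longlonglongrightarrow> ennreal K * 0"
          using L2_lim by (intro tendsto_mult_ennreal tendsto_const) auto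
        then have "eventually (\<lambda>n. ennreal K * L2 (convolution G (d n)) < \<epsilon> / 2) sequentially"
          by (rule order_tendstoD) (use \<epsilon> in \<open>simp add: ennreal_zero_less_divide\<close>)
        moreover have "eventually (\<lambda>n. \<forall>x\<in>UNIV. dist (d n x) 0 < c) sequentially"
          using unif c(1) by (simp add: uniform_limit_iff)
        ultimately show "eventually (\<lambda>n. modular a nu (convolution G (d n)) < \<epsilon>) sequentially"
        proof eventually_elim
          case (elim n)
          have "max c (c\<^sup>2) = c" using c mult_left_mono[of c 1 c] by (simp add: power2_eq_square max_def)
          then have "modular a nu (convolution G (d n)) \<le> ennreal K * L2 (convolution G (d n)) + ennreal c * T R"
            using mod_le[OF d supp, of n c] elim(2) by (auto simp: dist_real_def less_imp_le)
          also have "\<dots> < \<epsilon> / 2 + \<epsilon> / 2" using elim(1) c(3) by (rule add_strict_mono)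
          also have "\<dots> = \<epsilon>" by (cases \<epsilon>) (simp_all add: ennreal_divide_numeral ennreal_top_divide ennreal_plus[symmetric] del: ennreal_plus)
          finally show ?case .
        qed
      qed simp
      have "(\<lambda>n. enn2real (modular a nu (convolution G (d n)))) \<longlonglongrightarrow> enn2real 0"
        using mod_lim by (intro tendsto_enn2real) auto
      then have lim: "(\<lambda>n. 8 * max (2/e) ((2/e)\<^sup>2) * enn2real (modular a nu (convolution G (d n)))) \<longlonglongrightarrow> 0"
        by (intro tendsto_mult_right_zero) simp
      have "prob {\<omega>\<in>space M. e < \<bar>s (phis n) \<omega> - s phi \<omega>\<bar>} \<le> 8 * max (2/e) ((2/e)\<^sup>2) * enn2real (modular a nu (convolution G (d n)))" for n
      proof -
        have [measurable]: "s (phis n) \<in> borel_measurable M" "s phi \<in> borel_measurable M" "s (d n) \<in> borel_measurable M"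
          using phis phi d by auto
        have "AE \<omega> in M. s (d n) \<omega> = s (phis n) \<omega> - s phi \<omega>"
          using s_lin[OF phis[of n] phi, of 1 "-1"] by (simp add: d_def)
        then have "prob {\<omega>\<in>space M. e < \<bar>s (phis n) \<omega> - s phi \<omega>\<bar>} = prob {\<omega>\<in>space M. e < \<bar>s (d n) \<omega>\<bar>}"
          by (intro measure_eq_AE) auto
        also have "\<dots> \<le> 8 * max (2/e) ((2/e)\<^sup>2) * enn2real (modular a nu (convolution G (d n)))"
          using s_char[OF d] e by (rule has_levy_char_tail)
        finally show ?thesis .
      qed
      then show "(\<lambda>n. prob {\<omega>\<in>space M. e < \<bar>s (phis n) \<omega> - s phi \<omega>\<bar>}) \<longlonglongrightarrow> 0"
        by (intro tendsto_sandwich[OF _ _ tendsto_const lim] always_eventually allI) simp_all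
    qed
    show "gen_random_process M s"
      unfolding gen_random_process_def using s_meas s_lin s_cont by blast
    have s_sum: "AE \<omega> in M. s (\<lambda>x. \<Sum>i\<in>J. z i * f i x) \<omega> = (\<Sum>i\<in>J. z i * s (f i) \<omega>)"
      if "finite J" "\<And>i. i \<in> J \<Longrightarrow> test_fun (f i)" for J z and f :: "('a \<Rightarrow> real) \<Rightarrow> 'a \<Rightarrow> real"
      using that
    proof (induction J rule: finite_induct)
      case empty
      show ?case using s_lin[OF test_fun_zero test_fun_zero, of 0 0] by simp
    next
      case (insert i J)
      have "AE \<omega> in M. s (\<lambda>x. z i * f i x + 1 * (\<Sum>i\<in>J. z i * f i x)) \<omega> = z i * s (f i) \<omega> + 1 * s (\<lambda>x. \<Sum>i\<in>J. z i * f i x) \<omega>"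
        using insert by (intro s_lin test_fun_sum) auto
      moreover have "AE \<omega> in M. s (\<lambda>x. \<Sum>i\<in>J. z i * f i x) \<omega> = (\<Sum>i\<in>J. z i * s (f i) \<omega>)"
        using insert by simp
      ultimately show ?case by eventually_elim (use insert in simp)
    qed
    \<comment> \<open>The Cramer-Wold idea: by linearity a combination of values of \<open>s\<close>
      is one value of \<open>s\<close> at a combined test function, so joint characteristic
      functions reduce to the one-dimensional formula at z = 1.\<close>
    have s_joint: "(\<integral>\<omega>. cis (\<Sum>i\<in>J. z i * s (f i) \<omega>) \<partial>M) = exp (\<integral>x. psi (convolution G (\<lambda>x. \<Sum>i\<in>J. z i * f i x) x) \<partial>lborel)"
      if J: "finite J" "\<And>i. i \<in> J \<Longrightarrow> test_fun (f i)" for J z and f :: "('a \<Rightarrow> real) \<Rightarrow> 'a \<Rightarrow> real"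
    proof -
      have t: "test_fun (\<lambda>x. \<Sum>i\<in>J. z i * f i x)" using J by (rule test_fun_sum)
      have "(\<integral>\<omega>. cis (\<Sum>i\<in>J. z i * s (f i) \<omega>) \<partial>M) = (\<integral>\<omega>. cis (1 * s (\<lambda>x. \<Sum>i\<in>J. z i * f i x) \<omega>) \<partial>M)"
      proof (rule integral_cong_AE)
        have [measurable]: "s (\<lambda>x. \<Sum>i\<in>J. z i * f i x) \<in> borel_measurable M" using t by (rule s_meas)
        have [measurable]: "(\<lambda>\<omega>. \<Sum>i\<in>J. z i * s (f i) \<omega>) \<in> borel_measurable M"
          using J by (intro borel_measurable_sum borel_measurable_times s_meas) auto
        show "(\<lambda>\<omega>. cis (\<Sum>i\<in>J. z i * s (f i) \<omega>)) \<in> borel_measurable M"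
          "(\<lambda>\<omega>. cis (1 * s (\<lambda>x. \<Sum>i\<in>J. z i * f i x) \<omega>)) \<in> borel_measurable M" by measurable
        show "AE \<omega> in M. cis (\<Sum>i\<in>J. z i * s (f i) \<omega>) = cis (1 * s (\<lambda>x. \<Sum>i\<in>J. z i * f i x) \<omega>)"
        proof -
          have "AE \<omega> in M. s (\<lambda>x. \<Sum>i\<in>J. z i * f i x) \<omega> = (\<Sum>i\<in>J. z i * s (f i) \<omega>)"
            using J by (rule s_sum)
          then show ?thesis by eventually_elim simp
        qed
      qed
      also have "\<dots> = exp (\<integral>x. psi (1 * convolution G (\<lambda>x. \<Sum>i\<in>J. z i * f i x) x) \<partial>lborel)"
        using s_char[OF t] by (simp only: has_levy_char_def)
      finally show ?thesis by simp
    qed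
    show "stationary_process M s"
      unfolding stationary_process_def
    proof
      fix t :: 'a
      show "distr M (Pi\<^sub>M {phi. test_fun phi} (\<lambda>_. borel)) (\<lambda>\<omega>. \<lambda>phi\<in>{phi. test_fun phi}. s (\<lambda>x. phi (x - t)) \<omega>)
        = distr M (Pi\<^sub>M {phi. test_fun phi} (\<lambda>_. borel)) (\<lambda>\<omega>. \<lambda>phi\<in>{phi. test_fun phi}. s phi \<omega>)"
      proof (rule process_law_unique)
        fix J :: "('a \<Rightarrow> real) set" and z assume J: "finite J" "J \<subseteq> {phi. test_fun phi}"
        let ?F = "\<lambda>x. \<Sum>phi\<in>J. z phi * phi x"
        have F: "test_fun ?F" using J by (intro test_fun_sum) auto
        have "(\<integral>\<omega>. cis (\<Sum>phi\<in>J. z phi * s (\<lambda>x. phi (x - t)) \<omega>) \<partial>M) = exp (\<integral>x. psi (convolution G (\<lambda>x. ?F (x - t)) x) \<partial>lborel)"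
          using J by (intro s_joint test_fun_shift) auto
        also have "(\<integral>x. psi (convolution G (\<lambda>x. ?F (x - t)) x) \<partial>lborel) = (\<integral>x. psi (convolution G ?F (x - t)) \<partial>lborel)"
          by (simp only: convolution_shift[of G ?F t])
        also have "\<dots> = (\<integral>x. psi (convolution G ?F x) \<partial>lborel)"
        proof (rule integral_lborel_shift[of "\<lambda>x. psi (convolution G ?F x)"])
          have [measurable]: "convolution G ?F \<in> borel_measurable borel" using F by (rule conv_meas)
          show "(\<lambda>x. psi (convolution G ?F x)) \<in> borel_measurable borel" by measurable
        qed
        also have "exp \<dots> = (\<integral>\<omega>. cis (\<Sum>phi\<in>J. z phi * s phi \<omega>) \<partial>M)"
          using J by (intro s_joint[symmetric]) auto
        finally show "(\<integral>\<omega>. cis (\<Sum>phi\<in>J. z phi * s (\<lambda>x. phi (x - t)) \<omega>) \<partial>M) = (\<integral>\<omega>. cis (\<Sum>phi\<in>J. z phi * s phi \<omega>) \<partial>M)" .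
      qed (auto intro: s_meas test_fun_shift)
    qed
  qed
  then show ?thesis using exists by blast
qed

end
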